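(* Let $N\in\mathbb N_0$ and let $\sigma\in L^\infty(\mathbb{R}^n\times\mathbb{R}^n)\cap\mathcal C^\infty(\{(\xi,\eta)\in\mathbb{R}^n\times\mathbb{R}^n:|\xi||\eta|\ne0\})$ satisfy $|\partial_1^{\alpha_1}\partial_2^{\alpha_2}\sigma(\xi,\eta)|\le C_{\alpha_1,\alpha_2}|\xi|^{-|\alpha_1|}|\eta|^{-|\alpha_2|}$ for all multiindices and all $\xi\ne0,\eta\ne0$. Assume that for all $a_1,a_2\in\mathcal O_N(\mathbb{R}^n)$ there is a locally integrable $b$ with $b(x)\le C|x|^{-2n-N-1}$ for large $|x|$ and $|T_\sigma(a_1,a_2)(x)|\le b(x)$ for all $x$. Then the following are equivalent: (a) For all $\alpha\in\mathbb N_0^n$ with $|\alpha|\le N$ and all $\xi_1\in\mathbb{R}^n\setminus\{0\}$, $\partial_2^\alpha\sigma(\xi_1,-\xi_1)=0$. (b) For all $a_1,a_2\in\mathcal O_N(\mathbb{R}^n)$ and all $|\alpha|\le N$, $\int_{\mathbb{R}^n}x^\alpha T_\sigma(a_1,a_2)(x)\,dx=0$.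
   Context: $\widehat f(\xi)=\int f(x)e^{-2\pi ix\cdot\xi}dx$. $T_\sigma(f_1,f_2)(x)=\int_{\mathbb{R}^{2n}}e^{2\pi ix\cdot(\xi_1+\xi_2)}\sigma(\xi_1,\xi_2)\widehat{f_1}(\xi_1)\widehat{f_2}(\xi_2)\,d\xi_1d\xi_2$. $\partial_1^\alpha,\partial_2^\alpha$ denote partial derivatives of order $\alpha$ in the first and second $\mathbb{R}^n$-variable respectively. $\mathcal O_N(\mathbb{R}^n)=\{f\in\mathcal C_c^\infty(\mathbb{R}^n):\int x^\beta f(x)dx=0\ \forall|\beta|\le N\}$. *)

theory Defs
  imports "HOL-Analysis.Analysis"
begin

definition fourier :: "(real^'n \<Rightarrow> complex) \<Rightarrow> real^'n \<Rightarrow> complex" where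
  "fourier f \<xi> = (LINT x|lborel. f x * cis (- 2 * pi * (x \<bullet> \<xi>)))"

definition Tsig :: "((real^'n) \<times> (real^'n) \<Rightarrow> complex) \<Rightarrow> (real^'n \<Rightarrow> complex)
     \<Rightarrow> (real^'n \<Rightarrow> complex) \<Rightarrow> real^'n \<Rightarrow> complex" where
  "Tsig \<sigma> f1 f2 x = (LINT z|lborel. cis (2 * pi * (x \<bullet> (fst z + snd z))) * \<sigma> z
        * fourier f1 (fst z) * fourier f2 (snd z))"

definition dirder :: "'v::real_normed_vector \<Rightarrow> ('v \<Rightarrow> 'b::real_normed_vector) \<Rightarrow> 'v \<Rightarrow> 'b" where
  "dirder v f x = vector_derivative (\<lambda>t. f (x + t *\<^sub>R v)) (at 0)"

fun dders :: "'v::real_normed_vector list \<Rightarrow> ('v \<Rightarrow> 'b::real_normed_vector) \<Rightarrow> 'v \<Rightarrow> 'b" where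
  "dders [] f = f"
| "dders (v # vs) f = dirder v (dders vs f)"

definition smooth_on :: "'v::euclidean_space set \<Rightarrow> ('v \<Rightarrow> 'b::real_normed_vector) \<Rightarrow> bool" where
  "smooth_on S f \<longleftrightarrow> (\<forall>vs. set vs \<subseteq> Basis \<longrightarrow>
      continuous_on S (dders vs f) \<and>
      (\<forall>x\<in>S. \<forall>v\<in>Basis. (\<lambda>t. dders vs f (x + t *\<^sub>R v)) differentiable (at 0)))"

definition mabs :: "('n::finite \<Rightarrow> nat) \<Rightarrow> nat" where
  "mabs \<alpha> = (\<Sum>i\<in>UNIV. \<alpha> i)"

definition monom :: "('n::finite \<Rightarrow> nat) \<Rightarrow> real^'n \<Rightarrow> real" where
  "monom \<alpha> x = (\<Prod>i\<in>UNIV. (x $ i) ^ \<alpha> i)"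

text \<open>A canonical list of indices in which index i occurs alpha i times (the order is
  irrelevant for smooth functions).\<close>
definition mlist :: "('n::finite \<Rightarrow> nat) \<Rightarrow> 'n list" where
  "mlist \<alpha> = (SOME l. \<forall>i. count_list l i = \<alpha> i)"

definition pd2 :: "('n::finite \<Rightarrow> nat) \<Rightarrow> ('n \<Rightarrow> nat)
     \<Rightarrow> ((real^'n) \<times> (real^'n) \<Rightarrow> complex) \<Rightarrow> (real^'n) \<times> (real^'n) \<Rightarrow> complex" where
  "pd2 \<alpha>1 \<alpha>2 f = dders (map (\<lambda>i. (axis i 1, 0)) (mlist \<alpha>1) @ map (\<lambda>i. (0, axis i 1)) (mlist \<alpha>2)) f"

definition O_N :: "nat \<Rightarrow> ((real^'n::finite) \<Rightarrow> complex) set" where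
  "O_N N = {f. smooth_on UNIV f \<and> compact (closure {x. f x \<noteq> 0}) \<and>
      (\<forall>\<beta>. mabs \<beta> \<le> N \<longrightarrow> (LINT x|lborel. of_real (monom \<beta> x) * f x) = 0)}"

end

theory Submission
  imports Defs "HOL-Probability.Characteristic_Functions" "HOL-Probability.Sinc_Integral"
begin

text \<open>After the substitution \<open>\<zeta> = \<xi> + \<eta>\<close>, the function \<open>T = Tsig \<sigma> a1 a2\<close> is the inverse Fourier
  transform of \<open>G \<zeta> = \<integral> \<sigma> (\<xi>, \<zeta> - \<xi>) fourier a1 \<xi> fourier a2 (\<zeta> - \<xi>) d\<xi>\<close>. The decay of \<open>T\<close> makes
  Fourier inversion available and allows differentiating \<open>fourier T = G\<close> up to order \<open>N\<close>. Since
  \<open>fourier a2\<close> vanishes to order \<open>N + 1\<close> at \<open>0\<close>, which beats the singularities of \<open>\<sigma>\<close>, one may also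
  differentiate under the integral. At \<open>\<zeta> = 0\<close> the moments of \<open>T\<close> thus equal, up to constants,
  \<open>\<integral> fourier a1 \<xi> [\<partial>\<^sub>\<eta>\<^sup>\<alpha> (\<sigma> (\<xi>, \<eta>) fourier a2 \<eta>)] d\<xi>\<close> evaluated at \<open>\<eta> = - \<xi>\<close>. By the Leibniz rule this
  vanishes under (a). Conversely, by induction on the order only the term with all derivatives on
  \<open>\<sigma>\<close> survives, and translating \<open>a1\<close> turns the vanishing integrals into the Fourier transform of
  \<open>\<partial>\<^sub>2\<^sup>\<alpha>\<sigma> (\<xi>, - \<xi>) fourier a1 \<xi> fourier a2 (- \<xi>)\<close>.\<close>

section \<open>Integration over Euclidean space\<close>

text \<open>After the substitution only the second slot of \<open>\<sigma>\<close> depends on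
  \<zeta>, so no derivative in the first variable is ever taken, and in the moment computation
  \<open>a1\<close> enters through the integrability of its transform. The delicate place is \<eta>
  = 0. There k derivatives on \<open>\<sigma>\<close> cost |\<eta>|^(-k), while m derivatives on
  \<open>fourier a2\<close> leave |\<eta>|^(N+1-m). A Leibniz term of order j = k + m is thus
  O(|\<eta>|^(N+1-j)): it still tends to 0 for j = N, and for j < N the value 0 continues it
  differentiably. The rate 2n + N + 1 leaves room for the factor |x|^(2n) of the integrability
  criterion on top of a weight of degree N. Derivatives are indexed by lists of basis vectors, since
  the inductions differentiate in one direction at a time; symmetry of mixed partials connects lists
  with multi-indices. Fourier inversion serves twice, to recover G from T and in the final
  uniqueness argument, both times at points of continuity, so Gaussian summation suffices.\<close>

lemma has_vector_derivative_iff_quotient: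
  fixes f :: "real \<Rightarrow> 'a::real_normed_vector"
  shows "(f has_vector_derivative D) (at x) \<longleftrightarrow> ((\<lambda>h. (1/h) *\<^sub>R (f (x + h) - f x)) \<longlongrightarrow> D) (at 0)"
proof -
  have "norm ((1/h) *\<^sub>R (f (x + h) - f x) - D) = norm (f (x + h) - f x - h *\<^sub>R D) / norm h" if "h \<noteq> 0" for h
  proof -
    have "(1/h) *\<^sub>R (f (x + h) - f x) - D = (1/h) *\<^sub>R (f (x + h) - f x - h *\<^sub>R D)"
      using that by (simp add: scaleR_diff_right)
    then show ?thesis by simp
  qed
  then have "((\<lambda>h. norm (f (x + h) - f x - h *\<^sub>R D) / norm h) \<longlongrightarrow> 0) (at 0)
     \<longleftrightarrow> ((\<lambda>h. norm ((1/h) *\<^sub>R (f (x + h) - f x) - D)) \<longlongrightarrow> 0) (at 0)"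
    by (intro tendsto_cong) (auto simp: eventually_at_filter)
  then show ?thesis
    by (simp add: has_vector_derivative_def has_derivative_at bounded_linear_scaleR_left tendsto_norm_zero_iff LIM_zero_iff)
qed

text \<open>The mean value inequality turns the bound \<open>g\<close> on the derivative into a
  bound on all difference quotients with increment below 1; dominated convergence then handles any
  sequence of increments tending to 0.\<close>

lemma has_vector_derivative_integral:
  fixes f :: "real \<Rightarrow> 'a \<Rightarrow> complex"
  assumes int: "\<And>t. integrable M (f t)"
    and der: "\<And>t a. \<lbrakk>a \<in> space M; \<bar>t - t0\<bar> < 1\<rbrakk> \<Longrightarrow> ((\<lambda>s. f s a) has_vector_derivative f' t a) (at t)"
    and bnd: "\<And>t a. \<lbrakk>a \<in> space M; \<bar>t - t0\<bar> < 1\<rbrakk> \<Longrightarrow> norm (f' t a) \<le> g a"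
    and g: "integrable M g"
    and f'[measurable]: "f' t0 \<in> borel_measurable M"
  shows "((\<lambda>t. LINT a|M. f t a) has_vector_derivative (LINT a|M. f' t0 a)) (at t0)"
proof -
  have [measurable]: "f t \<in> borel_measurable M" for t using int[of t] by auto
  have "((\<lambda>h. (1/h) *\<^sub>R ((LINT a|M. f (t0 + h) a) - (LINT a|M. f t0 a))) \<longlongrightarrow> (LINT a|M. f' t0 a)) (at 0)"
    unfolding tendsto_at_iff_sequentially comp_def
  proof (intro allI impI)
    fix X :: "nat \<Rightarrow> real" assume X: "\<forall>i. X i \<in> UNIV - {0}" "X \<longlonglongrightarrow> 0"
    obtain K where K: "\<And>n. n \<ge> K \<Longrightarrow> \<bar>X n\<bar> < 1"
      using LIMSEQ_D[OF X(2), of 1] by auto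
    define Y where "Y n = X (n + K)" for n
    have Y: "Y n \<noteq> 0" "\<bar>Y n\<bar> < 1" for n using X(1) K[of "n+K"] by (auto simp: Y_def)
    have Ylim: "Y \<longlonglongrightarrow> 0" using LIMSEQ_ignore_initial_segment[OF X(2), of K] by (simp add: Y_def[abs_def])
    have "(\<lambda>n. LINT a|M. (1 / Y n) *\<^sub>R (f (t0 + Y n) a - f t0 a)) \<longlonglongrightarrow> (LINT a|M. f' t0 a)"
    proof (rule integral_dominated_convergence[where w=g])
      show "AE a in M. (\<lambda>n. (1 / Y n) *\<^sub>R (f (t0 + Y n) a - f t0 a)) \<longlonglongrightarrow> f' t0 a"
      proof (rule AE_I2)
        fix a assume a: "a \<in> space M"
        have "((\<lambda>s. f s a) has_vector_derivative f' t0 a) (at t0)" using der[OF a, of t0] by simp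
        then have "((\<lambda>h. (1/h) *\<^sub>R (f (t0 + h) a - f t0 a)) \<longlongrightarrow> f' t0 a) (at 0)"
          by (simp add: has_vector_derivative_iff_quotient)
        then show "(\<lambda>n. (1 / Y n) *\<^sub>R (f (t0 + Y n) a - f t0 a)) \<longlonglongrightarrow> f' t0 a"
          unfolding tendsto_at_iff_sequentially comp_def using Y Ylim by auto
      qed
      show "AE a in M. norm ((1 / Y n) *\<^sub>R (f (t0 + Y n) a - f t0 a)) \<le> g a" for n
      proof (rule AE_I2)
        fix a assume a: "a \<in> space M"
        have "norm (f (t0 + Y n) a - f t0 a) \<le> g a * norm ((t0 + Y n) - t0)"
        proof (rule differentiable_bound[where f'="\<lambda>t h. h *\<^sub>R f' t a" and S="ball t0 1"])
          fix t assume "t \<in> ball t0 1"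
          then have t: "\<bar>t - t0\<bar> < 1" by (auto simp: dist_real_def)
          show "((\<lambda>s. f s a) has_derivative (\<lambda>h. h *\<^sub>R f' t a)) (at t within ball t0 1)"
            using der[OF a t] by (auto simp: has_vector_derivative_def intro: has_derivative_at_withinI)
          show "onorm (\<lambda>h. h *\<^sub>R f' t a) \<le> g a"
            using bnd[OF a t] by (intro onorm_le) (auto simp: mult.commute mult_left_mono)
        qed (use Y[of n] in \<open>auto simp: dist_real_def\<close>)
        then show "norm ((1 / Y n) *\<^sub>R (f (t0 + Y n) a - f t0 a)) \<le> g a"
          using Y[of n] by (simp add: divide_le_eq)
      qed
    qed (auto intro: g)
    then have "(\<lambda>n. (1 / Y n) *\<^sub>R ((LINT a|M. f (t0 + Y n) a) - (LINT a|M. f t0 a))) \<longlonglongrightarrow> (LINT a|M. f' t0 a)"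
      using int by simp
    then show "(\<lambda>n. (1 / X n) *\<^sub>R ((LINT a|M. f (t0 + X n) a) - (LINT a|M. f t0 a))) \<longlonglongrightarrow> (LINT a|M. f' t0 a)"
      unfolding Y_def by (rule LIMSEQ_offset)
  qed
  then show ?thesis by (simp add: has_vector_derivative_iff_quotient)
qed

text \<open>Lebesgue measure on a Euclidean space is the image of a product of one-dimensional
  Lebesgue measures, so both claims are Fubini for finite products. They reduce Gaussians and the
  model decay function to dimension one.\<close>

lemma
  fixes f :: "'a::euclidean_space \<Rightarrow> real \<Rightarrow> 'b::{real_normed_field,banach,second_countable_topology}"
  assumes f: "\<And>b. b \<in> Basis \<Longrightarrow> integrable lborel (f b)"
  shows integrable_lborel_prod: "integrable lborel (\<lambda>x::'a. \<Prod>b\<in>Basis. f b (x \<bullet> b))"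
    and integral_lborel_prod: "(LINT x|lborel. (\<Prod>b\<in>Basis. f b (x \<bullet> b))) = (\<Prod>b\<in>Basis. LINT t|lborel. f b t)"
proof -
  interpret product_sigma_finite "\<lambda>_::'a. lborel :: real measure" ..
  have e: "(\<Prod>b\<in>Basis. f b ((\<Sum>b\<in>Basis. y b *\<^sub>R b) \<bullet> b)) = (\<Prod>b\<in>Basis. f b (y b))" for y :: "'a \<Rightarrow> real"
    by (intro prod.cong) auto
  have [measurable]: "b \<in> Basis \<Longrightarrow> f b \<in> borel_measurable borel" for b using f[of b] by auto
  have m: "(\<lambda>y. \<Sum>b\<in>Basis. y b *\<^sub>R b) \<in> measurable (Pi\<^sub>M Basis (\<lambda>_. lborel)) (borel :: 'a measure)"
    by measurable
  show "integrable lborel (\<lambda>x::'a. \<Prod>b\<in>Basis. f b (x \<bullet> b))"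
    unfolding lborel_eq[where 'a='a] 
    by (subst integrable_distr_eq[OF m]) (auto simp: e intro!: product_integrable_prod f)
  show "(LINT x|lborel. (\<Prod>b\<in>Basis. f b (x \<bullet> b))) = (\<Prod>b\<in>Basis. LINT t|lborel. f b t)"
    unfolding lborel_eq[where 'a='a] 
    by (subst integral_distr[OF m]) (auto simp: e intro!: product_integral_prod f)
qed

section \<open>Translations, dilations and reflections of Lebesgue measure\<close>

lemma integrable_lborel_translate:
  fixes f :: "'a::euclidean_space \<Rightarrow> 'b::{banach,second_countable_topology}"
  assumes "integrable lborel f"
  shows "integrable lborel (\<lambda>x. f (c + x))"
  using assms integrable_distr[of "(+) c" lborel borel f] by (simp add: lborel_distr_plus)

lemma integral_lborel_translate:
  fixes f :: "'a::euclidean_space \<Rightarrow> 'b::{banach,second_countable_topology}"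
  assumes [measurable]: "f \<in> borel_measurable borel"
  shows "(LINT x|lborel. f (c + x)) = (LINT x|lborel. f x)"
  using integral_distr[of "(+) c" lborel borel f] by (simp add: lborel_distr_plus)

lemma integral_lborel_affine:
  fixes f :: "'a::euclidean_space \<Rightarrow> 'b::{banach,second_countable_topology}"
  assumes [measurable]: "f \<in> borel_measurable borel" and c: "c \<noteq> 0"
  shows "(LINT x|lborel. f x) = \<bar>c\<bar> ^ DIM('a) *\<^sub>R (LINT x|lborel. f (t + c *\<^sub>R x))"
  by (subst lborel_affine[OF c, of t]) (simp add: integral_density integral_distr)

lemma integrable_lborel_uminus_iff:
  fixes f :: "'a::euclidean_space \<Rightarrow> 'b::{banach,second_countable_topology}"
  assumes [measurable]: "f \<in> borel_measurable borel"
  shows "integrable lborel (\<lambda>x. f (- x)) \<longleftrightarrow> integrable lborel f"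
proof -
  have "lborel = distr (lborel :: 'a measure) borel uminus"
    by (subst lborel_affine[of "-1" 0]) (simp_all add: density_1 one_ennreal_def[symmetric])
  then show ?thesis using integrable_distr_eq[of uminus lborel borel f] by simp
qed

section \<open>Integrability from polynomial decay\<close>

lemma integrable_inverse_1_plus_square_UNIV: "integrable lborel (\<lambda>t::real. inverse (1 + t\<^sup>2))"
  using integrable_inverse_1_plus_square by (simp add: set_integrable_def)

text \<open>Each coordinate is at most |x| in absolute value, so a product of one-dimensional
  functions 1/(1+t^2) dominates. Giving every coordinate a full factor raises the power to the
  dimension.\<close>

lemma integrable_inverse_power_1_plus_norm_square:
  "integrable lborel (\<lambda>x::'a::euclidean_space. inverse ((1 + (norm x)\<^sup>2) ^ DIM('a)))"
proof (rule Bochner_Integration.integrable_bound)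
  show "integrable lborel (\<lambda>x::'a. \<Prod>b\<in>Basis. inverse (1 + (x \<bullet> b)\<^sup>2))"
    by (rule integrable_lborel_prod) (rule integrable_inverse_1_plus_square_UNIV)
  have "inverse ((1 + (norm x)\<^sup>2) ^ DIM('a)) \<le> (\<Prod>b\<in>Basis. inverse (1 + (x \<bullet> b)\<^sup>2))" for x :: 'a
  proof -
    have "(\<Prod>b\<in>(Basis::'a set). inverse (1 + (norm x)\<^sup>2)) \<le> (\<Prod>b\<in>Basis. inverse (1 + (x \<bullet> b)\<^sup>2))"
    proof (rule prod_mono, safe)
      fix b :: 'a assume "b \<in> Basis"
      then have "(x \<bullet> b)\<^sup>2 \<le> (norm x)\<^sup>2"
        using Basis_le_norm[of b x] by (simp add: abs_le_square_iff[symmetric])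
      then show "inverse (1 + (norm x)\<^sup>2) \<le> inverse (1 + (x \<bullet> b)\<^sup>2)"
        by (intro le_imp_inverse_le) (auto intro: add_pos_nonneg)
    qed (auto intro: add_nonneg_nonneg)
    then show ?thesis by (simp add: power_inverse)
  qed
  then show "AE x in lborel. norm (inverse ((1 + (norm (x::'a))\<^sup>2) ^ DIM('a))) \<le> norm (\<Prod>b\<in>Basis. inverse (1 + (x \<bullet> b)\<^sup>2))"
    by (auto intro!: AE_I2 simp: abs_of_nonneg prod_nonneg)
qed measurable

text \<open>Comparison with (1+|x|^2)^(-n), where n is the dimension. The weight |x|^(2n) matches
  the decay hypothesis: at rate 2n + N + 1 the criterion applies to T times any monomial of degree
  at most N.\<close>

lemma integrable_if_decay:
  fixes f :: "'a::euclidean_space \<Rightarrow> 'b::{banach,second_countable_topology}"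
  assumes [measurable]: "f \<in> borel_measurable borel"
    and 1: "\<And>x. norm (f x) \<le> C" and 2: "\<And>x. norm x ^ (2 * DIM('a)) * norm (f x) \<le> D"
  shows "integrable lborel f"
proof (rule Bochner_Integration.integrable_bound)
  let ?n = "DIM('a)"
  show "integrable lborel (\<lambda>x::'a. (2 ^ ?n * (C + D)) * inverse ((1 + (norm x)\<^sup>2) ^ ?n))"
    by (intro integrable_mult_right integrable_inverse_power_1_plus_norm_square)
  have "norm (f x) \<le> (2 ^ ?n * (C + D)) * inverse ((1 + (norm x)\<^sup>2) ^ ?n)" for x
  proof -
    have "(1 + (norm x)\<^sup>2) ^ ?n \<le> (2 * max 1 ((norm x)\<^sup>2)) ^ ?n"
      by (intro power_mono) auto
    also have "\<dots> = 2 ^ ?n * (max 1 ((norm x)\<^sup>2)) ^ ?n" by (simp add: power_mult_distrib)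
    also have "(max 1 ((norm x)\<^sup>2)) ^ ?n \<le> 1 + norm x ^ (2 * ?n)"
      by (auto simp: max_def power_mult)
    finally have "(1 + (norm x)\<^sup>2) ^ ?n * norm (f x) \<le> (2 ^ ?n * (1 + norm x ^ (2 * ?n))) * norm (f x)"
      by (simp add: mult_right_mono)
    also have "\<dots> \<le> 2 ^ ?n * (C + D)"
      using mult_left_mono[OF add_mono[OF 1[of x] 2[of x]], of "2 ^ ?n"] by (simp add: algebra_simps)
    finally have "norm (f x) * (1 + (norm x)\<^sup>2) ^ ?n \<le> 2 ^ ?n * (C + D)" by (simp add: mult.commute)
    moreover have "0 < (1 + (norm x)\<^sup>2) ^ ?n" by (intro zero_less_power) (auto intro: add_pos_nonneg)
    ultimately show ?thesis by (simp add: field_simps)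
  qed
  then show "AE x in lborel. norm (f x) \<le> norm ((2 ^ ?n * (C + D)) * inverse ((1 + (norm x)\<^sup>2) ^ ?n))"
    by (intro AE_I2) (auto intro: order_trans abs_ge_self)
qed measurable

section \<open>Gaussians and Fourier inversion\<close>

lemma borel_measurable_cis [measurable (raw)]:
  assumes "f \<in> borel_measurable M"
  shows "(\<lambda>x. cis (f x)) \<in> borel_measurable M"
  using assms unfolding cis_conv_exp by measurable

text \<open>This is the characteristic function of the standard normal distribution, with the
  normalising factor of the density removed.\<close>

lemma integral_gaussian_cis_real:
  fixes s :: real
  shows "integrable lborel (\<lambda>t. of_real (exp (- t\<^sup>2 / 2)) * cis (s * t))" (is ?I)
    and "(LINT t|lborel. of_real (exp (- t\<^sup>2 / 2)) * cis (s * t)) = of_real (sqrt (2 * pi) * exp (- s\<^sup>2 / 2))" (is ?E)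
proof -
  have e: "of_real (exp (- t\<^sup>2 / 2)) = of_real (sqrt (2 * pi)) * complex_of_real (std_normal_density t)" for t
    by (simp add: std_normal_density_def)
  have n: "integrable lborel std_normal_density" by simp
  have i: "integrable lborel (\<lambda>t. complex_of_real (std_normal_density t) * cis (s * t))"
    by (rule Bochner_Integration.integrable_bound[OF n]) (auto simp: norm_mult)
  show ?I unfolding e mult.assoc by (intro integrable_mult_right i)
  have "char std_normal_distribution s = (LINT t|lborel. complex_of_real (std_normal_density t) * cis (s * t))"
    unfolding char_def by (subst integral_density) (auto simp: cis_conv_exp scaleR_conv_of_real)
  then have "(LINT t|lborel. complex_of_real (std_normal_density t) * cis (s * t)) = of_real (exp (- s\<^sup>2 / 2))"
    by (simp add: char_std_normal_distribution)
  then show ?E unfolding e mult.assoc by (simp del: of_real_mult add: of_real_mult[symmetric])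
     (simp add: std_normal_density_def)
qed

lemma cis_sum: "cis (\<Sum>i\<in>A. f i) = (\<Prod>i\<in>A. cis (f i))"
  by (induction A rule: infinite_finite_induct) (auto simp: cis_mult[symmetric])

lemma gaussian_cis_prod:
  fixes x u :: "'a::euclidean_space"
  shows "of_real (exp (- (norm x)\<^sup>2 / 2)) * cis (u \<bullet> x)
     = (\<Prod>b\<in>Basis. of_real (exp (- (x \<bullet> b)\<^sup>2 / 2)) * cis ((u \<bullet> b) * (x \<bullet> b)))"
proof -
  have "- (norm x)\<^sup>2 / 2 = (\<Sum>b\<in>Basis. - (x \<bullet> b)\<^sup>2 / 2)"
    by (simp add: norm_eq_sqrt_inner euclidean_inner[of x x] sum_nonneg sum_divide_distrib[symmetric] sum_negf power2_eq_square)
  moreover have "cis (u \<bullet> x) = (\<Prod>b\<in>Basis. cis ((u \<bullet> b) * (x \<bullet> b)))"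
    by (simp add: euclidean_inner[of u x] cis_sum)
  ultimately show ?thesis by (simp add: exp_sum prod.distrib)
qed

lemma integral_gaussian_cis:
  fixes u :: "'a::euclidean_space"
  shows integrable_gaussian_cis: "integrable lborel (\<lambda>x. of_real (exp (- (norm x)\<^sup>2 / 2)) * cis (u \<bullet> x))"
    and "(LINT x|lborel. of_real (exp (- (norm x)\<^sup>2 / 2)) * cis (u \<bullet> x))
       = of_real (sqrt (2 * pi) ^ DIM('a) * exp (- (norm u)\<^sup>2 / 2))"
proof -
  show "integrable lborel (\<lambda>x. of_real (exp (- (norm x)\<^sup>2 / 2)) * cis (u \<bullet> x))"
    unfolding gaussian_cis_prod
    by (rule integrable_lborel_prod) (rule integral_gaussian_cis_real(1))
  have "- (norm u)\<^sup>2 / 2 = (\<Sum>b\<in>Basis. - (u \<bullet> b)\<^sup>2 / 2)"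
    by (simp add: norm_eq_sqrt_inner euclidean_inner[of u u] sum_nonneg sum_divide_distrib[symmetric] sum_negf power2_eq_square)
  then have e: "exp (- (norm u)\<^sup>2 / 2) = (\<Prod>b\<in>Basis. exp (- (u \<bullet> b)\<^sup>2 / 2))" by (simp add: exp_sum)
  show "(LINT x|lborel. of_real (exp (- (norm x)\<^sup>2 / 2)) * cis (u \<bullet> x))
       = of_real (sqrt (2 * pi) ^ DIM('a) * exp (- (norm u)\<^sup>2 / 2))"
    unfolding gaussian_cis_prod e
    by (subst integral_lborel_prod[OF integral_gaussian_cis_real(1)])
      (simp only: integral_gaussian_cis_real(2), simp add: prod.distrib)
qed

lemma integrable_gaussian: "integrable lborel (\<lambda>x::'a::euclidean_space. exp (- (norm x)\<^sup>2 / 2))"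
  using integrable_norm[OF integrable_gaussian_cis[of "0::'a"]] by simp

text \<open>\<open>K\<close> is the Fourier transform of the Gaussian exp(-|x|^2/2), with 2 pi in
  the exponent of the kernel. Rescaling its integral by 2 pi produces (2 pi)^(-n), which cancels two
  factors (2 pi)^(n/2): one from the definition, one from the Gaussian integral.\<close>

lemma integral_gaussian_fourier_kernel:
  defines "K \<equiv> \<lambda>u::'a::euclidean_space. sqrt (2 * pi) ^ DIM('a) * exp (- (norm ((2 * pi) *\<^sub>R u))\<^sup>2 / 2)"
  shows "integrable lborel K" "(LINT u|lborel. K u) = 1"
proof -
  have [measurable]: "K \<in> borel_measurable borel" unfolding K_def by measurable
  have e: "LINT x|lborel. exp (- (norm (x::'a))\<^sup>2 / 2) = sqrt (2 * pi) ^ DIM('a)"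
    using integral_gaussian_cis[of "0::'a"] by (simp add: integral_complex_of_real del: of_real_mult of_real_power of_real_exp)
  define q where "q = sqrt (2 * pi) ^ DIM('a)"
  define I where "I = (LINT u::'a|lborel. exp (- (norm ((2 * pi) *\<^sub>R u))\<^sup>2 / 2))"
  have q: "q \<noteq> 0" by (simp add: q_def)
  have ne: "\<bar>2 * pi\<bar> ^ DIM('a) = q * q"
    unfolding q_def power_mult_distrib[symmetric] by simp
  have "sqrt (2 * pi) ^ DIM('a) = \<bar>2 * pi\<bar> ^ DIM('a) *\<^sub>R (LINT u::'a|lborel. exp (- (norm (0 + (2 * pi) *\<^sub>R u))\<^sup>2 / 2))"
    unfolding e[symmetric] by (rule integral_lborel_affine) auto
  then have "q = q * q * I" unfolding ne by (simp add: q_def I_def)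
  then have "q * I = 1" using q by simp
  then show "(LINT u|lborel. K u) = 1" unfolding K_def q_def I_def by simp
  \<comment> \<open>A non-integrable function has Bochner integral 0, so the value 1 already yields
    integrability.\<close>
  then show "integrable lborel K" by (metis not_integrable_integral_eq zero_neq_one)
qed

lemma integrable_mult_cis:
  assumes "integrable lborel f" and [measurable]: "g \<in> borel_measurable lborel"
  shows "integrable lborel (\<lambda>x. f x * cis (g x))"
  by (rule Bochner_Integration.integrable_bound[OF assms(1)]) (use assms in \<open>auto simp: norm_mult\<close>)

lemma fourier_measurable [measurable]:
  assumes [measurable]: "f \<in> borel_measurable borel"
  shows "fourier f \<in> borel_measurable borel"
proof -
  have "(\<lambda>\<xi>. LINT x|lborel. f x * cis (- 2 * pi * (x \<bullet> \<xi>))) \<in> borel_measurable lborel"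
    by (rule lborel.borel_measurable_lebesgue_integral) measurable
  then show ?thesis by (simp add: fourier_def[abs_def])
qed

text \<open>Gaussian summation: damp the inverse transform by
  \<open>\<gamma> (\<epsilon> *\<^sub>R \<xi>)\<close> and let \<epsilon> tend to 0. Fubini rewrites
  the damped integral as an average of \<open>f\<close> near \<open>z\<close> against the
  probability density \<open>K\<close>. Integrability of \<open>fourier f\<close> controls one
  limit, boundedness of \<open>f\<close> and continuity at \<open>z\<close> the other.\<close>

lemma fourier_inversion:
  fixes f :: "real^'n \<Rightarrow> complex"
  assumes f: "integrable lborel f" and bnd: "\<And>x. norm (f x) \<le> B" and cont: "isCont f z"
    and F: "integrable lborel (fourier f)"
  shows "f z = (LINT \<xi>|lborel. fourier f \<xi> * cis (2 * pi * (z \<bullet> \<xi>)))"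
proof -
  have [measurable]: "f \<in> borel_measurable borel" using f by auto
  define \<gamma> where "\<gamma> x = exp (- (norm (x::real^'n))\<^sup>2 / 2)" for x
  define K where "K u = sqrt (2 * pi) ^ CARD('n) * exp (- (norm ((2 * pi) *\<^sub>R u))\<^sup>2 / 2)" for u :: "real^'n"
  have K: "integrable lborel K" "(LINT u|lborel. K u) = 1"
    using integral_gaussian_fourier_kernel[where 'a="real^'n"] by (simp_all add: K_def[abs_def])
  have K0: "K u \<ge> 0" for u by (simp add: K_def)
  have [measurable]: "\<gamma> \<in> borel_measurable borel" "K \<in> borel_measurable borel"
    unfolding \<gamma>_def[abs_def] K_def[abs_def] by measurable
  have \<gamma>: "0 \<le> \<gamma> x" "\<gamma> x \<le> 1" for x by (auto simp: \<gamma>_def)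
  have K\<gamma>: "(LINT w|lborel. \<gamma> w * cis (2 * pi * (u \<bullet> w))) = K u" for u
    using integral_gaussian_cis(2)[of "(2 * pi) *\<^sub>R u"] by (simp add: \<gamma>_def K_def mult.assoc)
  have i\<gamma>: "integrable lborel \<gamma>" unfolding \<gamma>_def[abs_def] by (rule integrable_gaussian)
  define L where "L \<epsilon> = (LINT \<xi>|lborel. fourier f \<xi> * cis (2 * pi * (z \<bullet> \<xi>)) * \<gamma> (\<epsilon> *\<^sub>R \<xi>))" for \<epsilon>
  have main: "L \<epsilon> = (LINT u|lborel. f (z - \<epsilon> *\<^sub>R u) * K u)" if \<epsilon>: "\<epsilon> > 0" for \<epsilon>
  proof -
    let ?h = "\<lambda>y \<xi>. f y * cis (2 * pi * ((z - y) \<bullet> \<xi>)) * \<gamma> (\<epsilon> *\<^sub>R \<xi>)"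
    have i\<epsilon>: "integrable lborel (\<lambda>\<xi>. \<gamma> (\<epsilon> *\<^sub>R \<xi>))"
      using i\<gamma> by (subst (asm) lborel_affine[of \<epsilon> 0]) (use \<epsilon> in \<open>auto simp: integrable_density integrable_distr_eq\<close>)
    have "L \<epsilon> = (LINT \<xi>|lborel. LINT y|lborel. ?h y \<xi>)"
      unfolding L_def
    proof (rule Bochner_Integration.integral_cong)
      fix \<xi> :: "real^'n"
      have "fourier f \<xi> * cis (2 * pi * (z \<bullet> \<xi>)) * \<gamma> (\<epsilon> *\<^sub>R \<xi>) =
        (LINT x|lborel. f x * cis (- 2 * pi * (x \<bullet> \<xi>)) * (cis (2 * pi * (z \<bullet> \<xi>)) * \<gamma> (\<epsilon> *\<^sub>R \<xi>)))"
        unfolding fourier_def by simp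
      also have "\<dots> = (LINT y|lborel. ?h y \<xi>)"
        by (rule Bochner_Integration.integral_cong)
          (simp_all add: inner_diff_left right_diff_distrib cis_divide[symmetric] divide_inverse mult_ac)
      finally show "fourier f \<xi> * cis (2 * pi * (z \<bullet> \<xi>)) * \<gamma> (\<epsilon> *\<^sub>R \<xi>) = (LINT y|lborel. ?h y \<xi>)" .
    qed simp
    also have "\<dots> = (LINT y|lborel. LINT \<xi>|lborel. ?h y \<xi>)"
    proof (rule lborel_pair.Fubini_integral)
      have "integrable (lborel \<Otimes>\<^sub>M lborel) (\<lambda>p. norm (f (fst p)) * \<gamma> (\<epsilon> *\<^sub>R snd p))"
      proof (rule lborel_pair.Fubini_integrable)
        show "integrable lborel (\<lambda>x. LINT y|lborel. norm (norm (f (fst (x, y))) * \<gamma> (\<epsilon> *\<^sub>R snd (x, y))))"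
          using \<gamma> by (simp add: f abs_mult)
      qed (auto intro!: AE_I2 i\<epsilon>)
      then show "integrable (lborel \<Otimes>\<^sub>M lborel) (\<lambda>(y, \<xi>). ?h y \<xi>)"
        by (rule Bochner_Integration.integrable_bound) (auto simp: norm_mult \<gamma> split_beta)
    qed
    \<comment> \<open>The substitution w = \<epsilon> \<xi> turns the inner integral into a rescaled
      value of \<open>K\<close>.\<close>
    also have "\<dots> = (LINT y|lborel. f y * ((1 / \<epsilon>) ^ CARD('n) * K ((1 / \<epsilon>) *\<^sub>R (z - y))))"
    proof (rule Bochner_Integration.integral_cong)
      fix y :: "real^'n"
      have "(LINT \<xi>|lborel. cis (2 * pi * ((z - y) \<bullet> \<xi>)) * \<gamma> (\<epsilon> *\<^sub>R \<xi>)) = 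
          (1 / \<epsilon>) ^ CARD('n) *\<^sub>R (LINT w|lborel. cis (2 * pi * ((z - y) \<bullet> ((1 / \<epsilon>) *\<^sub>R w))) * \<gamma> (\<epsilon> *\<^sub>R ((1 / \<epsilon>) *\<^sub>R w)))"
        using \<epsilon> by (subst integral_lborel_affine[where c="1/\<epsilon>" and t=0]) simp_all
      also have "\<dots> = (1 / \<epsilon>) ^ CARD('n) *\<^sub>R (LINT w|lborel. \<gamma> w * cis (2 * pi * (((1 / \<epsilon>) *\<^sub>R (z - y)) \<bullet> w)))"
        using \<epsilon> by (simp add: mult.commute)
      finally show "(LINT \<xi>|lborel. ?h y \<xi>) = f y * ((1 / \<epsilon>) ^ CARD('n) * K ((1 / \<epsilon>) *\<^sub>R (z - y)))"
        unfolding K\<gamma> by (simp add: mult.assoc scaleR_conv_of_real)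
    qed simp
    \<comment> \<open>Substituting y = z - \<epsilon> u; the Jacobian cancels the power of
      1/\<epsilon>.\<close>
    also have "\<dots> = \<bar>- \<epsilon>\<bar> ^ CARD('n) *\<^sub>R (LINT u|lborel. f (z + (- \<epsilon>) *\<^sub>R u) * ((1 / \<epsilon>) ^ CARD('n) * K ((1 / \<epsilon>) *\<^sub>R (z - (z + (- \<epsilon>) *\<^sub>R u)))))"
      using \<epsilon> by (subst integral_lborel_affine[where c="-\<epsilon>" and t=z]) simp_all
    also have "\<dots> = \<epsilon> ^ CARD('n) *\<^sub>R (LINT u|lborel. (1 / \<epsilon>) ^ CARD('n) * (f (z - \<epsilon> *\<^sub>R u) * K u))"
      using \<epsilon> by (simp add: mult_ac)
    also have "\<dots> = (LINT u|lborel. f (z - \<epsilon> *\<^sub>R u) * K u)"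
      using \<epsilon> by (simp add: scaleR_conv_of_real power_one_over)
    finally show ?thesis .
  qed
  define \<epsilon> where "\<epsilon> n = inverse (real (Suc n))" for n
  have \<epsilon>: "\<epsilon> n > 0" for n by (simp add: \<epsilon>_def)
  have \<epsilon>0: "\<epsilon> \<longlonglongrightarrow> 0" unfolding \<epsilon>_def[abs_def] by (rule LIMSEQ_inverse_real_of_nat)
  have "(\<lambda>n. L (\<epsilon> n)) \<longlonglongrightarrow> (LINT \<xi>|lborel. fourier f \<xi> * cis (2 * pi * (z \<bullet> \<xi>)))"
    unfolding L_def
  proof (rule integral_dominated_convergence[where w="\<lambda>\<xi>. norm (fourier f \<xi>)"])
    show "AE \<xi> in lborel. (\<lambda>n. fourier f \<xi> * cis (2 * pi * (z \<bullet> \<xi>)) * \<gamma> (\<epsilon> n *\<^sub>R \<xi>)) \<longlonglongrightarrow> fourier f \<xi> * cis (2 * pi * (z \<bullet> \<xi>))"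
    proof (rule AE_I2)
      fix \<xi> :: "real^'n"
      have "(\<lambda>n. exp (- (norm (\<epsilon> n *\<^sub>R \<xi>))\<^sup>2 / 2)) \<longlonglongrightarrow> exp (- (norm (0 *\<^sub>R \<xi>))\<^sup>2 / 2)"
        by (intro tendsto_intros \<epsilon>0) auto
      then have "(\<lambda>n. \<gamma> (\<epsilon> n *\<^sub>R \<xi>)) \<longlonglongrightarrow> 1" by (simp add: \<gamma>_def)
      then show "(\<lambda>n. fourier f \<xi> * cis (2 * pi * (z \<bullet> \<xi>)) * \<gamma> (\<epsilon> n *\<^sub>R \<xi>)) \<longlonglongrightarrow> fourier f \<xi> * cis (2 * pi * (z \<bullet> \<xi>))"
        by (intro tendsto_eq_intros tendsto_of_real | simp)+
    qed
    show "AE \<xi> in lborel. norm (fourier f \<xi> * cis (2 * pi * (z \<bullet> \<xi>)) * \<gamma> (\<epsilon> n *\<^sub>R \<xi>)) \<le> norm (fourier f \<xi>)" for n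
      using \<gamma> by (auto simp: norm_mult intro!: AE_I2 mult_left_le)
  qed (use F in auto)
  moreover have "(\<lambda>n. L (\<epsilon> n)) \<longlonglongrightarrow> (LINT u|lborel. f z * K u)"
    unfolding main[OF \<epsilon>]
  proof (rule integral_dominated_convergence[where w="\<lambda>u. B * K u"])
    show "AE u in lborel. (\<lambda>n. f (z - \<epsilon> n *\<^sub>R u) * K u) \<longlonglongrightarrow> f z * K u"
    proof (rule AE_I2)
      fix u :: "real^'n"
      have "(\<lambda>n. z - \<epsilon> n *\<^sub>R u) \<longlonglongrightarrow> z - 0 *\<^sub>R u" by (intro tendsto_intros \<epsilon>0)
      then have "(\<lambda>n. f (z - \<epsilon> n *\<^sub>R u)) \<longlonglongrightarrow> f z" using isCont_tendsto_compose[OF cont] by simp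
      then show "(\<lambda>n. f (z - \<epsilon> n *\<^sub>R u) * K u) \<longlonglongrightarrow> f z * K u" by (intro tendsto_intros)
    qed
    show "AE u in lborel. norm (f (z - \<epsilon> n *\<^sub>R u) * K u) \<le> B * K u" for n
      using bnd K0 by (auto simp: norm_mult intro!: AE_I2 mult_right_mono)
  qed (use K in auto)
  moreover have "(LINT u|lborel. f z * K u) = f z" using K by (simp add: integral_complex_of_real)
  ultimately show ?thesis using LIMSEQ_unique by metis
qed

section \<open>Iterated directional derivatives\<close>

text \<open>\<open>dirder\<close> and \<open>smooth_on\<close> differentiate only at parameter 0.
  Moving the base point along the line carries such statements to any parameter, as mean value
  arguments require.\<close>

lemma has_vector_derivative_line_iff:
  fixes f :: "'v::real_normed_vector \<Rightarrow> 'b::real_normed_vector"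
  shows "((\<lambda>t. f (x + t *\<^sub>R v)) has_vector_derivative D) (at t)
    \<longleftrightarrow> ((\<lambda>s. f ((x + t *\<^sub>R v) + s *\<^sub>R v)) has_vector_derivative D) (at 0)"
proof -
  have e: "(x + t *\<^sub>R v) + s *\<^sub>R v = x + (s + t) *\<^sub>R v" for s by (simp add: algebra_simps)
  have "((\<lambda>s. f (x + (s + t) *\<^sub>R v)) has_vector_derivative D) (at 0)
     \<longleftrightarrow> ((\<lambda>t. f (x + t *\<^sub>R v)) has_vector_derivative D) (at (0 + t))"
  proof
    assume "((\<lambda>s. f (x + (s + t) *\<^sub>R v)) has_vector_derivative D) (at 0)"
    then have "((\<lambda>s. f (x + ((s - t) + t) *\<^sub>R v)) has_vector_derivative 1 *\<^sub>R D) (at t)"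
      by (intro vector_diff_chain_at[of "\<lambda>s. s - t" 1 t "\<lambda>s. f (x + (s + t) *\<^sub>R v)", unfolded o_def])
        (auto intro!: derivative_eq_intros)
    then show "((\<lambda>t. f (x + t *\<^sub>R v)) has_vector_derivative D) (at (0 + t))" by simp
  next
    assume "((\<lambda>t. f (x + t *\<^sub>R v)) has_vector_derivative D) (at (0 + t))"
    then have "((\<lambda>s. f (x + (s + t) *\<^sub>R v)) has_vector_derivative 1 *\<^sub>R D) (at 0)"
      by (intro vector_diff_chain_at[of "\<lambda>s. s + t" 1 0 "\<lambda>t. f (x + t *\<^sub>R v)", unfolded o_def])
        (auto intro!: derivative_eq_intros)
    then show "((\<lambda>s. f (x + (s + t) *\<^sub>R v)) has_vector_derivative D) (at 0)" by simp
  qed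
  then show ?thesis unfolding e by simp
qed

lemma dirder_eqI: "((\<lambda>t. f (x + t *\<^sub>R v)) has_vector_derivative D) (at 0) \<Longrightarrow> dirder v f x = D"
  by (simp add: dirder_def vector_derivative_at)

lemma smooth_on_continuous: "smooth_on S f \<Longrightarrow> set vs \<subseteq> Basis \<Longrightarrow> continuous_on S (dders vs f)"
  by (simp add: smooth_on_def)

lemma smooth_on_has_vector_derivative:
  assumes "smooth_on S f" "set vs \<subseteq> Basis" "v \<in> Basis" "x + t *\<^sub>R v \<in> S"
  shows "((\<lambda>t. dders vs f (x + t *\<^sub>R v)) has_vector_derivative dders (v # vs) f (x + t *\<^sub>R v)) (at t)"
proof -
  have "(\<lambda>s. dders vs f ((x + t *\<^sub>R v) + s *\<^sub>R v)) differentiable (at 0)"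
    using assms unfolding smooth_on_def by blast
  then show ?thesis
    unfolding has_vector_derivative_line_iff[of _ x]
    by (simp add: dirder_def vector_derivative_works[symmetric])
qed

lemma dirder_cong_open:
  assumes "open S" "x \<in> S" "\<And>y. y \<in> S \<Longrightarrow> f y = g y"
  shows "dirder v f x = dirder v g x"
proof -
  have "isCont (\<lambda>t. x + t *\<^sub>R v) 0" by (intro continuous_intros)
  then have "((\<lambda>t. x + t *\<^sub>R v) \<longlongrightarrow> x) (nhds 0)" using tendsto_at_iff_tendsto_nhds[of "\<lambda>t. x + t *\<^sub>R v" 0] by (simp add: isCont_def)
  then have "\<forall>\<^sub>F t in nhds 0. x + t *\<^sub>R v \<in> S" using assms(1,2) by (rule topological_tendstoD)
  then have "\<forall>\<^sub>F t in nhds 0. t \<in> UNIV \<longrightarrow> f (x + t *\<^sub>R v) = g (x + t *\<^sub>R v)"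
    by (rule eventually_mono) (simp add: assms(3))
  then show ?thesis unfolding dirder_def by (intro vector_derivative_cong_eq) auto
qed

lemma dders_append: "dders (vs @ ws) f = dders vs (dders ws f)"
  by (induction vs) auto

lemma dders_translate: "dders vs (\<lambda>x. f (x + c)) x = dders vs f (x + c)"
proof (induction vs arbitrary: x)
  case (Cons v vs)
  then have "dders vs (\<lambda>x. f (x + c)) = (\<lambda>x. dders vs f (x + c))" by auto
  then show ?case by (simp add: dirder_def algebra_simps)
qed simp

lemma smooth_on_translate:
  assumes "smooth_on UNIV f"
  shows "smooth_on UNIV (\<lambda>x. f (x + c))"
  unfolding smooth_on_def
proof (intro allI impI conjI ballI)
  fix vs :: "'a list" and v x :: 'a assume vs: "set vs \<subseteq> Basis"
  have e: "dders vs (\<lambda>x. f (x + c)) = (\<lambda>x. dders vs f (x + c))" by (rule ext) (rule dders_translate)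
  show "continuous_on UNIV (dders vs (\<lambda>x. f (x + c)))"
    unfolding e using smooth_on_continuous[OF assms vs]
    by (auto intro!: continuous_on_compose2[of UNIV "dders vs f"] continuous_intros)
  assume "v \<in> Basis"
  then have "(\<lambda>t. dders vs f ((x + c) + t *\<^sub>R v)) differentiable (at 0)"
    using assms vs unfolding smooth_on_def by blast
  then show "(\<lambda>t. dders vs (\<lambda>x. f (x + c)) (x + t *\<^sub>R v)) differentiable (at 0)"
    unfolding e by (simp add: algebra_simps)
qed

text \<open>Polynomials in the functions of \<open>B\<close>. Smoothness asks for all iterated
  derivatives at once; membership in an algebra closed under differentiation replaces explicit
  formulas for them.\<close>

inductive_set generated_alg :: "('v \<Rightarrow> complex) set \<Rightarrow> ('v \<Rightarrow> complex) set" for B where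
  const: "(\<lambda>_. c) \<in> generated_alg B"
| base: "f \<in> B \<Longrightarrow> f \<in> generated_alg B"
| add: "f \<in> generated_alg B \<Longrightarrow> g \<in> generated_alg B \<Longrightarrow> (\<lambda>x. f x + g x) \<in> generated_alg B"
| mult: "f \<in> generated_alg B \<Longrightarrow> g \<in> generated_alg B \<Longrightarrow> (\<lambda>x. f x * g x) \<in> generated_alg B"

text \<open>By the sum and product rules it is enough that derivatives of the generators stay in the
  algebra: every iterated derivative is then a polynomial in the generators, hence continuous and
  again differentiable.\<close>

lemma generated_alg_smooth:
  fixes B :: "('v::euclidean_space \<Rightarrow> complex) set"
  assumes cont: "\<And>f. f \<in> B \<Longrightarrow> continuous_on UNIV f"
    and der: "\<And>f v. f \<in> B \<Longrightarrow> v \<in> Basis \<Longrightarrow>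
       \<exists>g\<in>generated_alg B. \<forall>x. ((\<lambda>t. f (x + t *\<^sub>R v)) has_vector_derivative g x) (at 0)"
    and f: "f \<in> generated_alg B"
  shows "smooth_on UNIV f"
proof -
  have c: "continuous_on UNIV f" if "f \<in> generated_alg B" for f
    using that by induction (auto intro: continuous_on_add continuous_on_mult cont)
  have d: "\<exists>g\<in>generated_alg B. \<forall>x. ((\<lambda>t. f (x + t *\<^sub>R v)) has_vector_derivative g x) (at 0)"
    if "f \<in> generated_alg B" "v \<in> Basis" for f v
    using that(1)
  proof induction
    case (const c)
    then show ?case by (intro bexI[of _ "\<lambda>_. 0"]) (auto intro: generated_alg.const)
  next
    case (base f)
    then show ?case using der that(2) by blast
  next
    case (add f g)
    then obtain f' g' where "f' \<in> generated_alg B" "\<forall>x. ((\<lambda>t. f (x + t *\<^sub>R v)) has_vector_derivative f' x) (at 0)"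
      "g' \<in> generated_alg B" "\<forall>x. ((\<lambda>t. g (x + t *\<^sub>R v)) has_vector_derivative g' x) (at 0)" by blast
    then show ?case
      by (intro bexI[of _ "\<lambda>x. f' x + g' x"]) (auto intro: generated_alg.add has_vector_derivative_add)
  next
    case (mult f g)
    then obtain f' g' where "f' \<in> generated_alg B" "\<And>x. ((\<lambda>t. f (x + t *\<^sub>R v)) has_vector_derivative f' x) (at 0)"
      "g' \<in> generated_alg B" "\<And>x. ((\<lambda>t. g (x + t *\<^sub>R v)) has_vector_derivative g' x) (at 0)" by blast
    note * = this
    have "((\<lambda>t. f (x + t *\<^sub>R v) * g (x + t *\<^sub>R v)) has_vector_derivative f x * g' x + f' x * g x) (at 0)" for x
      using has_vector_derivative_mult[OF *(2)[of x] *(4)[of x]] by simp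
    then show ?case
      by (intro bexI[of _ "\<lambda>x. f x * g' x + f' x * g x"]) (auto intro!: generated_alg.add generated_alg.mult * mult)
  qed
  have a: "dders vs f \<in> generated_alg B" if "set vs \<subseteq> Basis" for vs
    using that
  proof (induction vs)
    case (Cons v vs)
    then obtain g where g: "g \<in> generated_alg B" "\<forall>x. ((\<lambda>t. dders vs f (x + t *\<^sub>R v)) has_vector_derivative g x) (at 0)"
      using d[of "dders vs f" v] by auto
    have "dders (v # vs) f = g" using g(2) by (auto intro: dirder_eqI)
    then show ?case using g(1) by simp
  qed (simp add: f)
  show ?thesis unfolding smooth_on_def
  proof (intro allI impI conjI ballI)
    fix vs :: "'v list" and v x :: 'v assume vs: "set vs \<subseteq> Basis"
    show "continuous_on UNIV (dders vs f)" using a[OF vs] by (rule c)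
    assume "v \<in> Basis"
    then show "(\<lambda>t. dders vs f (x + t *\<^sub>R v)) differentiable at 0"
      using d[OF a[OF vs]] by (meson differentiableI_vector)
  qed
qed

lemma smooth_on_diff:
  fixes f g :: "'v::euclidean_space \<Rightarrow> complex"
  assumes "smooth_on UNIV f" "smooth_on UNIV g"
  shows "smooth_on UNIV (\<lambda>x. f x - g x)"
proof -
  \<comment> \<open>With all iterated derivatives of \<open>f\<close> and \<open>g\<close> as
    generators, differentiating a generator gives another one.\<close>
  define B where "B = {dders vs h | vs h. set vs \<subseteq> Basis \<and> h \<in> {f, g}}"
  have s: "smooth_on UNIV h" if "h \<in> {f, g}" for h using assms that by auto
  have "smooth_on UNIV (\<lambda>x. f x + (\<lambda>_. -1) x * g x)"
  proof (rule generated_alg_smooth[where B=B])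
    fix k assume "k \<in> B"
    then obtain vs h where k: "k = dders vs h" "set vs \<subseteq> Basis" "h \<in> {f, g}" unfolding B_def by blast
    show "continuous_on UNIV k" using s k by (auto intro: smooth_on_continuous)
    fix v :: 'v assume v: "v \<in> Basis"
    have "dders (v # vs) h \<in> B" unfolding B_def using v k by fastforce
    moreover have "((\<lambda>t. k (x + t *\<^sub>R v)) has_vector_derivative dders (v # vs) h x) (at 0)" for x
      using smooth_on_has_vector_derivative[OF s[OF k(3)] k(2) v, of x 0] k by simp
    ultimately show "\<exists>g\<in>generated_alg B. \<forall>x. ((\<lambda>t. k (x + t *\<^sub>R v)) has_vector_derivative g x) (at 0)"
      by (blast intro: generated_alg.base)
  next
    have "dders [] f \<in> B" "dders [] g \<in> B" unfolding B_def by fastforce+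
    then show "(\<lambda>x. f x + (\<lambda>_. -1) x * g x) \<in> generated_alg B"
      by (intro generated_alg.intros) auto
  qed
  then show ?thesis by simp
qed

lemma smooth_on_dders:
  assumes "smooth_on S f" "set vs \<subseteq> Basis"
  shows "smooth_on S (dders vs f)"
  using assms unfolding smooth_on_def by (auto simp: dders_append[symmetric])

text \<open>The second difference of \<open>F\<close> over a small square with corner at the origin
  is h^2 times a value of either mixed partial inside the square, by two mean value steps in either
  order. Continuity at the origin brings these values close to the two sides.\<close>

lemma mixed_partials_eq_real:
  fixes F Fs Ft Fst Fts :: "real \<Rightarrow> real \<Rightarrow> real"
  assumes \<delta>: "\<delta> > 0"
    and s: "\<And>s t. \<bar>s\<bar> < \<delta> \<Longrightarrow> \<bar>t\<bar> < \<delta> \<Longrightarrow> ((\<lambda>s. F s t) has_real_derivative Fs s t) (at s)"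
    and t: "\<And>s t. \<bar>s\<bar> < \<delta> \<Longrightarrow> \<bar>t\<bar> < \<delta> \<Longrightarrow> ((\<lambda>t. F s t) has_real_derivative Ft s t) (at t)"
    and st: "\<And>s t. \<bar>s\<bar> < \<delta> \<Longrightarrow> \<bar>t\<bar> < \<delta> \<Longrightarrow> ((\<lambda>t. Fs s t) has_real_derivative Fst s t) (at t)"
    and ts: "\<And>s t. \<bar>s\<bar> < \<delta> \<Longrightarrow> \<bar>t\<bar> < \<delta> \<Longrightarrow> ((\<lambda>s. Ft s t) has_real_derivative Fts s t) (at s)"
    and c: "isCont (\<lambda>p. Fst (fst p) (snd p)) (0, 0)" "isCont (\<lambda>p. Fts (fst p) (snd p)) (0, 0)"
  shows "Fst 0 0 = Fts 0 0"
proof -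
  have close: "\<bar>Fst 0 0 - Fts 0 0\<bar> \<le> e" if e: "e > 0" for e
  proof -
    obtain d1 where d1: "d1 > 0" "\<And>p. dist p (0, 0) < d1 \<Longrightarrow> dist (Fst (fst p) (snd p)) (Fst 0 0) < e/2"
      using c(1) e unfolding continuous_at_eps_delta by (metis fst_conv snd_conv half_gt_zero)
    obtain d2 where d2: "d2 > 0" "\<And>p. dist p (0, 0) < d2 \<Longrightarrow> dist (Fts (fst p) (snd p)) (Fts 0 0) < e/2"
      using c(2) e unfolding continuous_at_eps_delta by (metis fst_conv snd_conv half_gt_zero)
    \<comment> \<open>Interior points of the square have norm below 2h, so the factor 1/2 keeps them
      in both continuity balls.\<close>
    define h where "h = min \<delta> (min d1 d2) / 2"
    have h: "0 < h" "h < \<delta>" "2 * h \<le> d1" "2 * h \<le> d2" using \<delta> d1 d2 by (auto simp: h_def)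
    have dd: "dist (a, b) (0, 0) < 2 * h" if "0 < a" "a < h" "0 < b" "b < h" for a b :: real
    proof -
      have "norm (a, b) \<le> norm a + norm b" by (rule norm_Pair_le)
      then show ?thesis using that by (simp add: dist_norm zero_prod_def[symmetric])
    qed
    define \<Delta> where "\<Delta> = F h h - F h 0 - F 0 h + F 0 0"
    obtain z w where zw: "0 < z" "z < h" "0 < w" "w < h" "\<Delta> = h * (h * Fst z w)"
    proof -
      have "\<exists>z. 0 < z \<and> z < h \<and> (F h h - F h 0) - (F 0 h - F 0 0) = (h - 0) * (Fs z h - Fs z 0)"
        using h by (intro MVT2[of 0 h "\<lambda>s. F s h - F s 0" "\<lambda>s. Fs s h - Fs s 0"]) (auto intro!: DERIV_diff s)
      then obtain z where z: "0 < z" "z < h" "\<Delta> = h * (Fs z h - Fs z 0)" by (auto simp: \<Delta>_def)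
      have "\<exists>w. 0 < w \<and> w < h \<and> Fs z h - Fs z 0 = (h - 0) * Fst z w"
        using h z by (intro MVT2) (auto intro!: st)
      then show ?thesis using z that by auto
    qed
    obtain z' w' where zw': "0 < z'" "z' < h" "0 < w'" "w' < h" "\<Delta> = h * (h * Fts z' w')"
    proof -
      have "\<exists>w. 0 < w \<and> w < h \<and> (F h h - F 0 h) - (F h 0 - F 0 0) = (h - 0) * (Ft h w - Ft 0 w)"
        using h by (intro MVT2[of 0 h "\<lambda>t. F h t - F 0 t" "\<lambda>t. Ft h t - Ft 0 t"]) (auto intro!: DERIV_diff t)
      then obtain w where w: "0 < w" "w < h" "\<Delta> = h * (Ft h w - Ft 0 w)" by (auto simp: \<Delta>_def algebra_simps)
      have "\<exists>z. 0 < z \<and> z < h \<and> Ft h w - Ft 0 w = (h - 0) * Fts z w"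
        using h w by (intro MVT2[of 0 h "\<lambda>s. Ft s w"]) (auto intro!: ts)
      then show ?thesis using w that by auto
    qed
    have "Fst z w = Fts z' w'" using zw(5) zw'(5) h by auto
    moreover have "\<bar>Fst z w - Fst 0 0\<bar> < e/2"
      using d1(2)[of "(z, w)"] dd[OF zw(1-4)] h by (auto simp: dist_real_def)
    moreover have "\<bar>Fts z' w' - Fts 0 0\<bar> < e/2"
      using d2(2)[of "(z', w')"] dd[OF zw'(1-4)] h by (auto simp: dist_real_def)
    ultimately show ?thesis by linarith
  qed
  show ?thesis
  proof (rule ccontr)
    assume "Fst 0 0 \<noteq> Fts 0 0"
    then show False using close[of "\<bar>Fst 0 0 - Fts 0 0\<bar> / 2"] by simp
  qed
qed

text \<open>Symmetry is checked on the plane \<open>x + s *\<^sub>R v + t *\<^sub>R w\<close>. The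
  mean value theorem is real-valued, so real and imaginary parts are treated separately.\<close>

lemma dders_swap:
  fixes f :: "'v::euclidean_space \<Rightarrow> complex"
  assumes S: "open S" and f: "smooth_on S f" and vs: "set vs \<subseteq> Basis" and v: "v \<in> Basis" and w: "w \<in> Basis" and x: "x \<in> S"
  shows "dders (v # w # vs) f x = dders (w # v # vs) f x"
proof -
  obtain e where e: "e > 0" "ball x e \<subseteq> S" using S x by (meson openE)
  have near: "x + s *\<^sub>R v + t *\<^sub>R w \<in> S" if "\<bar>s\<bar> < e / 2" "\<bar>t\<bar> < e / 2" for s t
  proof -
    have "norm (s *\<^sub>R v + t *\<^sub>R w) \<le> \<bar>s\<bar> + \<bar>t\<bar>"
      using v w by (intro order_trans[OF norm_triangle_ineq]) simp
    then have "dist (x + s *\<^sub>R v + t *\<^sub>R w) x < e" using that by (simp add: dist_norm add.assoc)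
    then show ?thesis using e by (auto simp: dist_commute)
  qed
  have D1: "((\<lambda>s. dders us f (x + s *\<^sub>R v + t *\<^sub>R w)) has_vector_derivative dders (v # us) f (x + s *\<^sub>R v + t *\<^sub>R w)) (at s)"
    if "\<bar>s\<bar> < e / 2" "\<bar>t\<bar> < e / 2" "set us \<subseteq> Basis" for us s t
    using smooth_on_has_vector_derivative[OF f that(3) v, of "x + t *\<^sub>R w" s] near[OF that(1,2)] by (simp add: algebra_simps)
  have D2: "((\<lambda>t. dders us f (x + s *\<^sub>R v + t *\<^sub>R w)) has_vector_derivative dders (w # us) f (x + s *\<^sub>R v + t *\<^sub>R w)) (at t)"
    if "\<bar>s\<bar> < e / 2" "\<bar>t\<bar> < e / 2" "set us \<subseteq> Basis" for us s t
    using smooth_on_has_vector_derivative[OF f that(3) w, of "x + s *\<^sub>R v" t] near[OF that(1,2)] by simp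
  have C: "isCont (\<lambda>p. dders us f (x + fst p *\<^sub>R v + snd p *\<^sub>R w)) (0, 0)" if "set us \<subseteq> Basis" for us
  proof -
    have "isCont (dders us f) x"
      using smooth_on_continuous[OF f that] S x by (simp add: continuous_on_eq_continuous_at)
    then show ?thesis
      by (intro isCont_o2[of "(0, 0)" "\<lambda>p. x + fst p *\<^sub>R v + snd p *\<^sub>R w" "dders us f"] isCont_add isCont_scaleR) simp_all
  qed
  have "L (dders (w # v # vs) f (x + 0 *\<^sub>R v + 0 *\<^sub>R w)) = L (dders (v # w # vs) f (x + 0 *\<^sub>R v + 0 *\<^sub>R w))"
    if L: "bounded_linear L" for L :: "complex \<Rightarrow> real"
  proof (rule mixed_partials_eq_real[where \<delta>="e/2"
        and F="\<lambda>s t. L (dders vs f (x + s *\<^sub>R v + t *\<^sub>R w))"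
        and Fs="\<lambda>s t. L (dders (v # vs) f (x + s *\<^sub>R v + t *\<^sub>R w))"
        and Ft="\<lambda>s t. L (dders (w # vs) f (x + s *\<^sub>R v + t *\<^sub>R w))"
        and Fst="\<lambda>s t. L (dders (w # v # vs) f (x + s *\<^sub>R v + t *\<^sub>R w))"
        and Fts="\<lambda>s t. L (dders (v # w # vs) f (x + s *\<^sub>R v + t *\<^sub>R w))"])
    show "isCont (\<lambda>p. L (dders (w # v # vs) f (x + fst p *\<^sub>R v + snd p *\<^sub>R w))) (0, 0)"
      using C[of "w # v # vs"] vs v w by (intro bounded_linear.isCont[OF L]) auto
    show "isCont (\<lambda>p. L (dders (v # w # vs) f (x + fst p *\<^sub>R v + snd p *\<^sub>R w))) (0, 0)"
      using C[of "v # w # vs"] vs v w by (intro bounded_linear.isCont[OF L]) auto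
  qed (use e vs v w in \<open>auto simp del: dders.simps simp: has_real_derivative_iff_has_vector_derivative
       intro!: bounded_linear.has_vector_derivative[OF L] D1 D2\<close>)
  from this[OF bounded_linear_Re] this[OF bounded_linear_Im] show ?thesis
    by (simp add: complex_eq_iff)
qed

lemma dders_move:
  fixes f :: "'v::euclidean_space \<Rightarrow> complex"
  assumes S: "open S" and f: "smooth_on S f"
  shows "set (v # us @ vs) \<subseteq> Basis \<Longrightarrow> x \<in> S \<Longrightarrow> dders (v # us @ vs) f x = dders (us @ v # vs) f x"
proof (induction us arbitrary: x)
  case (Cons u us)
  have "dders (v # u # us @ vs) f x = dders (u # v # us @ vs) f x"
    using Cons.prems by (intro dders_swap[OF S f]) auto
  also have "\<dots> = dirder u (dders (v # us @ vs) f) x" by simp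
  also have "\<dots> = dirder u (dders (us @ v # vs) f) x"
    using Cons by (intro dirder_cong_open[OF S]) auto
  finally show ?case by simp
qed simp

text \<open>Multi-index derivatives use an unspecified ordering of the directions; permutation
  invariance makes them computable along any list with the same counts.\<close>

lemma dders_perm:
  fixes f :: "'v::euclidean_space \<Rightarrow> complex"
  assumes S: "open S" and f: "smooth_on S f"
  shows "mset vs = mset ws \<Longrightarrow> set vs \<subseteq> Basis \<Longrightarrow> x \<in> S \<Longrightarrow> dders vs f x = dders ws f x"
proof (induction vs arbitrary: ws x)
  case (Cons v vs)
  have "v \<in> set ws" using Cons.prems(1) by (metis list.set_intros(1) set_mset_mset)
  then obtain us us' where ws: "ws = us @ v # us'" by (meson split_list)
  have m: "mset vs = mset (us @ us')" using Cons.prems(1) ws by simp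
  have "dders (v # vs) f x = dders (v # us @ us') f x"
    using Cons.IH[OF m] Cons.prems by (auto intro!: dirder_cong_open[OF S])
  also have "\<dots> = dders ws f x"
    unfolding ws using mset_eq_setD[OF Cons.prems(1)] Cons.prems(2,3)
    by (intro dders_move[OF S f]) (auto simp: ws)
  finally show ?case .
qed simp

section \<open>Test functions and their Fourier transforms\<close>

text \<open>The power of 1/s makes the family closed under differentiation: the derivative of member
  \<open>k\<close> combines members \<open>k + 1\<close> and \<open>k + 2\<close>. For
  \<open>k = 0\<close> it is the classical flat function.\<close>

definition bump_profile :: "nat \<Rightarrow> real \<Rightarrow> real" where
  "bump_profile k s = (if s > 0 then exp (- 1 / s) / s ^ k else 0)"

lemma bump_profile_tendsto_0: "(bump_profile k \<longlongrightarrow> 0) (at 0)"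
proof -
  have "((\<lambda>s::real. inverse s ^ k / exp (inverse s)) \<longlongrightarrow> 0) (at_right 0)"
    using filterlim_compose[OF tendsto_power_div_exp_0 filterlim_inverse_at_top_right] .
  then have "(bump_profile k \<longlongrightarrow> 0) (at_right 0)"
  proof (rule Lim_transform_eventually)
    show "\<forall>\<^sub>F s in at_right 0. inverse s ^ k / exp (inverse s) = bump_profile k s"
      by (rule eventually_mono[OF eventually_at_right_less])
        (simp add: bump_profile_def exp_minus inverse_eq_divide power_one_over mult.commute)
  qed
  moreover have "(bump_profile k \<longlongrightarrow> 0) (at_left 0)"
    by (rule tendsto_eventually) (auto simp: bump_profile_def eventually_at_filter)
  ultimately show ?thesis by (simp add: filterlim_at_split)
qed

lemma bump_profile_deriv:
  "(bump_profile k has_real_derivative - real k * bump_profile (k + 1) s + bump_profile (k + 2) s) (at s)"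
proof (cases s "0 :: real" rule: linorder_cases)
  case less
  have "((\<lambda>_. 0) has_real_derivative 0) (at s)" by simp
  then have "(bump_profile k has_real_derivative 0) (at s)"
    by (rule has_field_derivative_transform_within_open[of _ _ _ "{..<0}"]) (use less in \<open>auto simp: bump_profile_def\<close>)
  then show ?thesis using less by (simp add: bump_profile_def)
next
  case equal
  \<comment> \<open>At the origin the difference quotient is itself the member \<open>k + 1\<close>,
    whose limit there is 0.\<close>
  have "((\<lambda>h. (bump_profile k (0 + h) - bump_profile k 0) / h) \<longlongrightarrow> 0) (at 0)"
  proof (rule Lim_transform_eventually[OF bump_profile_tendsto_0[of "k + 1"]])
    show "\<forall>\<^sub>F h in at 0. bump_profile (k + 1) h = (bump_profile k (0 + h) - bump_profile k 0) / h"
      by (auto simp: bump_profile_def eventually_at_filter)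
  qed
  then show ?thesis using equal by (simp add: DERIV_def bump_profile_def)
next
  case greater
  have "((\<lambda>s. exp (- 1 / s) / s ^ k) has_real_derivative - real k * bump_profile (k + 1) s + bump_profile (k + 2) s) (at s)"
    using greater
    by (auto intro!: derivative_eq_intros simp: bump_profile_def power2_eq_square)
       (cases k; simp add: field_simps)
  then show ?thesis
    by (rule has_field_derivative_transform_within_open[of _ _ _ "{0<..}"]) (use greater in \<open>auto simp: bump_profile_def\<close>)
qed

lemma has_vector_derivative_cis:
  "((\<lambda>t. cis (a + t * b)) has_vector_derivative \<i> * of_real b * cis (a + t * b)) (at t)"
proof -
  have "((\<lambda>z. exp (\<i> * (of_real a + z * of_real b))) has_field_derivative
      \<i> * of_real b * exp (\<i> * (of_real a + of_real t * of_real b))) (at (of_real t))"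
    by (auto intro!: derivative_eq_intros)
  from has_vector_derivative_real_field[OF this] show ?thesis
    by (simp add: cis_conv_exp)
qed

definition test_fun :: "(real^'n \<Rightarrow> complex) \<Rightarrow> bool" where
  "test_fun f \<longleftrightarrow> smooth_on UNIV f \<and> bounded {x. f x \<noteq> 0}"

text \<open>A bump on the unit ball is modulated to frequency \<open>w\<close>: the character
  cancels the Fourier kernel at \<open>w\<close>, leaving the integral of a nonnegative function
  that is positive on the open ball.\<close>

lemma exists_modulated_bump:
  fixes w :: "real^'n"
  shows "\<exists>f. test_fun f \<and> fourier f w \<noteq> 0"
proof -
  define \<phi> where "\<phi> k x = bump_profile k (1 - x \<bullet> x)" for k and x :: "real^'n"
  define e where "e x = cis (2 * pi * (x \<bullet> w))" for x
  \<comment> \<open>The chain rule for the profile produces linear factors x.v, and derivatives of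
    the character reproduce it, so these three kinds of functions generate an algebra closed under
    differentiation.\<close>
  define B where "B = range (\<lambda>k x. complex_of_real (\<phi> k x)) \<union> range (\<lambda>u x. complex_of_real (x \<bullet> u)) \<union> {e}"
  have cb: "continuous_on UNIV (bump_profile k)" for k
    by (rule DERIV_continuous_on) (rule has_field_derivative_at_within[OF bump_profile_deriv])
  have c\<phi>: "continuous_on UNIV (\<phi> k)" for k unfolding \<phi>_def[abs_def]
    by (rule continuous_on_compose2[OF cb]) (auto intro!: continuous_intros)
  have \<phi>0: "\<phi> k x \<ge> 0" for k x by (auto simp: \<phi>_def bump_profile_def)
  have s: "smooth_on UNIV (\<lambda>x. complex_of_real (\<phi> 0 x) * e x)"
  proof (rule generated_alg_smooth[where B=B])
    fix g assume "g \<in> B"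
    then show "continuous_on UNIV g"
      unfolding B_def e_def[abs_def] cis_conv_exp by (auto intro!: continuous_intros c\<phi>)
  next
    fix g and v :: "real^'n" assume "g \<in> B"
    then consider k where "g = (\<lambda>x. complex_of_real (\<phi> k x))" | u where "g = (\<lambda>x. complex_of_real (x \<bullet> u))" | "g = e"
      unfolding B_def by blast
    then show "\<exists>h\<in>generated_alg B. \<forall>x. ((\<lambda>t. g (x + t *\<^sub>R v)) has_vector_derivative h x) (at 0)"
    proof cases
      case (1 k)
      define h where "h x = (of_real (\<phi> (k + 2) x) + of_real (- real k) * of_real (\<phi> (k + 1) x)) * (complex_of_real (-2) * of_real (x \<bullet> v))" for x
      have "((\<lambda>t. g (x + t *\<^sub>R v)) has_vector_derivative h x) (at 0)" for x
      proof -
        have "((\<lambda>t. 1 - (x + t *\<^sub>R v) \<bullet> (x + t *\<^sub>R v)) has_real_derivative - 2 * (x \<bullet> v)) (at 0)"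
          by (auto simp: inner_add_left inner_add_right inner_commute[of v x] intro!: derivative_eq_intros)
        from DERIV_chain'[OF this bump_profile_deriv[of k]]
        have "((\<lambda>t. \<phi> k (x + t *\<^sub>R v)) has_real_derivative (- real k * \<phi> (k + 1) x + \<phi> (k + 2) x) * (- 2 * (x \<bullet> v))) (at 0)"
          by (simp add: \<phi>_def)
        then have "((\<lambda>t. complex_of_real (\<phi> k (x + t *\<^sub>R v))) has_vector_derivative
            complex_of_real ((- real k * \<phi> (k + 1) x + \<phi> (k + 2) x) * (- 2 * (x \<bullet> v)))) (at 0)"
          by (intro bounded_linear.has_vector_derivative[OF bounded_linear_of_real])
             (simp add: has_real_derivative_iff_has_vector_derivative)
        then show ?thesis by (simp add: 1 h_def algebra_simps)
      qed
      moreover have "h \<in> generated_alg B" unfolding h_def[abs_def]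
        by (intro generated_alg.mult generated_alg.add generated_alg.const generated_alg.base) (auto simp: B_def)
      ultimately show ?thesis by blast
    next
      case (2 u)
      have "((\<lambda>t. g (x + t *\<^sub>R v)) has_vector_derivative complex_of_real (v \<bullet> u)) (at 0)" for x
      proof -
        have "((\<lambda>t. (x + t *\<^sub>R v) \<bullet> u) has_real_derivative v \<bullet> u) (at 0)"
          by (auto simp: inner_add_left intro!: derivative_eq_intros)
        then show ?thesis unfolding 2
          by (intro bounded_linear.has_vector_derivative[OF bounded_linear_of_real])
             (simp add: has_real_derivative_iff_has_vector_derivative)
      qed
      then show ?thesis
        by (intro bexI[of _ "\<lambda>_. complex_of_real (v \<bullet> u)"]) (auto intro: generated_alg.const)
    next
      case 3
      have "((\<lambda>t. g (x + t *\<^sub>R v)) has_vector_derivative \<i> * of_real (2 * pi * (v \<bullet> w)) * e x) (at 0)" for x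
        using has_vector_derivative_cis[of "2 * pi * (x \<bullet> w)" "2 * pi * (v \<bullet> w)" 0]
        by (simp add: 3 e_def[abs_def] inner_add_left algebra_simps)
      moreover have "(\<lambda>x. \<i> * of_real (2 * pi * (v \<bullet> w)) * e x) \<in> generated_alg B"
        by (intro generated_alg.mult generated_alg.const generated_alg.base) (auto simp: B_def)
      ultimately show ?thesis by (intro bexI[of _ "\<lambda>x. \<i> * of_real (2 * pi * (v \<bullet> w)) * e x"]) auto
    qed
  next
    show "(\<lambda>x. complex_of_real (\<phi> 0 x) * e x) \<in> generated_alg B"
      by (intro generated_alg.mult generated_alg.base) (auto simp: B_def)
  qed
  have out: "\<phi> k x = 0" if "norm x > 1" for k x
  proof -
    have "1 < (norm x)\<^sup>2" using one_less_power[OF that, of 2] by simp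
    then show ?thesis by (simp add: \<phi>_def bump_profile_def power2_norm_eq_inner)
  qed
  have "bounded {x. complex_of_real (\<phi> 0 x) * e x \<noteq> 0}"
    unfolding bounded_iff
  proof (intro exI[of _ 1] ballI)
    fix x assume "x \<in> {x. complex_of_real (\<phi> 0 x) * e x \<noteq> 0}"
    then have "\<phi> 0 x \<noteq> 0" by auto
    then show "norm x \<le> 1" using out[of x 0] by linarith
  qed
  moreover have "fourier (\<lambda>x. complex_of_real (\<phi> 0 x) * e x) w = of_real (LINT x|lborel. \<phi> 0 x)"
  proof -
    have "complex_of_real (\<phi> 0 x) * e x * cis (- 2 * pi * (x \<bullet> w)) = complex_of_real (\<phi> 0 x)" for x
      by (simp add: e_def mult.assoc cis_mult)
    then show ?thesis unfolding fourier_def by (simp only: integral_complex_of_real)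
  qed
  moreover have "(LINT x|lborel. \<phi> 0 x) \<noteq> 0"
  proof
    assume z: "(LINT x|lborel. \<phi> 0 x) = 0"
    have "integrable lborel (\<lambda>x. indicator (cball 0 1) x *\<^sub>R \<phi> 0 x)"
      by (intro borel_integrable_compact continuous_on_subset[OF c\<phi>]) auto
    also have "(\<lambda>x. indicator (cball 0 1) x *\<^sub>R \<phi> 0 x) = \<phi> 0"
      using out[of _ 0] by (auto simp: fun_eq_iff indicator_def not_le)
    finally have "AE x in lborel. \<phi> 0 x = 0"
      using z \<phi>0 by (simp add: integral_nonneg_eq_0_iff_AE)
    then have "AE x in lborel. x \<notin> ball (0::real^'n) 1"
    proof (rule AE_mp, intro AE_I2 impI)
      fix x :: "real^'n" assume "\<phi> 0 x = 0"
      then have "1 \<le> (norm x)\<^sup>2" by (auto simp: \<phi>_def bump_profile_def power2_norm_eq_inner split: if_splits)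
      then show "x \<notin> ball 0 1" using abs_le_square_iff[of 1 "norm x"] by auto
    qed
    then have "emeasure lborel {x. x \<in> ball (0::real^'n) 1} = 0"
      by (subst (asm) AE_iff_measurable[OF _ refl]) auto
    then have "measure lborel (ball (0::real^'n) 1) = 0" by (simp add: measure_def ball_def)
    then show False using content_ball_pos[of 1 "0::real^'n"] by simp
  qed
  ultimately show ?thesis using s unfolding test_fun_def by (intro exI[of _ "\<lambda>x. complex_of_real (\<phi> 0 x) * e x"]) auto
qed

section \<open>Closure properties and integrability of test functions\<close>

lemma test_fun_out: "test_fun f \<Longrightarrow> \<exists>R. \<forall>x. norm x > R \<longrightarrow> f x = 0"
  unfolding test_fun_def bounded_iff by (metis (mono_tags, lifting) mem_Collect_eq not_le)

lemma test_fun_continuous: "test_fun f \<Longrightarrow> continuous_on UNIV f"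
  using smooth_on_continuous[of UNIV f "[]"] by (simp add: test_fun_def)

lemma test_fun_measurable: "test_fun f \<Longrightarrow> f \<in> borel_measurable borel"
  by (simp add: borel_measurable_continuous_onI test_fun_continuous)

lemma test_fun_dirder:
  assumes f: "test_fun f" and v: "v \<in> Basis"
  shows "test_fun (dirder v f)"
proof -
  have "smooth_on UNIV (dirder v f)"
    using smooth_on_dders[of UNIV f "[v]"] f v by (simp add: test_fun_def)
  moreover obtain R where R: "\<And>x. norm x > R \<Longrightarrow> f x = 0" using test_fun_out[OF f] by blast
  have "dirder v f x = 0" if "norm x > R" for x
  proof -
    have "dirder v f x = dirder v (\<lambda>_. 0) x"
      by (rule dirder_cong_open[of "- cball 0 R"]) (use R that in auto)
    then show ?thesis by (simp add: dirder_def)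
  qed
  then have "bounded {x. dirder v f x \<noteq> 0}"
    unfolding bounded_iff by (intro exI[of _ R]) (auto simp: not_less[symmetric])
  ultimately show ?thesis by (simp add: test_fun_def)
qed

lemma test_fun_translate:
  assumes f: "test_fun f"
  shows "test_fun (\<lambda>x. f (x + c))"
proof -
  obtain R where R: "\<And>x. norm x > R \<Longrightarrow> f x = 0" using test_fun_out[OF f] by blast
  have "norm x \<le> R + norm c" if "f (x + c) \<noteq> 0" for x
    using R[of "x + c"] that norm_diff_ineq[of x c] by force
  then have "bounded {x. f (x + c) \<noteq> 0}" unfolding bounded_iff by blast
  then show ?thesis using f smooth_on_translate unfolding test_fun_def by blast
qed

lemma test_fun_diff:
  assumes "test_fun f" "test_fun g"
  shows "test_fun (\<lambda>x. f x - g x)"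
proof -
  have "bounded ({x. f x \<noteq> 0} \<union> {x. g x \<noteq> 0})" using assms by (simp add: test_fun_def)
  then have "bounded {x. f x - g x \<noteq> 0}" by (rule bounded_subset) auto
  then show ?thesis using assms smooth_on_diff[of f g] unfolding test_fun_def by blast
qed

lemma test_fun_mult_integrable:
  assumes f: "test_fun f" and p: "continuous_on UNIV p"
  shows "integrable lborel (\<lambda>x. p x * f x)"
proof -
  obtain R where R: "\<And>x. norm x > R \<Longrightarrow> f x = 0" using test_fun_out[OF f] by blast
  have "integrable lborel (\<lambda>x. indicator (cball 0 R) x *\<^sub>R (p x * f x))"
    by (intro borel_integrable_compact continuous_on_subset[OF continuous_on_mult[OF p test_fun_continuous[OF f]]]) auto
  also have "(\<lambda>x. indicator (cball 0 R) x *\<^sub>R (p x * f x)) = (\<lambda>x. p x * f x)"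
    using R by (auto simp: fun_eq_iff indicator_def not_le)
  finally show ?thesis .
qed

lemma test_fun_integrable: "test_fun f \<Longrightarrow> integrable lborel f"
  using test_fun_mult_integrable[of f "\<lambda>_. 1"] by simp

lemma test_fun_bounded:
  assumes f: "test_fun f"
  shows "\<exists>B. \<forall>x. norm (f x) \<le> B"
proof -
  obtain R where R: "\<And>x. norm x > R \<Longrightarrow> f x = 0" using test_fun_out[OF f] by blast
  have "compact (f ` cball 0 R)"
    by (intro compact_continuous_image continuous_on_subset[OF test_fun_continuous[OF f]]) auto
  then obtain B where B: "\<And>x. norm x \<le> R \<Longrightarrow> norm (f x) \<le> B"
    using compact_imp_bounded[of "f ` cball 0 R"] unfolding bounded_iff by (metis imageI mem_cball_0)
  have "norm (f x) \<le> max B 0" for x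
    using R[of x] B[of x] by (cases "norm x \<le> R") auto
  then show ?thesis by blast
qed

section \<open>Regularity and decay of the Fourier transform\<close>

lemma fourier_bound:
  "integrable lborel f \<Longrightarrow> norm (fourier f \<xi>) \<le> (LINT x|lborel. norm (f x))"
  unfolding fourier_def
  by (rule order_trans[OF integral_norm_bound]) (simp add: norm_mult)

lemma fourier_continuous:
  assumes f: "integrable lborel f"
  shows "isCont (fourier f) z"
  unfolding continuous_at_sequentially fourier_def comp_def
proof (intro allI impI)
  fix X :: "nat \<Rightarrow> real^'a" assume X: "X \<longlonglongrightarrow> z"
  have [measurable]: "f \<in> borel_measurable borel" using f by auto
  show "(\<lambda>n. LINT x|lborel. f x * cis (- 2 * pi * (x \<bullet> X n))) \<longlonglongrightarrow> (LINT x|lborel. f x * cis (- 2 * pi * (x \<bullet> z)))"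
  proof (rule integral_dominated_convergence[where w="\<lambda>x. norm (f x)"])
    show "AE x in lborel. (\<lambda>n. f x * cis (- 2 * pi * (x \<bullet> X n))) \<longlonglongrightarrow> f x * cis (- 2 * pi * (x \<bullet> z))"
      unfolding cis_conv_exp by (intro AE_I2 tendsto_intros X)
  qed (use f in \<open>auto simp: norm_mult\<close>)
qed

lemma fourier_has_vector_derivative:
  fixes f :: "real^'n \<Rightarrow> complex"
  assumes f: "integrable lborel f" and vf: "integrable lborel (\<lambda>x. of_real (x \<bullet> v) * f x)"
  shows "((\<lambda>t. fourier f (\<xi> + t *\<^sub>R v)) has_vector_derivative
     fourier (\<lambda>x. - 2 * pi * \<i> * of_real (x \<bullet> v) * f x) (\<xi> + t *\<^sub>R v)) (at t)"
  unfolding fourier_def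
proof (rule has_vector_derivative_integral[where g="\<lambda>x. 2 * pi * norm (of_real (x \<bullet> v) * f x)" and
      f'="\<lambda>t x. - 2 * pi * \<i> * of_real (x \<bullet> v) * f x * cis (- 2 * pi * (x \<bullet> (\<xi> + t *\<^sub>R v)))"])
  have [measurable]: "f \<in> borel_measurable borel" using f by auto
  show "complex_integrable lborel (\<lambda>x. f x * cis (- 2 * pi * (x \<bullet> (\<xi> + t *\<^sub>R v))))" for t
    by (rule integrable_mult_cis[OF f]) simp
  show "((\<lambda>s. f x * cis (- 2 * pi * (x \<bullet> (\<xi> + s *\<^sub>R v)))) has_vector_derivative
      - 2 * pi * \<i> * of_real (x \<bullet> v) * f x * cis (- 2 * pi * (x \<bullet> (\<xi> + t *\<^sub>R v)))) (at t)" for t x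
    using has_vector_derivative_mult_right[OF has_vector_derivative_cis[of "- 2 * pi * (x \<bullet> \<xi>)" "- 2 * pi * (x \<bullet> v)" t], of "f x"]
    by (simp add: inner_add_right algebra_simps)
  show "norm (- 2 * pi * \<i> * of_real (x \<bullet> v) * f x * cis (- 2 * pi * (x \<bullet> (\<xi> + t *\<^sub>R v)))) \<le> 2 * pi * norm (of_real (x \<bullet> v) * f x)" for t x
    by (simp add: norm_mult)
  show "integrable lborel (\<lambda>x. 2 * pi * norm (of_real (x \<bullet> v) * f x))"
    by (intro integrable_mult_right integrable_norm vf)
  show "(\<lambda>x. - 2 * pi * \<i> * of_real (x \<bullet> v) * f x * cis (- 2 * pi * (x \<bullet> (\<xi> + t *\<^sub>R v)))) \<in> borel_measurable lborel"
    by measurable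
qed

lemma fourier_translate:
  assumes [measurable]: "f \<in> borel_measurable borel"
  shows "fourier (\<lambda>x. f (x + w)) \<xi> = cis (2 * pi * (w \<bullet> \<xi>)) * fourier f \<xi>"
proof -
  have "fourier (\<lambda>x. f (x + w)) \<xi> = (LINT x|lborel. f (w + x) * cis (- 2 * pi * (((w + x) - w) \<bullet> \<xi>)))"
    by (simp add: fourier_def add.commute)
  also have "\<dots> = (LINT x|lborel. f x * cis (- 2 * pi * ((x - w) \<bullet> \<xi>)))"
    by (rule integral_lborel_translate[of "\<lambda>y. f y * cis (- 2 * pi * ((y - w) \<bullet> \<xi>))"]) measurable
  also have "\<dots> = (LINT x|lborel. cis (2 * pi * (w \<bullet> \<xi>)) * (f x * cis (- 2 * pi * (x \<bullet> \<xi>))))"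
  proof (rule Bochner_Integration.integral_cong)
    fix x
    have "cis (- 2 * pi * ((x - w) \<bullet> \<xi>)) = cis (2 * pi * (w \<bullet> \<xi>)) * cis (- 2 * pi * (x \<bullet> \<xi>))"
      unfolding cis_mult by (simp add: inner_diff_left algebra_simps)
    then show "f x * cis (- 2 * pi * ((x - w) \<bullet> \<xi>)) = cis (2 * pi * (w \<bullet> \<xi>)) * (f x * cis (- 2 * pi * (x \<bullet> \<xi>)))"
      by (simp only: mult_ac)
  qed simp
  finally show ?thesis by (simp add: fourier_def)
qed

text \<open>In place of integration by parts, \<open>f\<close> is translated by t v. The transform
  of the translate is a character in t times \<open>fourier f \<xi>\<close>; differentiating this at
  t = 0, and differentiating under the integral, gives the two sides.\<close>

lemma fourier_dirder:
  fixes f :: "real^'n \<Rightarrow> complex"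
  assumes f: "test_fun f" and v: "v \<in> Basis"
  shows "fourier (dirder v f) \<xi> = 2 * pi * \<i> * of_real (v \<bullet> \<xi>) * fourier f \<xi>"
proof -
  have [measurable]: "f \<in> borel_measurable borel" "dirder v f \<in> borel_measurable borel"
    using test_fun_measurable f test_fun_dirder[OF f v] by auto
  obtain B where B: "\<And>x. norm (dirder v f x) \<le> B" using test_fun_bounded[OF test_fun_dirder[OF f v]] by blast
  obtain R where R: "\<And>x. norm x > R \<Longrightarrow> dirder v f x = 0" using test_fun_out[OF test_fun_dirder[OF f v]] by blast
  have B0: "B \<ge> 0" using order_trans[OF norm_ge_zero B] .
  have "((\<lambda>t. LINT x|lborel. f (x + t *\<^sub>R v) * cis (- 2 * pi * (x \<bullet> \<xi>))) has_vector_derivative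
      (LINT x|lborel. dirder v f (x + 0 *\<^sub>R v) * cis (- 2 * pi * (x \<bullet> \<xi>)))) (at 0)"
  \<comment> \<open>For |t| < 1 and the unit vector \<open>v\<close>, the translated support stays
    in the ball of radius \<open>R + 1\<close>, which makes the constant majorant
    integrable.\<close>
  proof (rule has_vector_derivative_integral[where g="\<lambda>x. indicator (cball 0 (R + 1)) x *\<^sub>R B" and
      f'="\<lambda>t x. dirder v f (x + t *\<^sub>R v) * cis (- 2 * pi * (x \<bullet> \<xi>))"])
    show "complex_integrable lborel (\<lambda>x. f (x + t *\<^sub>R v) * cis (- 2 * pi * (x \<bullet> \<xi>)))" for t
      by (rule integrable_mult_cis[OF test_fun_integrable[OF test_fun_translate[OF f]]]) measurable
    show "((\<lambda>s. f (x + s *\<^sub>R v) * cis (- 2 * pi * (x \<bullet> \<xi>))) has_vector_derivative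
        dirder v f (x + t *\<^sub>R v) * cis (- 2 * pi * (x \<bullet> \<xi>))) (at t)" for t x
      using f smooth_on_has_vector_derivative[of UNIV f "[]" v x t] v
      by (intro has_vector_derivative_mult_left) (simp add: test_fun_def)
    show "norm (dirder v f (x + t *\<^sub>R v) * cis (- 2 * pi * (x \<bullet> \<xi>))) \<le> indicator (cball 0 (R + 1)) x *\<^sub>R B"
      if "\<bar>t - 0\<bar> < 1" for t x
    proof (cases "norm x \<le> R + 1")
      case False
      have "norm (t *\<^sub>R v) < 1" using that v by simp
      then have "norm (x + t *\<^sub>R v) > R" using False norm_diff_ineq[of x "t *\<^sub>R v"] by linarith
      then show ?thesis using R B0 by simp
    qed (use B in \<open>simp add: norm_mult\<close>)
    show "integrable lborel (\<lambda>x::real^'n. indicator (cball 0 (R + 1)) x *\<^sub>R B)"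
      by (rule borel_integrable_compact) auto
  qed measurable
  moreover have "(LINT x|lborel. f (x + t *\<^sub>R v) * cis (- 2 * pi * (x \<bullet> \<xi>))) = cis (0 + t * (2 * pi * (v \<bullet> \<xi>))) * fourier f \<xi>" for t
    using fourier_translate[of f "t *\<^sub>R v" \<xi>] by (simp add: fourier_def mult_ac)
  moreover have "((\<lambda>t. cis (0 + t * (2 * pi * (v \<bullet> \<xi>))) * fourier f \<xi>) has_vector_derivative
     \<i> * of_real (2 * pi * (v \<bullet> \<xi>)) * cis (0 + 0 * (2 * pi * (v \<bullet> \<xi>))) * fourier f \<xi>) (at 0)"
    by (intro has_vector_derivative_mult_left has_vector_derivative_cis)
  ultimately have "(LINT x|lborel. dirder v f (x + 0 *\<^sub>R v) * cis (- 2 * pi * (x \<bullet> \<xi>))) =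
     \<i> * of_real (2 * pi * (v \<bullet> \<xi>)) * cis (0 + 0 * (2 * pi * (v \<bullet> \<xi>))) * fourier f \<xi>"
    by (simp only: ) (rule vector_derivative_unique_at)
  then show ?thesis by (simp add: fourier_def mult_ac)
qed

text \<open>One power of |\<xi>| is at most the sum of the |\<xi>.b|, and each such factor is
  absorbed into \<open>dirder b f\<close>, again a test function; hence the induction runs over all
  test functions at once. The factor 2 pi is at least 1 and is dropped.\<close>

lemma fourier_decay: "test_fun f \<Longrightarrow> \<exists>C. \<forall>\<xi>. norm \<xi> ^ k * norm (fourier f \<xi>) \<le> C"
proof (induction k arbitrary: f)
  case 0
  then show ?case using fourier_bound[OF test_fun_integrable] by auto
next
  case (Suc k)
  have "\<forall>b. \<exists>C. b \<in> Basis \<longrightarrow> (\<forall>\<xi>. norm \<xi> ^ k * norm (fourier (dirder b f) \<xi>) \<le> C)"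
    using Suc by (blast intro: test_fun_dirder)
  then obtain C where C: "\<And>b \<xi>. b \<in> Basis \<Longrightarrow> norm \<xi> ^ k * norm (fourier (dirder b f) \<xi>) \<le> C b"
    by metis
  have "norm \<xi> ^ Suc k * norm (fourier f \<xi>) \<le> (\<Sum>b\<in>Basis. C b)" for \<xi>
  proof -
    have "norm \<xi> ^ Suc k * norm (fourier f \<xi>) = norm \<xi> * (norm \<xi> ^ k * norm (fourier f \<xi>))" by simp
    also have "\<dots> \<le> (\<Sum>b\<in>Basis. \<bar>\<xi> \<bullet> b\<bar>) * (norm \<xi> ^ k * norm (fourier f \<xi>))"
      by (intro mult_right_mono norm_le_l1) auto
    also have "\<dots> = (\<Sum>b\<in>Basis. \<bar>\<xi> \<bullet> b\<bar> * (norm \<xi> ^ k * norm (fourier f \<xi>)))" by (rule sum_distrib_right)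
    also have "\<dots> \<le> (\<Sum>b\<in>Basis. C b)"
    proof (rule sum_mono)
      fix b :: "real^'a" assume b: "b \<in> Basis"
      have "\<bar>\<xi> \<bullet> b\<bar> * (norm \<xi> ^ k * norm (fourier f \<xi>)) \<le> (2 * pi) * (\<bar>\<xi> \<bullet> b\<bar> * (norm \<xi> ^ k * norm (fourier f \<xi>)))"
        using pi_gt3 mult_right_mono[of 1 "2 * pi" "\<bar>\<xi> \<bullet> b\<bar> * (norm \<xi> ^ k * norm (fourier f \<xi>))"] by simp
      also have "\<dots> = norm \<xi> ^ k * norm (fourier (dirder b f) \<xi>)"
        using Suc.prems b by (simp add: fourier_dirder norm_mult inner_commute)
      finally show "\<bar>\<xi> \<bullet> b\<bar> * (norm \<xi> ^ k * norm (fourier f \<xi>)) \<le> C b" using C[OF b, of \<xi>] by linarith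
    qed
    finally show ?thesis .
  qed
  then show ?case by blast
qed

lemma integrable_fourier_test_fun:
  fixes f :: "real^'n \<Rightarrow> complex"
  assumes f: "test_fun f" shows "integrable lborel (fourier f)"
proof -
  obtain C where "\<And>\<xi>. norm \<xi> ^ (2 * DIM(real^'n)) * norm (fourier f \<xi>) \<le> C" using fourier_decay[OF f] by blast
  moreover have "fourier f \<in> borel_measurable borel" using test_fun_measurable[OF f] by measurable
  ultimately show ?thesis using fourier_bound[OF test_fun_integrable[OF f]] by (intro integrable_if_decay)
qed

section \<open>Vanishing moments\<close>

text \<open>The factor that the Fourier kernel acquires when differentiated along all of
  \<open>vs\<close>: the derivative of \<open>fourier f\<close> along \<open>vs\<close> is the
  transform of \<open>fweight vs\<close> times \<open>f\<close>, without further constants.\<close>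

definition fweight :: "(real^'n) list \<Rightarrow> real^'n \<Rightarrow> complex" where
  "fweight vs x = (\<Prod>v\<leftarrow>vs. - 2 * pi * \<i> * of_real (x \<bullet> v))"

lemma fweight_simps [simp]:
  "fweight [] x = 1" "fweight (v # vs) x = - 2 * pi * \<i> * of_real (x \<bullet> v) * fweight vs x"
  by (simp_all add: fweight_def)

lemma continuous_on_fweight [continuous_intros]:
  "continuous_on S f \<Longrightarrow> continuous_on S (\<lambda>x. fweight vs (f x))"
  by (induction vs) (auto intro!: continuous_intros)

lemma measurable_fweight [measurable]: "fweight vs \<in> borel_measurable borel"
  by (intro borel_measurable_continuous_onI) (auto intro!: continuous_intros)

lemma norm_fweight_le: "set vs \<subseteq> Basis \<Longrightarrow> norm (fweight vs x) \<le> (2 * pi * norm x) ^ length vs"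
proof (induction vs)
  case (Cons v vs)
  have "norm (fweight (v # vs) x) = (2 * pi * \<bar>x \<bullet> v\<bar>) * norm (fweight vs x)" by (simp add: norm_mult)
  also have "\<dots> \<le> (2 * pi * norm x) * (2 * pi * norm x) ^ length vs"
    using Cons Basis_le_norm[of v x] by (intro mult_mono) auto
  finally show ?case by simp
qed simp

text \<open>The strict inequality makes \<open>K = 0\<close> an empty condition, the start of an
  induction that gains one order at a time; \<open>O_N N\<close> corresponds to
  \<open>K = Suc N\<close>.\<close>

definition vanishing_moments :: "nat \<Rightarrow> (real^'n \<Rightarrow> complex) \<Rightarrow> bool" where
  "vanishing_moments K f \<longleftrightarrow>
     (\<forall>vs. set vs \<subseteq> Basis \<and> length vs < K \<longrightarrow> (LINT x|lborel. fweight vs x * f x) = 0)"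

lemma vanishing_momentsD:
  "vanishing_moments K f \<Longrightarrow> set vs \<subseteq> Basis \<Longrightarrow> length vs < K \<Longrightarrow> (LINT x|lborel. fweight vs x * f x) = 0"
  by (simp add: vanishing_moments_def)

section \<open>Multi-indices and lists of coordinate directions\<close>

lemma Basis_vec_eq: "(Basis :: (real^'n) set) = range (\<lambda>i. axis i 1)"
  by (auto simp: Basis_vec_def)

definition multi_index :: "(real^'n) list \<Rightarrow> 'n \<Rightarrow> nat" where
  "multi_index vs i = count_list vs (axis i 1)"

lemma fweight_monom:
  "set vs \<subseteq> Basis \<Longrightarrow> fweight vs x = (- 2 * pi * \<i>) ^ length vs * of_real (monom (multi_index vs) x)"
proof (induction vs)
  case Nil
  then show ?case by (simp add: monom_def multi_index_def)
next
  case (Cons v vs)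
  then obtain j where j: "v = axis j 1" by (auto simp: Basis_vec_eq)
  have "monom (multi_index (v # vs)) x = (\<Prod>i\<in>UNIV. (if i = j then x $ i else 1) * (x $ i) ^ multi_index vs i)"
    unfolding monom_def by (rule prod.cong) (auto simp: multi_index_def j axis_eq_axis)
  also have "\<dots> = x $ j * monom (multi_index vs) x"
    by (simp add: prod.distrib monom_def)
  finally show ?case using Cons by (simp add: j inner_axis)
qed

lemma mabs_multi_index: "set vs \<subseteq> Basis \<Longrightarrow> mabs (multi_index vs) = length vs"
proof (induction vs)
  case Nil
  then show ?case by (simp add: mabs_def multi_index_def)
next
  case (Cons v vs)
  then obtain j where j: "v = axis j 1" by (auto simp: Basis_vec_eq)
  have "mabs (multi_index (v # vs)) = (\<Sum>i\<in>UNIV. (if i = j then 1 else 0) + multi_index vs i)"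
    unfolding mabs_def by (rule sum.cong) (auto simp: multi_index_def j axis_eq_axis)
  also have "\<dots> = Suc (mabs (multi_index vs))" by (simp add: sum.distrib mabs_def)
  finally show ?case using Cons by simp
qed

lemma count_list_mlist: "count_list (mlist \<alpha>) i = \<alpha> i"
proof -
  have "\<exists>l. \<forall>i. count_list l i = \<alpha> i"
  proof -
    obtain l where l: "mset l = (\<Sum>i\<in>UNIV. replicate_mset (\<alpha> i) i)" using ex_mset by blast
    have "count_list l i = \<alpha> i" for i
      by (simp add: count_mset[symmetric] l count_sum)
    then show ?thesis by blast
  qed
  then show ?thesis unfolding mlist_def by (rule someI2_ex) blast
qed

definition vlist :: "('n \<Rightarrow> nat) \<Rightarrow> (real^'n) list" where
  "vlist \<alpha> = map (\<lambda>i. axis i 1) (mlist \<alpha>)"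

lemma set_vlist: "set (vlist \<alpha>) \<subseteq> Basis"
  by (auto simp: vlist_def Basis_vec_eq)

lemma multi_index_vlist: "multi_index (vlist \<alpha>) = \<alpha>"
  by (rule ext) (simp add: multi_index_def vlist_def count_list_map_conv[of "\<lambda>i. axis i (1::real)"] inj_def axis_eq_axis count_list_mlist)

lemma length_vlist: "length (vlist \<alpha>) = mabs \<alpha>"
  using mabs_multi_index[OF set_vlist[of \<alpha>]] by (simp add: multi_index_vlist)

lemma mset_vlist_multi_index:
  assumes "set vs \<subseteq> Basis" shows "mset (vlist (multi_index vs)) = mset vs"
proof (rule multiset_eqI)
  fix v :: "real^'a"
  show "count (mset (vlist (multi_index vs))) v = count (mset vs) v"
  proof (cases "v \<in> Basis")
    case True
    then obtain i where "v = axis i 1" by (auto simp: Basis_vec_eq)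
    then show ?thesis using fun_cong[OF multi_index_vlist, of "multi_index vs" i] by (simp add: count_mset multi_index_def)
  next
    case False
    then show ?thesis using assms set_vlist by (metis count_eq_zero_iff set_mset_mset subsetD)
  qed
qed

text \<open>For basis vectors, \<open>fweight\<close> is a monomial times a nonzero power of -2 pi
  i. Constants leave a Bochner integral whether or not it converges, so the equivalence also covers
  the output of the bilinear operator.\<close>

lemma monom_moments_iff:
  "(\<forall>\<beta>. mabs \<beta> \<le> N \<longrightarrow> (LINT x|lborel. of_real (monom \<beta> x) * f x) = 0) \<longleftrightarrow> vanishing_moments (Suc N) f"
proof -
  have e: "(LINT x|lborel. fweight vs x * f x) = (- 2 * pi * \<i>) ^ length vs * (LINT x|lborel. of_real (monom (multi_index vs) x) * f x)"
    if "set vs \<subseteq> Basis" for vs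
    by (subst integral_mult_right_zero[symmetric]) (simp add: fweight_monom[OF that] mult.assoc)
  show ?thesis
  proof
    assume "\<forall>\<beta>. mabs \<beta> \<le> N \<longrightarrow> (LINT x|lborel. of_real (monom \<beta> x) * f x) = 0"
    then show "vanishing_moments (Suc N) f" by (auto simp: vanishing_moments_def e mabs_multi_index)
  next
    assume v: "vanishing_moments (Suc N) f"
    show "\<forall>\<beta>. mabs \<beta> \<le> N \<longrightarrow> (LINT x|lborel. of_real (monom \<beta> x) * f x) = 0"
    proof (intro allI impI)
      fix \<beta> :: "'a \<Rightarrow> nat" assume "mabs \<beta> \<le> N"
      then show "(LINT x|lborel. of_real (monom \<beta> x) * f x) = 0"
        using vanishing_momentsD[OF v set_vlist[of \<beta>]] by (simp add: e[OF set_vlist] length_vlist multi_index_vlist)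
    qed
  qed
qed

lemma O_N_iff: "f \<in> O_N N \<longleftrightarrow> test_fun f \<and> vanishing_moments (Suc N) f"
  by (simp add: O_N_def test_fun_def monom_moments_iff compact_closure)

text \<open>Peel off one factor at a time: (x - c).v = x.v - c.v either hands the direction to
  \<open>us\<close> or leaves a constant and lowers the degree. The second list is what makes this
  induction close.\<close>

lemma vanishing_moments_shift:
  assumes f: "test_fun f" and K: "vanishing_moments K f"
  shows "set vs \<subseteq> Basis \<Longrightarrow> set us \<subseteq> Basis \<Longrightarrow> length vs + length us < K \<Longrightarrow>
    (LINT x|lborel. fweight vs (x - c) * fweight us x * f x) = 0"
proof (induction vs arbitrary: us)
  case Nil
  then show ?case using vanishing_momentsD[OF K] by simp
next
  case (Cons v vs)
  have i: "integrable lborel (\<lambda>x. fweight vs (x - c) * fweight us x * f x)" for us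
    by (intro test_fun_mult_integrable[OF f] continuous_intros)
  have "(LINT x|lborel. fweight (v # vs) (x - c) * fweight us x * f x) =
     (LINT x|lborel. fweight vs (x - c) * fweight (v # us) x * f x
        + (2 * pi * \<i> * of_real (c \<bullet> v)) * (fweight vs (x - c) * fweight us x * f x))"
    by (rule Bochner_Integration.integral_cong) (simp_all add: inner_diff_left algebra_simps)
  also have "\<dots> = 0"
    using i[of us] i[of "v # us"] Cons.IH[of us] Cons.IH[of "v # us"] Cons.prems
    by (subst Bochner_Integration.integral_add) (simp_all del: fweight_simps)
  finally show ?case .
qed

lemma integral_mult_translate:
  assumes f: "test_fun f" and p: "continuous_on UNIV p"
  shows "(LINT x|lborel. p x * f (x + w)) = (LINT x|lborel. p (x - w) * f x)"
proof -
  have [measurable]: "p \<in> borel_measurable borel" "f \<in> borel_measurable borel"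
    using p test_fun_measurable[OF f] by (auto intro: borel_measurable_continuous_onI)
  have "(LINT x|lborel. p x * f (x + w)) = (LINT x|lborel. p ((w + x) - w) * f (w + x))"
    by (simp add: add.commute)
  also have "\<dots> = (LINT x|lborel. p (x - w) * f x)"
    by (rule integral_lborel_translate[of "\<lambda>y. p (y - w) * f y"]) measurable
  finally show ?thesis .
qed

lemma O_N_translate:
  assumes "f \<in> O_N N" shows "(\<lambda>x. f (x + w)) \<in> O_N N"
proof -
  have f: "test_fun f" "vanishing_moments (Suc N) f" using assms by (simp_all add: O_N_iff)
  have "(LINT x|lborel. fweight vs x * f (x + w)) = 0" if "set vs \<subseteq> Basis" "length vs < Suc N" for vs
    using vanishing_moments_shift[OF f that(1), of "[]" w] that(2)
    by (subst integral_mult_translate[OF f(1)]) (auto intro!: continuous_intros)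
  then show ?thesis using test_fun_translate[OF f(1)] by (simp add: O_N_iff vanishing_moments_def)
qed

text \<open>Moving the translation onto the weight leaves
  \<open>fweight vs (x - w) - fweight vs x\<close>, whose top-degree parts cancel. A finite
  difference therefore gains one order of vanishing.\<close>

lemma vanishing_moments_difference:
  assumes f: "test_fun f" and K: "vanishing_moments K f"
  shows "vanishing_moments (Suc K) (\<lambda>x. f (x + w) - f x)"
proof -
  have d: "(LINT x|lborel. (fweight vs (x - w) - fweight vs x) * fweight us x * f x) = 0"
    if "set vs \<subseteq> Basis" "set us \<subseteq> Basis" "length vs + length us \<le> K" for vs us
    using that
  proof (induction vs arbitrary: us)
    case (Cons v vs)
    let ?D = "\<lambda>us x. (fweight vs (x - w) - fweight vs x) * fweight us x * f x"
    have i: "integrable lborel (?D us)" for us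
      by (intro test_fun_mult_integrable[OF f] continuous_intros)
    have j: "integrable lborel (\<lambda>x. fweight vs (x - w) * fweight us x * f x)"
      by (intro test_fun_mult_integrable[OF f] continuous_intros)
    have "(LINT x|lborel. (fweight (v # vs) (x - w) - fweight (v # vs) x) * fweight us x * f x) =
       (LINT x|lborel. ?D (v # us) x + (2 * pi * \<i> * of_real (w \<bullet> v)) * (fweight vs (x - w) * fweight us x * f x))"
      by (rule Bochner_Integration.integral_cong) (simp_all add: inner_diff_left algebra_simps)
    also have "\<dots> = 0"
      using i[of "v # us"] j Cons.IH[of "v # us"] Cons.prems vanishing_moments_shift[OF f K, of vs us w]
      by (subst Bochner_Integration.integral_add) (simp_all del: fweight_simps)
    finally show ?case .
  qed simp
  show ?thesis unfolding vanishing_moments_def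
  proof (intro allI impI, elim conjE)
    fix vs :: "(real^'a) list" assume vs: "set vs \<subseteq> Basis" "length vs < Suc K"
    have i: "integrable lborel (\<lambda>x. fweight vs x * f (x + w))" "integrable lborel (\<lambda>x. fweight vs x * f x)"
      "integrable lborel (\<lambda>x. fweight vs (x - w) * f x)"
      by (intro test_fun_mult_integrable f test_fun_translate continuous_intros)+
    have "(LINT x|lborel. fweight vs x * (f (x + w) - f x)) =
       (LINT x|lborel. fweight vs x * f (x + w)) - (LINT x|lborel. fweight vs x * f x)"
      using i by (simp add: right_diff_distrib)
    also have "(LINT x|lborel. fweight vs x * f (x + w)) = (LINT x|lborel. fweight vs (x - w) * f x)"
      by (rule integral_mult_translate[OF f]) (intro continuous_intros)
    also have "(LINT x|lborel. fweight vs (x - w) * f x) - (LINT x|lborel. fweight vs x * f x) =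
       (LINT x|lborel. (fweight vs (x - w) - fweight vs x) * fweight [] x * f x)"
      using i by (simp add: left_diff_distrib)
    also have "\<dots> = 0" using d[of vs "[]"] vs by simp
    finally show "(LINT x|lborel. fweight vs x * (f (x + w) - f x)) = 0" .
  qed
qed

text \<open>Start from a modulated bump and take N + 1 successive differences to supply the moments;
  each difference merely multiplies the transform at \<xi> by -2. The origin is excluded because the
  zeroth moment vanishes.\<close>

lemma exists_O_N_fourier_nonzero:
  fixes \<xi> :: "real^'n"
  assumes "\<xi> \<noteq> 0"
  shows "\<exists>f \<in> O_N N. fourier f \<xi> \<noteq> 0"
proof -
  \<comment> \<open>Chosen with w.\<xi> = 1/2, so that translation by \<open>w\<close> multiplies
    the transform at \<xi> by cis(pi) = -1.\<close>
  define w where "w = (1 / (2 * (\<xi> \<bullet> \<xi>))) *\<^sub>R \<xi>"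
  have w: "w \<bullet> \<xi> = 1 / 2" using assms by (simp add: w_def)
  have "\<exists>f. test_fun f \<and> vanishing_moments K f \<and> fourier f \<xi> \<noteq> 0" for K
  proof (induction K)
    case 0
    then show ?case using exists_modulated_bump by (simp add: vanishing_moments_def)
  next
    case (Suc K)
    then obtain f where f: "test_fun f" "vanishing_moments K f" "fourier f \<xi> \<noteq> 0" by blast
    have i: "integrable lborel (\<lambda>x. f (x + w) * cis (- 2 * pi * (x \<bullet> \<xi>)))" "integrable lborel (\<lambda>x. f x * cis (- 2 * pi * (x \<bullet> \<xi>)))"
      by (rule integrable_mult_cis; simp add: test_fun_integrable test_fun_translate f)+
    have "fourier (\<lambda>x. f (x + w) - f x) \<xi> = fourier (\<lambda>x. f (x + w)) \<xi> - fourier f \<xi>"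
      using i by (simp add: fourier_def left_diff_distrib)
    also have "\<dots> = (cis (2 * pi * (w \<bullet> \<xi>)) - 1) * fourier f \<xi>"
      by (subst fourier_translate) (simp_all add: test_fun_measurable f algebra_simps)
    also have "\<dots> = - 2 * fourier f \<xi>" by (simp add: w)
    finally have "fourier (\<lambda>x. f (x + w) - f x) \<xi> \<noteq> 0" using f(3) by simp
    then show ?case
      using vanishing_moments_difference[OF f(1,2)] test_fun_diff[OF test_fun_translate[OF f(1)] f(1)] by blast
  qed
  from this[of "Suc N"] show ?thesis by (auto simp: O_N_iff)
qed

text \<open>These integrals arise from the Taylor terms of the Fourier kernel. Expanding one factor
  x.\<xi> in coordinates moves each x.b into the weight and keeps the total degree.\<close>

lemma vanishing_moments_inner_power:
  assumes f: "test_fun f" and K: "vanishing_moments K f"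
  shows "set vs \<subseteq> Basis \<Longrightarrow> length vs + j < K \<Longrightarrow>
    (LINT x|lborel. of_real ((x \<bullet> \<xi>) ^ j) * (fweight vs x * f x)) = 0"
proof (induction j arbitrary: vs)
  case 0
  then show ?case using vanishing_momentsD[OF K] by simp
next
  case (Suc j)
  have i: "integrable lborel (\<lambda>x. of_real ((x \<bullet> \<xi>) ^ j) * (fweight vs x * f x))" for vs
    unfolding mult.assoc[symmetric] by (intro test_fun_mult_integrable[OF f] continuous_intros)
  have "of_real ((x \<bullet> \<xi>) ^ Suc j) * (fweight vs x * f x) =
      (\<Sum>b\<in>Basis. (of_real (\<xi> \<bullet> b) / (- 2 * pi * \<i>)) * (of_real ((x \<bullet> \<xi>) ^ j) * (fweight (b # vs) x * f x)))" for x
  proof -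
    have "of_real (x \<bullet> \<xi>) = (\<Sum>b\<in>Basis. complex_of_real (x \<bullet> b) * of_real (\<xi> \<bullet> b))"
      by (subst euclidean_inner) simp
    then have "of_real ((x \<bullet> \<xi>) ^ Suc j) * (fweight vs x * f x) =
       (\<Sum>b\<in>Basis. complex_of_real (x \<bullet> b) * of_real (\<xi> \<bullet> b) * (of_real ((x \<bullet> \<xi>) ^ j) * (fweight vs x * f x)))"
      by (simp only: power_Suc of_real_mult sum_distrib_right mult.assoc)
    also have "\<dots> = (\<Sum>b\<in>Basis. (of_real (\<xi> \<bullet> b) / (- 2 * pi * \<i>)) * (of_real ((x \<bullet> \<xi>) ^ j) * (fweight (b # vs) x * f x)))"
      by (rule sum.cong) (simp_all add: mult_ac)
    finally show ?thesis .
  qed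
  then have "(LINT x|lborel. of_real ((x \<bullet> \<xi>) ^ Suc j) * (fweight vs x * f x)) =
      (\<Sum>b\<in>Basis. (LINT x|lborel. (of_real (\<xi> \<bullet> b) / (- 2 * pi * \<i>)) * (of_real ((x \<bullet> \<xi>) ^ j) * (fweight (b # vs) x * f x))))"
    using i by (simp only:) (rule Bochner_Integration.integral_sum, rule integrable_mult_right, assumption)
  also have "\<dots> = 0"
  proof (rule sum.neutral, rule ballI)
    fix b :: "real^'a" assume "b \<in> Basis"
    then have "(LINT x|lborel. of_real ((x \<bullet> \<xi>) ^ j) * (fweight (b # vs) x * f x)) = 0"
      using Suc.prems by (intro Suc.IH) auto
    then show "(LINT x|lborel. (of_real (\<xi> \<bullet> b) / (- 2 * pi * \<i>)) * (of_real ((x \<bullet> \<xi>) ^ j) * (fweight (b # vs) x * f x))) = 0"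
      by (simp only: integral_mult_right_zero) simp
  qed
  finally show ?case .
qed

text \<open>Subtracting the Taylor polynomial of the exponential inside the Fourier integral costs
  nothing, because its terms integrate to moments of \<open>f\<close> that vanish.\<close>

lemma fourier_fweight_bound:
  fixes f :: "real^'n \<Rightarrow> complex"
  assumes f: "test_fun f" and K: "vanishing_moments (Suc N) f" and vs: "set vs \<subseteq> Basis" "length vs \<le> N"
  shows "\<exists>C. \<forall>\<xi>. norm (fourier (\<lambda>x. fweight vs x * f x) \<xi>) \<le> C * norm \<xi> ^ (Suc N - length vs)"
proof -
  \<comment> \<open>The largest degree of a Taylor term that, together with the weight, is still a
    moment of order at most \<open>N\<close>; the remainder then has order n + 1.\<close>
  define n where "n = N - length vs"
  define g where "g x = fweight vs x * f x" for x
  have n: "Suc N - length vs = Suc n" using vs by (simp add: n_def)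
  have ig: "integrable lborel (\<lambda>x. of_real (p x) * g x)" if "continuous_on UNIV p" for p :: "real^'n \<Rightarrow> real"
    unfolding g_def mult.assoc[symmetric] by (intro test_fun_mult_integrable[OF f] continuous_intros that)
  have g1: "integrable lborel g" using ig[of "\<lambda>_. 1"] by simp
  then have [measurable]: "g \<in> borel_measurable borel" by auto
  define C where "C = (2 * pi) ^ Suc n * (LINT x|lborel. norm (of_real (norm x ^ Suc n) * g x))"
  have "norm (fourier g \<xi>) \<le> C * norm \<xi> ^ Suc n" for \<xi>
  proof -
    define P where "P x = (\<Sum>k\<le>n. (\<i> * of_real (- 2 * pi * (x \<bullet> \<xi>))) ^ k / fact k)" for x
    have t: "g x * (\<i> * of_real (- 2 * pi * (x \<bullet> \<xi>))) ^ k / fact k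
        = ((\<i> * of_real (- 2 * pi)) ^ k / fact k) * (of_real ((x \<bullet> \<xi>) ^ k) * g x)" for x k
    proof -
      have "\<i> * of_real (- 2 * pi * (x \<bullet> \<xi>)) = (\<i> * of_real (- 2 * pi)) * of_real (x \<bullet> \<xi>)" by simp
      then have "(\<i> * of_real (- 2 * pi * (x \<bullet> \<xi>))) ^ k = (\<i> * of_real (- 2 * pi)) ^ k * of_real ((x \<bullet> \<xi>) ^ k)"
        by (simp only: power_mult_distrib of_real_power)
      then show ?thesis by (simp only: times_divide_eq_left times_divide_eq_right mult_ac)
    qed
    have it: "integrable lborel (\<lambda>x. g x * (\<i> * of_real (- 2 * pi * (x \<bullet> \<xi>))) ^ k / fact k)" for k
      unfolding t by (intro integrable_mult_right ig continuous_intros)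
    have gP: "g x * P x = (\<Sum>k\<le>n. g x * (\<i> * of_real (- 2 * pi * (x \<bullet> \<xi>))) ^ k / fact k)" for x
      by (simp add: P_def sum_distrib_left)
    have iP: "integrable lborel (\<lambda>x. g x * P x)" unfolding gP by (intro Bochner_Integration.integrable_sum it)
    have "(LINT x|lborel. g x * P x) = (\<Sum>k\<le>n. LINT x|lborel. g x * (\<i> * of_real (- 2 * pi * (x \<bullet> \<xi>))) ^ k / fact k)"
      unfolding gP by (intro Bochner_Integration.integral_sum it)
    also have "\<dots> = (\<Sum>k\<le>n. 0)"
    proof (rule sum.cong)
      fix k assume "k \<in> {..n}"
      then have "(LINT x|lborel. of_real ((x \<bullet> \<xi>) ^ k) * g x) = 0"
        unfolding g_def using vs by (intro vanishing_moments_inner_power[OF f K]) (auto simp: n_def)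
      then show "(LINT x|lborel. g x * (\<i> * of_real (- 2 * pi * (x \<bullet> \<xi>))) ^ k / fact k) = 0"
        unfolding t by (simp only: integral_mult_right_zero) simp
    qed simp
    finally have P0: "(LINT x|lborel. g x * P x) = 0" by simp
    have ic: "integrable lborel (\<lambda>x. g x * cis (- 2 * pi * (x \<bullet> \<xi>)))" by (rule integrable_mult_cis[OF g1]) simp
    have "fourier g \<xi> = (LINT x|lborel. g x * cis (- 2 * pi * (x \<bullet> \<xi>))) - (LINT x|lborel. g x * P x)"
      by (simp add: fourier_def P0)
    also have "\<dots> = (LINT x|lborel. g x * (cis (- 2 * pi * (x \<bullet> \<xi>)) - P x))"
      using Bochner_Integration.integral_diff[OF ic iP] by (simp only: right_diff_distrib[of "g _"])
    finally have "norm (fourier g \<xi>) \<le> (LINT x|lborel. norm (g x * (cis (- 2 * pi * (x \<bullet> \<xi>)) - P x)))"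
      by (simp only: integral_norm_bound)
    also have "\<dots> \<le> (LINT x|lborel. ((2 * pi) ^ Suc n * norm \<xi> ^ Suc n) * norm (of_real (norm x ^ Suc n) * g x))"
    proof (rule integral_mono)
      show "integrable lborel (\<lambda>x. norm (g x * (cis (- 2 * pi * (x \<bullet> \<xi>)) - P x)))"
        unfolding right_diff_distrib by (intro integrable_norm Bochner_Integration.integrable_diff ic iP)
      show "integrable lborel (\<lambda>x. ((2 * pi) ^ Suc n * norm \<xi> ^ Suc n) * norm (of_real (norm x ^ Suc n) * g x))"
        by (intro integrable_mult_right integrable_norm ig continuous_intros)
      fix x
      \<comment> \<open>Taylor's remainder estimate for the exponential on the imaginary axis;
        Cauchy-Schwarz then separates the powers of |x| and |\<xi>|.\<close>
      have "norm (cis (- 2 * pi * (x \<bullet> \<xi>)) - P x) \<le> \<bar>- 2 * pi * (x \<bullet> \<xi>)\<bar> ^ Suc n / fact (Suc n)"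
        using iexp_approx1[of "- 2 * pi * (x \<bullet> \<xi>)" n] by (simp only: P_def cis_conv_exp)
      also have "\<dots> \<le> \<bar>- 2 * pi * (x \<bullet> \<xi>)\<bar> ^ Suc n / 1"
        by (intro divide_left_mono fact_ge_1) auto
      also have "\<dots> \<le> (2 * pi * (norm x * norm \<xi>)) ^ Suc n"
        using Cauchy_Schwarz_ineq2[of x \<xi>] by (simp only: div_by_1) (intro power_mono, auto simp: abs_mult)
      also have "\<dots> = (2 * pi) ^ Suc n * norm \<xi> ^ Suc n * norm x ^ Suc n" by (simp only: power_mult_distrib mult_ac)
      finally have "norm (g x) * norm (cis (- 2 * pi * (x \<bullet> \<xi>)) - P x) \<le> norm (g x) * ((2 * pi) ^ Suc n * norm \<xi> ^ Suc n * norm x ^ Suc n)"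
        by (intro mult_left_mono) auto
      then show "norm (g x * (cis (- 2 * pi * (x \<bullet> \<xi>)) - P x)) \<le> ((2 * pi) ^ Suc n * norm \<xi> ^ Suc n) * norm (of_real (norm x ^ Suc n) * g x)"
        by (simp only: norm_mult norm_of_real power_abs abs_norm_cancel mult_ac)
    qed
    also have "\<dots> = C * norm \<xi> ^ Suc n" by (simp only: integral_mult_right_zero C_def mult_ac)
    finally show ?thesis .
  qed
  then show ?thesis unfolding n g_def by blast
qed

section \<open>Derivatives of the symbol times a Fourier transform\<close>

text \<open>All 2^|l| ways of distributing the directions in \<open>l\<close> over two factors.
  Equal directions count separately, so binomial coefficients arise as multiplicities and the
  Leibniz rule needs no coefficients.\<close>

primrec splits :: "'a list \<Rightarrow> ('a list \<times> 'a list) list" where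
  "splits [] = [([], [])]"
| "splits (v # l) = concat (map (\<lambda>(b, c). [(v # b, c), (b, v # c)]) (splits l))"

lemma splits_length: "(b, c) \<in> set (splits l) \<Longrightarrow> length b + length c = length l"
  by (induction l arbitrary: b c) auto

lemma splits_subset: "(b, c) \<in> set (splits l) \<Longrightarrow> set b \<subseteq> set l \<and> set c \<subseteq> set l"
proof (induction l arbitrary: b c)
  case (Cons v l)
  then show ?case by (auto; blast)
qed simp

lemma sum_list_splits_Cons:
  fixes g :: "'a list \<Rightarrow> 'a list \<Rightarrow> complex"
  shows "(\<Sum>(b, c)\<leftarrow>splits (v # l). g b c) = (\<Sum>(b, c)\<leftarrow>splits l. g (v # b) c + g b (v # c))"
proof -
  have "(\<Sum>(b, c)\<leftarrow>concat (map (\<lambda>(b, c). [(v # b, c), (b, v # c)]) ps). g b c) = (\<Sum>(b, c)\<leftarrow>ps. g (v # b) c + g b (v # c))" for ps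
    by (induction ps) auto
  then show ?thesis by simp
qed

text \<open>Exactly one split gives every direction to the first factor. In the converse implication
  this isolates the full-order derivative of the symbol.\<close>

lemma sum_list_splits_top:
  fixes g :: "'a list \<Rightarrow> 'a list \<Rightarrow> complex"
  assumes "\<And>b c. set b \<subseteq> set l \<Longrightarrow> length b < length l \<Longrightarrow> g b c = 0"
  shows "(\<Sum>(b, c)\<leftarrow>splits l. g b c) = g l []"
  using assms
proof (induction l arbitrary: g)
  case (Cons v l)
  have "(\<Sum>(b, c)\<leftarrow>splits (v # l). g b c) = (\<Sum>(b, c)\<leftarrow>splits l. g (v # b) c + g b (v # c))"
    by (rule sum_list_splits_Cons)
  also have "\<dots> = (\<Sum>(b, c)\<leftarrow>splits l. g (v # b) c)"
  proof (intro arg_cong[where f=sum_list] map_cong refl, clarify)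
    fix b c assume bc: "(b, c) \<in> set (splits l)"
    then have "g b (v # c) = 0" 
      using splits_length[OF bc] splits_subset[OF bc] by (intro Cons.prems) auto
    then show "g (v # b) c + g b (v # c) = g (v # b) c" by simp
  qed
  also have "\<dots> = g (v # l) []"
    by (rule Cons.IH[of "\<lambda>b c. g (v # b) c"]) (auto intro!: Cons.prems)
  finally show ?case .
qed simp

lemma has_vector_derivative_sum_list:
  "(\<And>p. p \<in> set ps \<Longrightarrow> (F p has_vector_derivative F' p) (at t)) \<Longrightarrow>
   ((\<lambda>t. \<Sum>p\<leftarrow>ps. F p t) has_vector_derivative (\<Sum>p\<leftarrow>ps. F' p)) (at t)"
  by (induction ps) (auto intro!: has_vector_derivative_add)

lemma norm_sum_list_bounds:
  fixes F :: "'p \<Rightarrow> 'z \<Rightarrow> complex"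
  assumes "\<And>p. p \<in> set ps \<Longrightarrow> \<exists>C. \<forall>z\<in>E. norm (F p z) \<le> C * w z"
  shows "\<exists>C. \<forall>z\<in>E. norm (\<Sum>p\<leftarrow>ps. F p z) \<le> C * w z"
  using assms
proof (induction ps)
  case Nil
  then show ?case by (intro exI[of _ 0]) auto
next
  case (Cons p ps)
  obtain C where C: "\<forall>z\<in>E. norm (\<Sum>p\<leftarrow>ps. F p z) \<le> C * w z" using Cons by auto
  obtain D where D: "\<forall>z\<in>E. norm (F p z) \<le> D * w z" using Cons.prems[of p] by auto
  have "norm (\<Sum>p\<leftarrow>p # ps. F p z) \<le> (D + C) * w z" if "z \<in> E" for z
    using norm_triangle_ineq[of "F p z" "\<Sum>p\<leftarrow>ps. F p z"] C[rule_format, OF that] D[rule_format, OF that]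
    by (simp add: algebra_simps)
  then show ?case by blast
qed

abbreviation off_axes :: "((real^'n) \<times> (real^'n)) set" where
  "off_axes \<equiv> {z. fst z \<noteq> 0 \<and> snd z \<noteq> 0}"

lemma open_off_axes: "open off_axes"
proof -
  have e: "off_axes = (- {0}) \<times> (- {0 :: real^'n})" by auto
  show "open (off_axes :: ((real^'n) \<times> (real^'n)) set)"
    unfolding e by (intro open_Times open_Compl closed_singleton)
qed

text \<open>The Leibniz expansion of the derivative along \<open>l\<close>, in the second variable, of
  \<open>\<sigma> (\<xi>, \<eta>) * fourier a \<eta>\<close>, where \<open>S b\<close> stands for the derivative of \<open>\<sigma>\<close> along \<open>b\<close>. The value
  \<open>0\<close> on the axes makes it continuously differentiable across \<open>\<eta> = 0\<close>.\<close>

definition leibniz where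
  "leibniz S a l z = (if z \<in> off_axes then
     (\<Sum>(b, c)\<leftarrow>splits l. S b z * fourier (\<lambda>x. fweight c x * a x) (snd z)) else 0)"

text \<open>Represents the symbol by its iterated derivatives in the second variable, indexed by
  lists. The size condition is multiplied out to avoid negative powers.\<close>

locale second_variable_symbol =
  fixes S :: "(real^'n) list \<Rightarrow> (real^'n) \<times> (real^'n) \<Rightarrow> complex"
  assumes S_cont: "set b \<subseteq> Basis \<Longrightarrow> continuous_on off_axes (S b)"
    and S_deriv: "set b \<subseteq> Basis \<Longrightarrow> v \<in> Basis \<Longrightarrow> \<xi> \<noteq> 0 \<Longrightarrow> \<eta> \<noteq> 0 \<Longrightarrow>
       ((\<lambda>t. S b (\<xi>, \<eta> + t *\<^sub>R v)) has_vector_derivative S (v # b) (\<xi>, \<eta>)) (at 0)"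
    and S_bound: "set b \<subseteq> Basis \<Longrightarrow> \<exists>C. \<forall>z\<in>off_axes. norm (S b z) * norm (snd z) ^ length b \<le> C"
begin

lemma test_fun_fweight_integrable: "test_fun a \<Longrightarrow> integrable lborel (\<lambda>x. fweight c x * a x)"
  by (intro test_fun_mult_integrable continuous_intros)

text \<open>Power counting: \<open>S b\<close> loses |b| powers of |\<eta>| and the transform gains
  N + 1 - |c|. This settles |\<eta>| \<le> 1 in the uniform bound; for larger \<eta> the symbol and
  the transform are bounded separately.\<close>

lemma leibniz_term_bounds:
  assumes a: "a \<in> O_N N" and l: "set b \<subseteq> Basis" "set c \<subseteq> Basis" "length b + length c \<le> N"
  shows "\<exists>C. \<forall>z\<in>off_axes. norm (S b z * fourier (\<lambda>x. fweight c x * a x) (snd z)) \<le> C * norm (snd z) ^ (Suc N - (length b + length c))"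
    and "\<exists>C. \<forall>z\<in>off_axes. norm (S b z * fourier (\<lambda>x. fweight c x * a x) (snd z)) \<le> C * 1"
proof -
  let ?A = "fourier (\<lambda>x. fweight c x * a x)"
  have f: "test_fun a" "vanishing_moments (Suc N) a" using a by (simp_all add: O_N_iff)
  obtain C where C: "\<And>z. z \<in> off_axes \<Longrightarrow> norm (S b z) * norm (snd z) ^ length b \<le> C" using S_bound[OF l(1)] by blast
  obtain D where D: "\<And>\<eta>. norm (?A \<eta>) \<le> D * norm \<eta> ^ (Suc N - length c)"
    using fourier_fweight_bound[OF f l(2)] l(3) by auto
  define B where "B = (LINT x|lborel. norm (fweight c x * a x))"
  have B: "norm (?A \<eta>) \<le> B" for \<eta> unfolding B_def by (rule fourier_bound[OF test_fun_fweight_integrable[OF f(1)]])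
  have e: "Suc N - length c = length b + (Suc N - (length b + length c))" using l(3) by simp
  have 1: "norm (S b z * ?A (snd z)) \<le> (C * D) * norm (snd z) ^ (Suc N - (length b + length c))" if z: "z \<in> off_axes" for z
  proof -
    have D0: "D \<ge> 0" using order_trans[OF norm_ge_zero D[of "axis i 1" for i]] by simp
    have "norm (S b z * ?A (snd z)) \<le> norm (S b z) * (D * norm (snd z) ^ (Suc N - length c))"
      unfolding norm_mult by (intro mult_left_mono D) auto
    also have "\<dots> = (norm (S b z) * norm (snd z) ^ length b) * (D * norm (snd z) ^ (Suc N - (length b + length c)))"
      unfolding e power_add by (simp only: mult_ac)
    also have "\<dots> \<le> C * (D * norm (snd z) ^ (Suc N - (length b + length c)))"
      using D0 by (intro mult_right_mono C z) auto
    finally show ?thesis by (simp only: mult_ac)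
  qed
  then show "\<exists>C. \<forall>z\<in>off_axes. norm (S b z * ?A (snd z)) \<le> C * norm (snd z) ^ (Suc N - (length b + length c))" by blast
  have "norm (S b z * ?A (snd z)) \<le> (\<bar>C * D\<bar> + \<bar>C * B\<bar>) * 1" if z: "z \<in> off_axes" for z
  proof (cases "norm (snd z) \<le> 1")
    case True
    then have "norm (snd z) ^ (Suc N - (length b + length c)) \<le> 1" by (intro power_le_one) auto
    then have "(C * D) * norm (snd z) ^ (Suc N - (length b + length c)) \<le> \<bar>C * D\<bar> * 1"
      by (intro mult_mono) auto
    from order_trans[OF 1[OF z] this] have "norm (S b z * ?A (snd z)) \<le> \<bar>C * D\<bar>" by (simp only: mult_1_right)
    then show ?thesis by (rule order_trans) simp
  next
    case False
    then have "1 \<le> norm (snd z) ^ length b" by (intro one_le_power) auto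
    then have "norm (S b z) \<le> norm (S b z) * norm (snd z) ^ length b"
      by (simp add: mult_le_cancel_left1)
    then have "norm (S b z) \<le> C" using C[OF z] by linarith
    then have "norm (S b z * ?A (snd z)) \<le> C * B"
      unfolding norm_mult using order_trans[OF norm_ge_zero B] by (intro mult_mono B) (auto intro: order_trans[OF norm_ge_zero])
    then show ?thesis by (rule order_trans) simp
  qed
  then show "\<exists>C. \<forall>z\<in>off_axes. norm (S b z * ?A (snd z)) \<le> C * 1" by blast
qed

lemma leibniz_bound_power:
  assumes a: "a \<in> O_N N" and l: "set l \<subseteq> Basis" "length l \<le> N"
  shows "\<exists>C. \<forall>z. norm (leibniz S a l z) \<le> C * norm (snd z) ^ (Suc N - length l)"
proof -
  have "\<exists>C. \<forall>z\<in>off_axes. norm (\<Sum>p\<leftarrow>splits l. S (fst p) z * fourier (\<lambda>x. fweight (snd p) x * a x) (snd z)) \<le> C * norm (snd z) ^ (Suc N - length l)"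
  proof (rule norm_sum_list_bounds)
    fix p assume "p \<in> set (splits l)"
    then have p: "(fst p, snd p) \<in> set (splits l)" by simp
    show "\<exists>C. \<forall>z\<in>off_axes. norm (S (fst p) z * fourier (\<lambda>x. fweight (snd p) x * a x) (snd z)) \<le> C * norm (snd z) ^ (Suc N - length l)"
      using leibniz_term_bounds(1)[OF a, of "fst p" "snd p"] splits_length[OF p] splits_subset[OF p] l by auto
  qed
  then obtain C where C: "\<forall>z\<in>off_axes. norm (\<Sum>p\<leftarrow>splits l. S (fst p) z * fourier (\<lambda>x. fweight (snd p) x * a x) (snd z)) \<le> C * norm (snd z) ^ (Suc N - length l)" by blast
  have "norm (leibniz S a l z) \<le> \<bar>C\<bar> * norm (snd z) ^ (Suc N - length l)" for z
  proof (cases "z \<in> off_axes")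
    case True
    then have e: "leibniz S a l z = (\<Sum>p\<leftarrow>splits l. S (fst p) z * fourier (\<lambda>x. fweight (snd p) x * a x) (snd z))"
      by (simp add: leibniz_def split_def)
    have "norm (leibniz S a l z) \<le> C * norm (snd z) ^ (Suc N - length l)"
      unfolding e by (rule C[rule_format, OF True])
    also have "\<dots> \<le> \<bar>C\<bar> * norm (snd z) ^ (Suc N - length l)" by (intro mult_right_mono) auto
    finally show ?thesis .
  next
    case False
    then have "leibniz S a l z = 0" unfolding leibniz_def by (rule if_not_P)
    then show ?thesis by simp
  qed
  then show ?thesis by blast
qed

lemma leibniz_bounded:
  assumes a: "a \<in> O_N N" and l: "set l \<subseteq> Basis" "length l \<le> N"
  shows "\<exists>C. \<forall>z. norm (leibniz S a l z) \<le> C"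
proof -
  have "\<exists>C. \<forall>z\<in>off_axes. norm (\<Sum>p\<leftarrow>splits l. S (fst p) z * fourier (\<lambda>x. fweight (snd p) x * a x) (snd z)) \<le> C * 1"
  proof (rule norm_sum_list_bounds)
    fix p assume "p \<in> set (splits l)"
    then have p: "(fst p, snd p) \<in> set (splits l)" by simp
    show "\<exists>C. \<forall>z\<in>off_axes. norm (S (fst p) z * fourier (\<lambda>x. fweight (snd p) x * a x) (snd z)) \<le> C * 1"
      using splits_length[OF p] splits_subset[OF p] l by (intro leibniz_term_bounds(2)[OF a]) auto
  qed
  then obtain C where C: "\<forall>z\<in>off_axes. norm (\<Sum>p\<leftarrow>splits l. S (fst p) z * fourier (\<lambda>x. fweight (snd p) x * a x) (snd z)) \<le> C * 1" by blast
  have "norm (leibniz S a l z) \<le> \<bar>C\<bar>" for z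
  proof (cases "z \<in> off_axes")
    case True
    then have e: "leibniz S a l z = (\<Sum>p\<leftarrow>splits l. S (fst p) z * fourier (\<lambda>x. fweight (snd p) x * a x) (snd z))"
      by (simp add: leibniz_def split_def)
    have "norm (leibniz S a l z) \<le> C * 1"
      unfolding e by (rule C[rule_format, OF True])
    then show ?thesis by linarith
  next
    case False
    then have "leibniz S a l z = 0" unfolding leibniz_def by (rule if_not_P)
    then show ?thesis by simp
  qed
  then show ?thesis by blast
qed

lemma continuous_on_leibniz:
  assumes a: "test_fun a" and l: "set l \<subseteq> Basis"
  shows "continuous_on off_axes (leibniz S a l)"
proof -
  have A: "continuous_on off_axes (\<lambda>z. fourier (\<lambda>x. fweight c x * a x) (snd z))" for c
    by (rule continuous_on_compose2[of UNIV "fourier (\<lambda>x. fweight c x * a x)"])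
      (auto intro!: continuous_at_imp_continuous_on fourier_continuous test_fun_fweight_integrable[OF a] continuous_intros)
  have "continuous_on off_axes (\<lambda>z. \<Sum>p\<leftarrow>ps. S (fst p) z * fourier (\<lambda>x. fweight (snd p) x * a x) (snd z))"
    if "\<And>p. p \<in> set ps \<Longrightarrow> set (fst p) \<subseteq> Basis" for ps
    using that by (induction ps) (auto intro!: continuous_intros S_cont A)
  moreover have "set (fst p) \<subseteq> Basis" if "p \<in> set (splits l)" for p
    using splits_subset[of "fst p" "snd p" l] that l by auto
  ultimately have "continuous_on off_axes (\<lambda>z. \<Sum>p\<leftarrow>splits l. S (fst p) z * fourier (\<lambda>x. fweight (snd p) x * a x) (snd z))"
    by blast
  then show ?thesis
    by (rule continuous_on_eq) (simp add: leibniz_def split_def)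
qed

lemma measurable_leibniz:
  assumes a: "test_fun a" and l: "set l \<subseteq> Basis"
  shows "leibniz S a l \<in> borel_measurable borel"
proof -
  have "(\<lambda>z. indicator off_axes z *\<^sub>R leibniz S a l z) \<in> borel_measurable borel"
    by (intro borel_measurable_continuous_on_indicator continuous_on_leibniz a l borel_open open_off_axes)
  also have "(\<lambda>z. indicator off_axes z *\<^sub>R leibniz S a l z) = leibniz S a l"
    by (rule ext) (simp add: indicator_def leibniz_def)
  finally show ?thesis .
qed

text \<open>Off the axes this is the product rule. For fixed \<xi> \<noteq> 0 the function vanishes
  at \<eta> = 0 to order N + 1 - |l|, which is at least 2 since |l| < N, so its derivative there is
  0 and agrees with the default value.\<close>

lemma leibniz_deriv:
  assumes a: "a \<in> O_N N" and l: "set l \<subseteq> Basis" "length l < N" and v: "v \<in> Basis"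
  shows "((\<lambda>t. leibniz S a l (\<xi>, \<eta> + t *\<^sub>R v)) has_vector_derivative leibniz S a (v # l) (\<xi>, \<eta>)) (at 0)"
proof -
  have f: "test_fun a" using a by (simp add: O_N_iff)
  consider "\<xi> = 0" | "\<xi> \<noteq> 0" "\<eta> = 0" | "\<xi> \<noteq> 0" "\<eta> \<noteq> 0" by blast
  then show ?thesis
  proof cases
    case 1
    then show ?thesis by (simp add: leibniz_def)
  next
    case 2
    obtain C where C: "\<And>z. norm (leibniz S a l z) \<le> C * norm (snd z) ^ (Suc N - length l)"
      using leibniz_bound_power[OF a l(1)] l(2) by (metis less_imp_le)
    have z: "leibniz S a k (\<xi>, 0) = 0" for k by (simp add: leibniz_def)
    have "((\<lambda>h. (1/h) *\<^sub>R (leibniz S a l (\<xi>, \<eta> + (0 + h) *\<^sub>R v) - leibniz S a l (\<xi>, \<eta> + 0 *\<^sub>R v))) \<longlongrightarrow> 0) (at 0)"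
    proof (rule Lim_null_comparison)
      \<comment> \<open>The quotient uses up one power of |h|; the remaining exponent is positive
        because |l| < N.\<close>
      have "norm ((1/h) *\<^sub>R (leibniz S a l (\<xi>, \<eta> + (0 + h) *\<^sub>R v) - leibniz S a l (\<xi>, \<eta> + 0 *\<^sub>R v))) \<le> C * \<bar>h\<bar> ^ (N - length l)"
        if "h \<noteq> 0" for h
      proof -
        have "norm (leibniz S a l (\<xi>, h *\<^sub>R v)) \<le> (C * \<bar>h\<bar> ^ (N - length l)) * \<bar>h\<bar>"
          using C[of "(\<xi>, h *\<^sub>R v)"] v l(2) by (simp add: Suc_diff_le mult_ac)
        then show ?thesis using that 2 z by (simp add: divide_le_eq)
      qed
      then show "\<forall>\<^sub>F h in at 0. norm ((1/h) *\<^sub>R (leibniz S a l (\<xi>, \<eta> + (0 + h) *\<^sub>R v) - leibniz S a l (\<xi>, \<eta> + 0 *\<^sub>R v))) \<le> C * \<bar>h\<bar> ^ (N - length l)"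
        by (auto simp: eventually_at_filter)
      have "((\<lambda>h. C * \<bar>h\<bar> ^ (N - length l)) \<longlongrightarrow> C * \<bar>0\<bar> ^ (N - length l)) (at (0::real))"
        by (intro tendsto_intros)
      then show "((\<lambda>h. C * \<bar>h\<bar> ^ (N - length l)) \<longlongrightarrow> 0) (at (0::real))"
        using l(2) by (simp add: power_0_left)
    qed
    then show ?thesis unfolding has_vector_derivative_iff_quotient using 2 z by simp
  next
    case 3
    define F where "F p t = S (fst p) (\<xi>, \<eta> + t *\<^sub>R v) * fourier (\<lambda>x. fweight (snd p) x * a x) (\<eta> + t *\<^sub>R v)" for p t
    define F' where "F' p = S (v # fst p) (\<xi>, \<eta>) * fourier (\<lambda>x. fweight (snd p) x * a x) \<eta>
         + S (fst p) (\<xi>, \<eta>) * fourier (\<lambda>x. fweight (v # snd p) x * a x) \<eta>" for p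
    have d: "((\<lambda>t. \<Sum>p\<leftarrow>splits l. F p t) has_vector_derivative (\<Sum>p\<leftarrow>splits l. F' p)) (at 0)"
    proof (rule has_vector_derivative_sum_list)
      fix p assume "p \<in> set (splits l)"
      then have p: "set (fst p) \<subseteq> Basis" using splits_subset[of "fst p" "snd p" l] l by auto
      have i: "integrable lborel (\<lambda>x. of_real (x \<bullet> v) * (fweight (snd p) x * a x))"
        unfolding mult.assoc[symmetric] by (intro test_fun_mult_integrable[OF f] continuous_intros)
      have "((\<lambda>t. fourier (\<lambda>x. fweight (snd p) x * a x) (\<eta> + t *\<^sub>R v)) has_vector_derivative
          fourier (\<lambda>x. fweight (v # snd p) x * a x) \<eta>) (at 0)"
        using fourier_has_vector_derivative[OF test_fun_fweight_integrable[OF f] i, of \<eta> 0]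
        by (simp add: mult.assoc)
      from has_vector_derivative_mult[OF S_deriv[OF p v 3] this]
      show "(F p has_vector_derivative F' p) (at 0)"
        by (simp add: F_def[abs_def] F'_def add.commute)
    qed
    have r: "leibniz S a (v # l) (\<xi>, \<eta>) = (\<Sum>p\<leftarrow>splits l. F' p)"
      unfolding leibniz_def sum_list_splits_Cons using 3 by (simp add: F'_def split_def)
    have o: "open {t. \<eta> + t *\<^sub>R v \<noteq> 0}"
      by (intro open_Collect_neq continuous_intros)
    have eq: "(\<Sum>p\<leftarrow>splits l. F p t) = leibniz S a l (\<xi>, \<eta> + t *\<^sub>R v)" if "t \<in> {t. \<eta> + t *\<^sub>R v \<noteq> 0}" for t
      using that 3 by (simp add: leibniz_def F_def split_def)
    have z: "0 \<in> {t. \<eta> + t *\<^sub>R v \<noteq> 0}" using 3 by simp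
    show ?thesis
      unfolding r by (rule has_vector_derivative_transform_within_open[OF d o z eq])
  qed
qed

lemma isCont_leibniz_snd:
  assumes a: "a \<in> O_N N"
  shows "isCont (\<lambda>\<eta>. leibniz S a [] (\<xi>, \<eta>)) \<eta>"
proof -
  have f: "test_fun a" using a by (simp add: O_N_iff)
  consider "\<xi> = 0" | "\<xi> \<noteq> 0" "\<eta> = 0" | "\<xi> \<noteq> 0" "\<eta> \<noteq> 0" by blast
  then show ?thesis
  proof cases
    case 1
    then show ?thesis by (simp add: leibniz_def)
  next
    case 2
    obtain C where C: "\<And>z. norm (leibniz S a [] z) \<le> C * norm (snd z) ^ Suc N"
    proof -
      have "\<exists>C. \<forall>z. norm (leibniz S a [] z) \<le> C * norm (snd z) ^ (Suc N - length ([] :: (real^'n) list))"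
        by (rule leibniz_bound_power[OF a]) auto
      then show ?thesis using that unfolding list.size diff_zero by blast
    qed
    have "((\<lambda>\<eta>. leibniz S a [] (\<xi>, \<eta>)) \<longlongrightarrow> 0) (at 0)"
    proof (rule Lim_null_comparison)
      show "\<forall>\<^sub>F \<eta> in at 0. norm (leibniz S a [] (\<xi>, \<eta>)) \<le> C * norm \<eta> ^ Suc N"
        using C[of "(\<xi>, _)"] by (intro always_eventually) auto
      have "((\<lambda>\<eta>::real^'n. C * norm \<eta> ^ Suc N) \<longlongrightarrow> C * norm (0::real^'n) ^ Suc N) (at 0)"
        by (intro tendsto_intros)
      then show "((\<lambda>\<eta>::real^'n. C * norm \<eta> ^ Suc N) \<longlongrightarrow> 0) (at 0)" by simp
    qed
    then show ?thesis using 2 by (simp add: isCont_def leibniz_def[of S a "[]" "(\<xi>, 0)"])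
  next
    case 3
    have "isCont (leibniz S a []) (\<xi>, \<eta>)"
      using continuous_on_leibniz[OF f, of "[]"] 3 by (simp add: continuous_on_eq_continuous_at[OF open_off_axes])
    then show ?thesis by (intro isCont_o2[of \<eta> "\<lambda>\<eta>. (\<xi>, \<eta>)" "leibniz S a []"] continuous_intros)
  qed
qed

end

section \<open>Moments of the bilinear operator\<close>

text \<open>Integrable majorants for the double integral before and after the shear (\<xi>, \<eta>)
  \<mapsto> (\<xi>, \<xi> + \<eta>).\<close>

lemma integrable_convolution_product:
  fixes f g :: "'a::euclidean_space \<Rightarrow> complex"
  assumes f: "integrable lborel f" and g: "integrable lborel g"
  shows "integrable (lborel \<Otimes>\<^sub>M lborel) (\<lambda>p. f (fst p) * g (snd p))"
    and "integrable (lborel \<Otimes>\<^sub>M lborel) (\<lambda>p. f (fst p) * g (snd p - fst p))"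
proof -
  have [measurable]: "f \<in> borel_measurable borel" "g \<in> borel_measurable borel" using f g by auto
  show "integrable (lborel \<Otimes>\<^sub>M lborel) (\<lambda>p. f (fst p) * g (snd p))"
    by (rule lborel_pair.Fubini_integrable) (use f g in \<open>auto simp: norm_mult\<close>)
  have t: "integrable lborel (\<lambda>y. g (y - x))" for x
    using integrable_lborel_translate[OF g, of "- x"] by (simp add: add.commute)
  have "(LINT y|lborel. norm (g (y - x))) = (LINT y|lborel. norm (g y))" for x
    using integral_lborel_translate[of "\<lambda>y. norm (g y)" "- x"] by (simp add: add.commute)
  then show "integrable (lborel \<Otimes>\<^sub>M lborel) (\<lambda>p. f (fst p) * g (snd p - fst p))"
    by (intro lborel_pair.Fubini_integrable) (use f t in \<open>auto simp: norm_mult\<close>)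
qed

lemma integral_lborel_reflect:
  fixes f :: "'a::euclidean_space \<Rightarrow> 'b::{banach,second_countable_topology}"
  assumes [measurable]: "f \<in> borel_measurable borel"
  shows "(LINT x|lborel. f (- x)) = (LINT x|lborel. f x)"
  using integral_lborel_affine[of f "-1" 0] by simp

context second_variable_symbol
begin

text \<open>For a nonempty list this is the candidate for the derivative along \<open>l\<close> of
  the function with empty list; at \<zeta> = 0 it samples the symbol on the antidiagonal \<eta> =
  -\<xi>.\<close>

definition G where
  "G a1 a2 l \<zeta> = (LINT \<xi>|lborel. fourier a1 \<xi> * leibniz S a2 l (\<xi>, \<zeta> - \<xi>))"

lemma measurable_leibniz_shear:
  assumes a: "test_fun a" and l: "set l \<subseteq> Basis"
  shows "(\<lambda>p. leibniz S a l (fst p, snd p - fst p)) \<in> borel_measurable (lborel \<Otimes>\<^sub>M lborel)"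
  by (rule measurable_compose[OF _ measurable_leibniz[OF a l]]) measurable

lemma measurable_leibniz_section:
  assumes a: "test_fun a" and l: "set l \<subseteq> Basis"
  shows "(\<lambda>\<xi>. leibniz S a l (\<xi>, \<zeta> - \<xi>)) \<in> borel_measurable borel"
  by (rule measurable_compose[OF _ measurable_leibniz[OF a l]]) measurable

lemma G_integrand_integrable:
  assumes a1: "test_fun a1" and a2: "a2 \<in> O_N N" and l: "set l \<subseteq> Basis" "length l \<le> N"
  shows "integrable lborel (\<lambda>\<xi>. fourier a1 \<xi> * leibniz S a2 l (\<xi>, \<zeta> - \<xi>))"
proof -
  have f: "test_fun a2" using a2 by (simp add: O_N_iff)
  obtain C where C: "\<And>z. norm (leibniz S a2 l z) \<le> C" using leibniz_bounded[OF a2 l] by blast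
  show ?thesis
  proof (rule Bochner_Integration.integrable_bound)
    show "integrable lborel (\<lambda>\<xi>. fourier a1 \<xi> * of_real C)"
      by (intro integrable_mult_left integrable_fourier_test_fun a1)
    have [measurable]: "(\<lambda>\<xi>. leibniz S a2 l (\<xi>, \<zeta> - \<xi>)) \<in> borel_measurable borel" "a1 \<in> borel_measurable borel"
      using measurable_leibniz_section[OF f l(1)] test_fun_measurable[OF a1] by auto
    show "(\<lambda>\<xi>. fourier a1 \<xi> * leibniz S a2 l (\<xi>, \<zeta> - \<xi>)) \<in> borel_measurable lborel" by measurable
    show "AE \<xi> in lborel. norm (fourier a1 \<xi> * leibniz S a2 l (\<xi>, \<zeta> - \<xi>)) \<le> norm (fourier a1 \<xi> * of_real C)"
      using C by (auto simp: norm_mult intro!: AE_I2 mult_left_mono intro: order_trans[OF _ abs_ge_self])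
  qed
qed

text \<open>Differentiation under the integral: \<open>leibniz\<close> stays bounded up to order
  \<open>N\<close>, so a constant multiple of |\<open>fourier a1\<close>| dominates the derivative
  uniformly in \<zeta>.\<close>

lemma G_deriv:
  assumes a1: "test_fun a1" and a2: "a2 \<in> O_N N" and l: "set l \<subseteq> Basis" "length l < N" and v: "v \<in> Basis"
  shows "((\<lambda>t. G a1 a2 l (\<zeta> + t *\<^sub>R v)) has_vector_derivative G a1 a2 (v # l) (\<zeta> + 0 *\<^sub>R v)) (at 0)"
proof -
  have vl: "set (v # l) \<subseteq> Basis" "length (v # l) \<le> N" using l v by auto
  obtain C where C: "\<And>z. norm (leibniz S a2 (v # l) z) \<le> C" using leibniz_bounded[OF a2 vl] by blast
  show ?thesis unfolding G_def
  proof (rule has_vector_derivative_integral[where g="\<lambda>\<xi>. norm (fourier a1 \<xi>) * C"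
        and f'="\<lambda>t \<xi>. fourier a1 \<xi> * leibniz S a2 (v # l) (\<xi>, \<zeta> + t *\<^sub>R v - \<xi>)"])
    show "integrable lborel (\<lambda>\<xi>. fourier a1 \<xi> * leibniz S a2 l (\<xi>, \<zeta> + t *\<^sub>R v - \<xi>))" for t
      using l by (intro G_integrand_integrable[OF a1 a2]) auto
    show "((\<lambda>s. fourier a1 \<xi> * leibniz S a2 l (\<xi>, \<zeta> + s *\<^sub>R v - \<xi>)) has_vector_derivative
        fourier a1 \<xi> * leibniz S a2 (v # l) (\<xi>, \<zeta> + t *\<^sub>R v - \<xi>)) (at t)" for t \<xi>
    proof -
      have "((\<lambda>s. leibniz S a2 l (\<xi>, (\<zeta> - \<xi>) + s *\<^sub>R v)) has_vector_derivative leibniz S a2 (v # l) (\<xi>, \<zeta> - \<xi> + t *\<^sub>R v)) (at t)"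
        by (rule has_vector_derivative_line_iff[where f="\<lambda>\<eta>. leibniz S a2 l (\<xi>, \<eta>)", THEN iffD2])
          (rule leibniz_deriv[OF a2 l v])
      from has_vector_derivative_mult_right[OF this, of "fourier a1 \<xi>"]
      show ?thesis by (simp add: algebra_simps)
    qed
    show "norm (fourier a1 \<xi> * leibniz S a2 (v # l) (\<xi>, \<zeta> + t *\<^sub>R v - \<xi>)) \<le> norm (fourier a1 \<xi>) * C" for t \<xi>
      unfolding norm_mult by (intro mult_left_mono C) auto
    show "integrable lborel (\<lambda>\<xi>. norm (fourier a1 \<xi>) * C)"
      by (intro integrable_mult_left integrable_norm integrable_fourier_test_fun a1)
    show "(\<lambda>\<xi>. fourier a1 \<xi> * leibniz S a2 (v # l) (\<xi>, \<zeta> + 0 *\<^sub>R v - \<xi>)) \<in> borel_measurable lborel"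
      using G_integrand_integrable[OF a1 a2 vl, of "\<zeta> + 0 *\<^sub>R v"] by auto
  qed
qed

text \<open>A bound on \<open>leibniz\<close> alone would not make the double integral absolutely
  convergent; the majorant \<open>hb\<close> keeps the integrable factor \<open>fourier a2\<close>.
  The translation \<eta> = \<zeta> - \<xi> of the inner integral then sits between two uses of
  Fubini.\<close>

lemma
  assumes a1: "test_fun a1" and a2: "a2 \<in> O_N N"
  shows integrable_G: "integrable lborel (G a1 a2 [])"
    and bilinear_eq_fourier_G: "(LINT z|lborel. cis (2 * pi * (x \<bullet> (fst z + snd z))) * (fourier a1 (fst z) * leibniz S a2 [] z))
       = fourier (G a1 a2 []) (- x)"
proof -
  have f: "test_fun a2" using a2 by (simp add: O_N_iff)
  define A1 where "A1 = fourier a1"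
  define A2 where "A2 = fourier a2"
  define h where "h = leibniz S a2 []"
  have i: "integrable lborel A1" "integrable lborel A2"
    unfolding A1_def A2_def using integrable_fourier_test_fun a1 f by auto
  have [measurable]: "A1 \<in> borel_measurable borel" "h \<in> borel_measurable borel"
    using i measurable_leibniz[OF f, of "[]"] by (auto simp: h_def)
  obtain C where C: "\<And>z. z \<in> off_axes \<Longrightarrow> norm (S [] z) \<le> C"
  proof -
    have "\<exists>C. \<forall>z\<in>off_axes. norm (S [] z) * norm (snd z) ^ length ([] :: (real^'n) list) \<le> C" by (rule S_bound) simp
    then show ?thesis using that unfolding list.size power_0 mult_1_right by blast
  qed
  have hb: "norm (h z) \<le> norm (of_real C * A2 (snd z))" for z
  proof (cases "z \<in> off_axes")
    case True
    then have "norm (h z) \<le> C * norm (A2 (snd z))"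
      using C[OF True] by (simp add: h_def leibniz_def A2_def norm_mult mult_right_mono)
    also have "\<dots> \<le> \<bar>C\<bar> * norm (A2 (snd z))" by (intro mult_right_mono) auto
    finally show ?thesis by (simp add: norm_mult)
  next
    case False
    then have "h z = 0" unfolding h_def leibniz_def by (rule if_not_P)
    then show ?thesis by simp
  qed
  have i1: "integrable (lborel \<Otimes>\<^sub>M lborel) (\<lambda>p. cis (2 * pi * (x \<bullet> (fst p + snd p))) * (A1 (fst p) * h p))" for x
  proof (rule Bochner_Integration.integrable_bound[OF integrable_convolution_product(1)[OF i(1) integrable_mult_right[OF i(2), of "of_real C"]]])
    show "AE p in lborel \<Otimes>\<^sub>M lborel. norm (cis (2 * pi * (x \<bullet> (fst p + snd p))) * (A1 (fst p) * h p)) \<le> norm (A1 (fst p) * (of_real C * A2 (snd p)))"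
      using hb by (auto simp: norm_mult intro!: AE_I2 mult_left_mono)
    have "h \<in> borel_measurable (lborel \<Otimes>\<^sub>M lborel)" by (simp add: lborel_prod)
    then show "(\<lambda>p. cis (2 * pi * (x \<bullet> (fst p + snd p))) * (A1 (fst p) * h p)) \<in> borel_measurable (lborel \<Otimes>\<^sub>M lborel)"
      by measurable
  qed
  have i2: "integrable (lborel \<Otimes>\<^sub>M lborel) (\<lambda>p. cis (2 * pi * (x \<bullet> snd p)) * (A1 (fst p) * h (fst p, snd p - fst p)))" for x
  proof (rule Bochner_Integration.integrable_bound[OF integrable_convolution_product(2)[OF i(1) integrable_mult_right[OF i(2), of "of_real C"]]])
    show "AE p in lborel \<Otimes>\<^sub>M lborel. norm (cis (2 * pi * (x \<bullet> snd p)) * (A1 (fst p) * h (fst p, snd p - fst p))) \<le> norm (A1 (fst p) * (of_real C * A2 (snd p - fst p)))"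
      using hb[of "(fst _, snd _ - fst _)"] by (auto simp: norm_mult intro!: AE_I2 mult_left_mono)
    have "(\<lambda>p. h (fst p, snd p - fst p)) \<in> borel_measurable (lborel \<Otimes>\<^sub>M lborel)"
      unfolding h_def by (rule measurable_leibniz_shear[OF f]) simp
    then show "(\<lambda>p. cis (2 * pi * (x \<bullet> snd p)) * (A1 (fst p) * h (fst p, snd p - fst p))) \<in> borel_measurable (lborel \<Otimes>\<^sub>M lborel)"
      by measurable
  qed
  have G: "G a1 a2 [] \<zeta> = (LINT \<xi>|lborel. A1 \<xi> * h (\<xi>, \<zeta> - \<xi>))" for \<zeta>
    by (simp add: G_def A1_def h_def)
  show "integrable lborel (G a1 a2 [])"
    using lborel_pair.integrable_snd[of "\<lambda>\<xi> \<zeta>. A1 \<xi> * h (\<xi>, \<zeta> - \<xi>)"] i2[of 0]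
    by (simp add: G[abs_def] split_def)
  have "(LINT z|lborel. cis (2 * pi * (x \<bullet> (fst z + snd z))) * (A1 (fst z) * h z))
     = (LINT \<xi>|lborel. LINT \<eta>|lborel. cis (2 * pi * (x \<bullet> (\<xi> + \<eta>))) * (A1 \<xi> * h (\<xi>, \<eta>)))"
    using lborel_pair.integral_fst'[OF i1[of x]] by (simp add: lborel_prod)
  also have "\<dots> = (LINT \<xi>|lborel. LINT \<zeta>|lborel. cis (2 * pi * (x \<bullet> \<zeta>)) * (A1 \<xi> * h (\<xi>, \<zeta> - \<xi>)))"
  proof (rule Bochner_Integration.integral_cong)
    fix \<xi> :: "real^'n"
    have "(LINT \<zeta>|lborel. cis (2 * pi * (x \<bullet> (\<xi> + (- \<xi> + \<zeta>)))) * (A1 \<xi> * h (\<xi>, - \<xi> + \<zeta>)))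
       = (LINT \<eta>|lborel. cis (2 * pi * (x \<bullet> (\<xi> + \<eta>))) * (A1 \<xi> * h (\<xi>, \<eta>)))"
      by (rule integral_lborel_translate[of "\<lambda>\<eta>. cis (2 * pi * (x \<bullet> (\<xi> + \<eta>))) * (A1 \<xi> * h (\<xi>, \<eta>))"]) measurable
    then show "(LINT \<eta>|lborel. cis (2 * pi * (x \<bullet> (\<xi> + \<eta>))) * (A1 \<xi> * h (\<xi>, \<eta>)))
       = (LINT \<zeta>|lborel. cis (2 * pi * (x \<bullet> \<zeta>)) * (A1 \<xi> * h (\<xi>, \<zeta> - \<xi>)))"
      by simp
  qed simp
  also have "\<dots> = (LINT \<zeta>|lborel. LINT \<xi>|lborel. cis (2 * pi * (x \<bullet> \<zeta>)) * (A1 \<xi> * h (\<xi>, \<zeta> - \<xi>)))"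
    using i2[of x] by (intro lborel_pair.Fubini_integral[symmetric]) (simp add: split_def)
  also have "\<dots> = fourier (G a1 a2 []) (- x)"
    unfolding fourier_def G by (intro Bochner_Integration.integral_cong refl) (simp add: inner_commute mult.commute)
  finally show "(LINT z|lborel. cis (2 * pi * (x \<bullet> (fst z + snd z))) * (fourier a1 (fst z) * leibniz S a2 [] z))
       = fourier (G a1 a2 []) (- x)"
    unfolding A1_def h_def .
qed

lemma G_bounded:
  assumes a1: "test_fun a1" and a2: "a2 \<in> O_N N"
  shows "\<exists>B. \<forall>\<zeta>. norm (G a1 a2 [] \<zeta>) \<le> B"
proof -
  obtain C where C: "\<And>z. norm (leibniz S a2 [] z) \<le> C" using leibniz_bounded[OF a2, of "[]"] by auto
  have "norm (G a1 a2 [] \<zeta>) \<le> (LINT \<xi>|lborel. norm (fourier a1 \<xi>) * C)" for \<zeta>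
    unfolding G_def
  proof (rule order_trans[OF integral_norm_bound], rule integral_mono)
    show "integrable lborel (\<lambda>\<xi>. norm (fourier a1 \<xi> * leibniz S a2 [] (\<xi>, \<zeta> - \<xi>)))"
      by (intro integrable_norm G_integrand_integrable[OF a1 a2]) auto
    show "integrable lborel (\<lambda>\<xi>. norm (fourier a1 \<xi>) * C)"
      by (intro integrable_mult_left integrable_norm integrable_fourier_test_fun a1)
    show "norm (fourier a1 \<xi> * leibniz S a2 [] (\<xi>, \<zeta> - \<xi>)) \<le> norm (fourier a1 \<xi>) * C" for \<xi>
      unfolding norm_mult by (intro mult_left_mono C) auto
  qed
  then show ?thesis by blast
qed

lemma isCont_G:
  assumes a1: "test_fun a1" and a2: "a2 \<in> O_N N"
  shows "isCont (G a1 a2 []) \<zeta>"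
  unfolding continuous_at_sequentially comp_def G_def
proof (intro allI impI)
  fix X :: "nat \<Rightarrow> real^'n" assume X: "X \<longlonglongrightarrow> \<zeta>"
  obtain C where C: "\<And>z. norm (leibniz S a2 [] z) \<le> C" using leibniz_bounded[OF a2, of "[]"] by auto
  have i: "integrable lborel (\<lambda>\<xi>. fourier a1 \<xi> * leibniz S a2 [] (\<xi>, \<zeta> - \<xi>))" for \<zeta>
    by (intro G_integrand_integrable[OF a1 a2]) auto
  show "(\<lambda>n. LINT \<xi>|lborel. fourier a1 \<xi> * leibniz S a2 [] (\<xi>, X n - \<xi>)) \<longlonglongrightarrow> (LINT \<xi>|lborel. fourier a1 \<xi> * leibniz S a2 [] (\<xi>, \<zeta> - \<xi>))"
  proof (rule integral_dominated_convergence[where w="\<lambda>\<xi>. norm (fourier a1 \<xi>) * C"])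
    show "AE \<xi> in lborel. (\<lambda>n. fourier a1 \<xi> * leibniz S a2 [] (\<xi>, X n - \<xi>)) \<longlonglongrightarrow> fourier a1 \<xi> * leibniz S a2 [] (\<xi>, \<zeta> - \<xi>)"
      by (intro AE_I2 tendsto_intros X isCont_tendsto_compose[OF isCont_leibniz_snd[OF a2]])
    show "integrable lborel (\<lambda>\<xi>. norm (fourier a1 \<xi>) * C)"
      by (intro integrable_mult_left integrable_norm integrable_fourier_test_fun a1)
    show "AE \<xi> in lborel. norm (fourier a1 \<xi> * leibniz S a2 [] (\<xi>, X n - \<xi>)) \<le> norm (fourier a1 \<xi>) * C" for n
      unfolding norm_mult by (intro AE_I2 mult_left_mono C) auto
  qed (use i in auto)
qed

lemma moments_eq:
  fixes T :: "real^'n \<Rightarrow> complex"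
  assumes a1: "test_fun a1" and a2: "a2 \<in> O_N N"
    and T: "\<And>x. T x = (LINT z|lborel. cis (2 * pi * (x \<bullet> (fst z + snd z))) * (fourier a1 (fst z) * leibniz S a2 [] z))"
    and decay: "\<And>x. norm x \<ge> R \<Longrightarrow> norm (T x) \<le> C * norm x powr (- real (2 * CARD('n) + N + 1))"
    and l: "set l \<subseteq> Basis" "length l \<le> N"
  shows "(LINT x|lborel. fweight l x * T x) = (LINT \<xi>|lborel. fourier a1 \<xi> * leibniz S a2 l (\<xi>, - \<xi>))"
proof -
  have TG: "T x = fourier (G a1 a2 []) (- x)" for x
    unfolding T by (rule bilinear_eq_fourier_G[OF a1 a2])
  have iG: "integrable lborel (G a1 a2 [])" by (rule integrable_G[OF a1 a2])
  then have [measurable]: "G a1 a2 [] \<in> borel_measurable borel" by auto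
  have [measurable]: "T \<in> borel_measurable borel" unfolding TG[abs_def] by measurable
  define M where "M = (LINT x|lborel. norm (G a1 a2 [] x))"
  have M: "norm (T x) \<le> M" for x unfolding TG M_def by (rule fourier_bound[OF iG])
  \<comment> \<open>The exponent is spent as 2n on the integrability criterion and at most N on the
    weight.\<close>
  have Tpow: "\<exists>D. \<forall>x. norm x ^ m * norm (T x) \<le> D" if m: "m \<le> 2 * CARD('n) + N" for m
  proof -
    \<comment> \<open>A radius of at least 1 lets powers be compared by their exponents; inside it
      the sup bound \<open>M\<close> takes over.\<close>
    define R1 where "R1 = max R 1"
    have "norm x ^ m * norm (T x) \<le> max \<bar>C\<bar> (R1 ^ m * M)" for x
    proof (cases "norm x \<ge> R1")
      case True
      then have x: "norm x \<ge> 1" "norm x \<ge> R" by (auto simp: R1_def)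
      have "norm (T x) \<le> \<bar>C\<bar> * norm x powr (- real (2 * CARD('n) + N + 1))"
        using decay[OF x(2)] by (rule order_trans) (intro mult_right_mono, auto)
      then have "norm x ^ m * norm (T x) \<le> norm x ^ m * (\<bar>C\<bar> * norm x powr (- real (2 * CARD('n) + N + 1)))"
        by (intro mult_left_mono) auto
      also have "\<dots> = \<bar>C\<bar> * norm x powr (real m - real (2 * CARD('n) + N + 1))"
      proof -
        have "norm x ^ m = norm x powr real m" using x by (intro powr_realpow[symmetric]) auto
        then show ?thesis by (simp only: diff_conv_add_uminus powr_add mult_ac)
      qed
      also have "\<dots> \<le> \<bar>C\<bar> * 1"
        using x m powr_mono[of "real m - real (2 * CARD('n) + N + 1)" 0 "norm x"]
        by (intro mult_left_mono) (auto split: if_splits)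
      finally show ?thesis by simp
    next
      case False
      then have "norm x ^ m * norm (T x) \<le> R1 ^ m * M"
        using M[of x] order_trans[OF norm_ge_zero M[of x]] by (intro mult_mono power_mono) (auto simp: R1_def)
      then show ?thesis by simp
    qed
    then show ?thesis by blast
  qed
  have iT: "integrable lborel (\<lambda>x. fweight l x * T x)" if l: "set l \<subseteq> Basis" "length l \<le> N" for l
  proof -
    obtain D1 where D1: "\<And>x. norm x ^ length l * norm (T x) \<le> D1" using Tpow[of "length l"] l by auto
    obtain D2 where D2: "\<And>x. norm x ^ (2 * CARD('n) + length l) * norm (T x) \<le> D2" using Tpow[of "2 * CARD('n) + length l"] l by auto
    have b: "norm (fweight l x * T x) \<le> (2 * pi) ^ length l * (norm x ^ length l * norm (T x))" for x
      using mult_right_mono[OF norm_fweight_le[OF l(1), of x] norm_ge_zero[of "T x"]]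
      by (simp add: norm_mult power_mult_distrib mult_ac)
    show ?thesis
    proof (rule integrable_if_decay)
      show "norm (fweight l x * T x) \<le> (2 * pi) ^ length l * D1" for x
        by (rule order_trans[OF b]) (intro mult_left_mono D1, simp)
      show "norm x ^ (2 * DIM(real^'n)) * norm (fweight l x * T x) \<le> (2 * pi) ^ length l * D2" for x
      proof -
        have "norm x ^ (2 * DIM(real^'n)) * norm (fweight l x * T x) \<le> norm x ^ (2 * DIM(real^'n)) * ((2 * pi) ^ length l * (norm x ^ length l * norm (T x)))"
          by (intro mult_left_mono b) auto
        also have "\<dots> = (2 * pi) ^ length l * (norm x ^ (2 * CARD('n) + length l) * norm (T x))"
          by (simp add: power_add mult_ac)
        also have "\<dots> \<le> (2 * pi) ^ length l * D2" by (intro mult_left_mono D2) auto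
        finally show ?thesis .
      qed
    qed measurable
  qed
  have iT0: "integrable lborel T" using iT[of "[]"] by simp
  obtain B where B: "\<And>\<zeta>. norm (G a1 a2 [] \<zeta>) \<le> B" using G_bounded[OF a1 a2] by blast
  have FG: "fourier (G a1 a2 []) x = T (- x)" for x by (simp add: TG)
  have G0: "G a1 a2 [] z = fourier T z" for z
  proof -
    have "integrable lborel (fourier (G a1 a2 []))"
      unfolding FG[abs_def] using iT0 by (simp add: integrable_lborel_uminus_iff)
    from fourier_inversion[OF iG B isCont_G[OF a1 a2] this, of z]
    \<comment> \<open>The transform of G is the reflection of \<open>T\<close>, so inversion becomes
      the forward transform of \<open>T\<close> after replacing \<xi> by -\<xi>.\<close>
    have "G a1 a2 [] z = (LINT \<xi>|lborel. T (- \<xi>) * cis (- 2 * pi * ((- \<xi>) \<bullet> z)))"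
      by (simp add: FG inner_commute)
    also have "\<dots> = (LINT \<xi>|lborel. T \<xi> * cis (- 2 * pi * (\<xi> \<bullet> z)))"
      by (rule integral_lborel_reflect[of "\<lambda>\<xi>. T \<xi> * cis (- 2 * pi * (\<xi> \<bullet> z))"]) measurable
    finally show ?thesis by (simp add: fourier_def)
  qed
  \<comment> \<open>Both sides are derivatives of one function in the same directions, so uniqueness
    of derivatives carries the identity from order to order. It is finally evaluated at the origin,
    where the Fourier kernel is 1.\<close>
  have "G a1 a2 l = fourier (\<lambda>x. fweight l x * T x)" using l
  proof (induction l)
    case Nil
    then show ?case using G0 by auto
  next
    case (Cons v l)
    have IH: "G a1 a2 l = fourier (\<lambda>x. fweight l x * T x)" using Cons by simp
    have v: "v \<in> Basis" "set l \<subseteq> Basis" "length l < N" using Cons.prems by auto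
    have e: "of_real (x \<bullet> v) * (fweight l x * T x) = (1 / (- 2 * pi * \<i>)) * (fweight (v # l) x * T x)" for x
      by simp
    have i: "integrable lborel (\<lambda>x. of_real (x \<bullet> v) * (fweight l x * T x))"
      unfolding e using Cons.prems by (intro integrable_mult_right iT)
    show ?case
    proof
      fix \<zeta>
      have "((\<lambda>t. G a1 a2 l (\<zeta> + t *\<^sub>R v)) has_vector_derivative
          fourier (\<lambda>x. - 2 * pi * \<i> * of_real (x \<bullet> v) * (fweight l x * T x)) (\<zeta> + 0 *\<^sub>R v)) (at 0)"
        unfolding IH using v by (intro fourier_has_vector_derivative iT i) auto
      from vector_derivative_unique_at[OF G_deriv[OF a1 a2 v(2,3,1), of \<zeta>] this]
      show "G a1 a2 (v # l) \<zeta> = fourier (\<lambda>x. fweight (v # l) x * T x) \<zeta>"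
        by (simp add: mult.assoc)
    qed
  qed
  from fun_cong[OF this, of 0] show ?thesis by (simp add: G_def fourier_def)
qed

text \<open>Translating \<open>a1\<close> multiplies its Fourier transform by characters, so the vanishing integrals
  form the Fourier transform of an integrable function, which must therefore vanish.\<close>

lemma symbol_eq_0_if_integrals_eq_0:
  assumes l: "set l \<subseteq> Basis" "length l \<le> N"
    and lower: "\<And>b \<xi>. set b \<subseteq> Basis \<Longrightarrow> length b < length l \<Longrightarrow> \<xi> \<noteq> 0 \<Longrightarrow> S b (\<xi>, - \<xi>) = 0"
    and int: "\<And>a1 a2. a1 \<in> O_N N \<Longrightarrow> a2 \<in> O_N N \<Longrightarrow> (LINT \<xi>|lborel. fourier a1 \<xi> * leibniz S a2 l (\<xi>, - \<xi>)) = 0"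
    and \<xi>0: "\<xi>0 \<noteq> 0"
  shows "S l (\<xi>0, - \<xi>0) = 0"
proof -
  \<comment> \<open>Nonzero transforms at \<xi>0 and -\<xi>0 allow both factors to be cancelled at
    the end.\<close>
  obtain a1 where a1: "a1 \<in> O_N N" "fourier a1 \<xi>0 \<noteq> 0" using exists_O_N_fourier_nonzero[OF \<xi>0] by blast
  obtain a2 where a2: "a2 \<in> O_N N" "fourier a2 (- \<xi>0) \<noteq> 0" using exists_O_N_fourier_nonzero[of "- \<xi>0"] \<xi>0 by auto
  have f: "test_fun a1" "test_fun a2" using a1 a2 by (simp_all add: O_N_iff)
  define m where "m \<xi> = fourier a1 \<xi> * leibniz S a2 l (\<xi>, - \<xi>)" for \<xi>
  have im: "integrable lborel m"
    using G_integrand_integrable[OF f(1) a2(1) l, of 0] by (simp add: m_def[abs_def])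
  have Fm: "fourier m y = 0" for y
  proof -
    have "fourier (\<lambda>x. a1 (x + - y)) \<xi> = cis (- 2 * pi * (\<xi> \<bullet> y)) * fourier a1 \<xi>" for \<xi>
      by (subst fourier_translate) (simp_all add: test_fun_measurable f inner_commute)
    then have "(LINT \<xi>|lborel. fourier (\<lambda>x. a1 (x + - y)) \<xi> * leibniz S a2 l (\<xi>, - \<xi>)) = fourier m y"
      unfolding fourier_def[of m] by (intro Bochner_Integration.integral_cong refl) (simp only: m_def mult_ac)
    then show ?thesis using int[OF O_N_translate[OF a1(1), of "- y"] a2(1)] by simp
  qed
  obtain C where C: "\<And>z. norm (leibniz S a2 l z) \<le> C" using leibniz_bounded[OF a2(1) l] by blast
  define B where "B = (LINT x|lborel. norm (a1 x))"
  have B: "norm (fourier a1 \<xi>) \<le> B" for \<xi> unfolding B_def by (rule fourier_bound[OF test_fun_integrable[OF f(1)]])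
  have mb: "norm (m \<xi>) \<le> B * C" for \<xi>
    unfolding m_def norm_mult using order_trans[OF norm_ge_zero B] by (intro mult_mono B C) auto
  \<comment> \<open>Inversion is pointwise, so continuity at \<xi>0 is enough; (\<xi>0, -\<xi>0)
    lies off the axes, where \<open>leibniz\<close> is continuous also at order N.\<close>
  have "isCont (leibniz S a2 l) (\<xi>0, - \<xi>0)"
    using continuous_on_leibniz[OF f(2) l(1)] \<xi>0 by (simp add: continuous_on_eq_continuous_at[OF open_off_axes])
  then have "isCont (\<lambda>\<xi>. leibniz S a2 l (\<xi>, - \<xi>)) \<xi>0"
    by (intro isCont_o2[of \<xi>0 "\<lambda>\<xi>. (\<xi>, - \<xi>)" "leibniz S a2 l"] continuous_intros)
  then have "isCont m \<xi>0" unfolding m_def[abs_def]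
    by (intro isCont_mult fourier_continuous test_fun_integrable f)
  from fourier_inversion[OF im mb this] have "m \<xi>0 = 0" by (simp add: Fm[abs_def])
  then have "leibniz S a2 l (\<xi>0, - \<xi>0) = 0" using a1(2) by (simp add: m_def)
  moreover have "leibniz S a2 l (\<xi>0, - \<xi>0) = (\<Sum>(b, c)\<leftarrow>splits l. S b (\<xi>0, - \<xi>0) * fourier (\<lambda>x. fweight c x * a2 x) (- \<xi>0))"
    using \<xi>0 by (simp add: leibniz_def)
  \<comment> \<open>Lower derivatives of the symbol vanish here, so only the split with nothing on
    the transform remains; its weight is 1.\<close>
  moreover have "\<dots> = S l (\<xi>0, - \<xi>0) * fourier (\<lambda>x. fweight [] x * a2 x) (- \<xi>0)"
    by (rule sum_list_splits_top[where g="\<lambda>b c. S b (\<xi>0, - \<xi>0) * fourier (\<lambda>x. fweight c x * a2 x) (- \<xi>0)"])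
      (use l lower \<xi>0 in auto)
  ultimately show ?thesis using a2(2) by simp
qed

end

section \<open>From multi-index derivatives of the multiplier to the list-indexed symbol\<close>

lemma mlist_zero: "mlist (\<lambda>_::'n::finite. 0) = []"
proof (cases "mlist (\<lambda>_::'n. 0)")
  case (Cons i l)
  then show ?thesis using count_list_mlist[of "\<lambda>_. 0" i] by simp
qed

lemma pd2_second_variable: "pd2 (\<lambda>_. 0) \<alpha> f = dders (map (Pair 0) (vlist \<alpha>)) f"
  by (simp add: pd2_def mlist_zero vlist_def comp_def)

lemma Pair_zero_Basis: "set b \<subseteq> Basis \<Longrightarrow> set (map (Pair 0) b) \<subseteq> Basis"
  by (auto simp: Basis_prod_def)

lemma dders_eq_pd2:
  fixes f :: "(real^'n) \<times> (real^'n) \<Rightarrow> complex"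
  assumes f: "smooth_on off_axes f" and b: "set b \<subseteq> Basis" and z: "z \<in> off_axes"
  shows "dders (map (Pair 0) b) f z = pd2 (\<lambda>_. 0) (multi_index b) f z"
  unfolding pd2_second_variable
proof (rule dders_perm[OF open_off_axes f _ Pair_zero_Basis[OF b] z])
  show "mset (map (Pair 0) b) = mset (map (Pair 0) (vlist (multi_index b)))"
    by (simp only: mset_map mset_vlist_multi_index[OF b])
qed

lemma second_variable_symbol_dders:
  fixes \<sigma> :: "(real^'n) \<times> (real^'n) \<Rightarrow> complex"
  assumes f: "smooth_on off_axes \<sigma>"
    and symb: "\<And>\<alpha>. \<exists>C. \<forall>\<xi> \<eta>. \<xi> \<noteq> 0 \<longrightarrow> \<eta> \<noteq> 0 \<longrightarrow>
               norm (pd2 (\<lambda>_. 0) \<alpha> \<sigma> (\<xi>, \<eta>)) \<le> C * norm \<eta> powr (- real (mabs \<alpha>))"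
  shows "second_variable_symbol (\<lambda>b. dders (map (Pair 0) b) \<sigma>)"
proof
  fix b :: "(real^'n) list" assume b: "set b \<subseteq> Basis"
  show "continuous_on off_axes (dders (map (Pair 0) b) \<sigma>)"
    by (rule smooth_on_continuous[OF f Pair_zero_Basis[OF b]])
  show "((\<lambda>t. dders (map (Pair 0) b) \<sigma> (\<xi>, \<eta> + t *\<^sub>R v)) has_vector_derivative
      dders (map (Pair 0) (v # b)) \<sigma> (\<xi>, \<eta>)) (at 0)" if "v \<in> Basis" "\<xi> \<noteq> 0" "\<eta> \<noteq> 0" for v \<xi> \<eta>
  proof -
    have "(0, v) \<in> (Basis :: ((real^'n) \<times> (real^'n)) set)" using that by (auto simp: Basis_prod_def)
    from smooth_on_has_vector_derivative[OF f Pair_zero_Basis[OF b] this, of "(\<xi>, \<eta>)" 0] that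
    show ?thesis by simp
  qed
  obtain C where C: "\<And>\<xi> \<eta>. \<xi> \<noteq> 0 \<Longrightarrow> \<eta> \<noteq> 0 \<Longrightarrow>
      norm (pd2 (\<lambda>_. 0) (multi_index b) \<sigma> (\<xi>, \<eta>)) \<le> C * norm \<eta> powr (- real (mabs (multi_index b)))"
    using symb[of "multi_index b"] by blast
  have "norm (dders (map (Pair 0) b) \<sigma> z) * norm (snd z) ^ length b \<le> C" if z: "z \<in> off_axes" for z
  proof -
    have nz: "fst z \<noteq> 0" "snd z \<noteq> 0" using z by auto
    have "norm (dders (map (Pair 0) b) \<sigma> z) \<le> C * norm (snd z) powr (- real (length b))"
      using C[OF nz] by (simp add: dders_eq_pd2[OF f b z] mabs_multi_index[OF b])
    then have "norm (dders (map (Pair 0) b) \<sigma> z) * norm (snd z) ^ length b \<le> C * norm (snd z) powr (- real (length b)) * norm (snd z) ^ length b"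
      by (rule mult_right_mono) simp
    also have "\<dots> = C" using nz by (simp add: powr_minus powr_realpow)
    finally show ?thesis .
  qed
  then show "\<exists>C. \<forall>z\<in>off_axes. norm (dders (map (Pair 0) b) \<sigma> z) * norm (snd z) ^ length b \<le> C" by blast
qed

lemma fourier_zero_O_N:
  assumes "a \<in> O_N N" shows "fourier a 0 = 0"
  using vanishing_momentsD[of "Suc N" a "[]"] assms by (simp add: O_N_iff fourier_def)

text \<open>On the axes the multiplier is arbitrary while \<open>leibniz\<close> is 0; the
  integrands nevertheless agree at every point, because both transforms vanish at the
  origin.\<close>

lemma Tsig_eq_leibniz:
  assumes a1: "a1 \<in> O_N N" and a2: "a2 \<in> O_N N"
  shows "Tsig \<sigma> a1 a2 x = (LINT z|lborel. cis (2 * pi * (x \<bullet> (fst z + snd z)))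
     * (fourier a1 (fst z) * leibniz (\<lambda>b. dders (map (Pair 0) b) \<sigma>) a2 [] z))"
  unfolding Tsig_def
proof (rule Bochner_Integration.integral_cong)
  fix z :: "(real^'a) \<times> (real^'a)"
  have "\<sigma> z * fourier a1 (fst z) * fourier a2 (snd z) = fourier a1 (fst z) * leibniz (\<lambda>b. dders (map (Pair 0) b) \<sigma>) a2 [] z"
    using fourier_zero_O_N[OF a1] fourier_zero_O_N[OF a2] by (auto simp: leibniz_def)
  then show "cis (2 * pi * (x \<bullet> (fst z + snd z))) * \<sigma> z * fourier a1 (fst z) * fourier a2 (snd z) =
      cis (2 * pi * (x \<bullet> (fst z + snd z))) * (fourier a1 (fst z) * leibniz (\<lambda>b. dders (map (Pair 0) b) \<sigma>) a2 [] z)"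
    by (simp only: mult.assoc)
qed simp

theorem theorem3p1:
  fixes N :: nat and \<sigma> :: "(real^'n) \<times> (real^'n) \<Rightarrow> complex"
  assumes Linf: "\<sigma> \<in> borel_measurable lborel" "\<exists>C. AE z in lborel. norm (\<sigma> z) \<le> C"
    and smooth: "smooth_on {(\<xi>, \<eta>). norm \<xi> * norm \<eta> \<noteq> 0} \<sigma>"
    and symb: "\<And>\<alpha>1 \<alpha>2. \<exists>C. \<forall>\<xi> \<eta>. \<xi> \<noteq> 0 \<longrightarrow> \<eta> \<noteq> 0 \<longrightarrow>
               norm (pd2 \<alpha>1 \<alpha>2 \<sigma> (\<xi>, \<eta>)) \<le> C * norm \<xi> powr (- real (mabs \<alpha>1)) * norm \<eta> powr (- real (mabs \<alpha>2))"
    and decay: "\<And>a1 a2. a1 \<in> O_N N \<Longrightarrow> a2 \<in> O_N N \<Longrightarrow>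
               \<exists>b :: real^'n \<Rightarrow> real.
                 (\<forall>K. compact K \<longrightarrow> set_integrable lborel K b) \<and>
                 (\<exists>C R. \<forall>x. norm x \<ge> R \<longrightarrow> b x \<le> C * norm x powr (- real (2 * CARD('n) + N + 1))) \<and>
                 (\<forall>x. norm (Tsig \<sigma> a1 a2 x) \<le> b x)"
  shows "(\<forall>\<alpha>. mabs \<alpha> \<le> N \<longrightarrow> (\<forall>\<xi>1. \<xi>1 \<noteq> 0 \<longrightarrow> pd2 (\<lambda>_. 0) \<alpha> \<sigma> (\<xi>1, - \<xi>1) = 0))
     \<longleftrightarrow> (\<forall>a1 \<in> O_N N. \<forall>a2 \<in> O_N N. \<forall>\<alpha>. mabs \<alpha> \<le> N \<longrightarrow>
            (LINT x|lborel. of_real (monom \<alpha> x) * Tsig \<sigma> a1 a2 x) = 0)"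
proof -
  define S where "S b = dders (map (Pair 0) b) \<sigma>" for b :: "(real^'n) list"
  have "{(\<xi>, \<eta>). norm \<xi> * norm \<eta> \<noteq> 0} = (off_axes :: ((real^'n) \<times> (real^'n)) set)" by auto
  with smooth have sm: "smooth_on off_axes \<sigma>" by simp
  have "\<exists>C. \<forall>\<xi> \<eta>. \<xi> \<noteq> 0 \<longrightarrow> \<eta> \<noteq> 0 \<longrightarrow>
      norm (pd2 (\<lambda>_. 0) \<alpha> \<sigma> (\<xi>, \<eta>)) \<le> C * norm \<eta> powr (- real (mabs \<alpha>))" for \<alpha>
  proof -
    obtain C where C: "\<And>\<xi> \<eta>. \<xi> \<noteq> 0 \<Longrightarrow> \<eta> \<noteq> 0 \<Longrightarrow> norm (pd2 (\<lambda>_. 0) \<alpha> \<sigma> (\<xi>, \<eta>)) \<le>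
       C * norm \<xi> powr (- real (mabs (\<lambda>_::'n. 0))) * norm \<eta> powr (- real (mabs \<alpha>))"
      using symb[of "\<lambda>_. 0" \<alpha>] by blast
    have "norm (pd2 (\<lambda>_. 0) \<alpha> \<sigma> (\<xi>, \<eta>)) \<le> C * norm \<eta> powr (- real (mabs \<alpha>))" if "\<xi> \<noteq> 0" "\<eta> \<noteq> 0" for \<xi> \<eta>
      using C[OF that] that by (simp add: mabs_def)
    then show ?thesis by blast
  qed
  then interpret second_variable_symbol S
    unfolding S_def[abs_def] by (rule second_variable_symbol_dders[OF sm])
  have S_pd2: "S b (\<xi>, - \<xi>) = pd2 (\<lambda>_. 0) (multi_index b) \<sigma> (\<xi>, - \<xi>)" if "set b \<subseteq> Basis" "\<xi> \<noteq> 0" for b \<xi>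
    unfolding S_def using that by (intro dders_eq_pd2[OF sm]) auto
  have moments: "(LINT x|lborel. fweight l x * Tsig \<sigma> a1 a2 x) = (LINT \<xi>|lborel. fourier a1 \<xi> * leibniz S a2 l (\<xi>, - \<xi>))"
    if a: "a1 \<in> O_N N" "a2 \<in> O_N N" and l: "set l \<subseteq> Basis" "length l \<le> N" for a1 a2 l
  proof -
    obtain b C R where b: "\<And>x. norm x \<ge> R \<Longrightarrow> b x \<le> C * norm x powr (- real (2 * CARD('n) + N + 1))"
      "\<And>x. norm (Tsig \<sigma> a1 a2 x) \<le> b x"
      using decay[OF a] by blast
    show ?thesis
    proof (rule moments_eq[OF _ a(2) _ _ l])
      show "test_fun a1" using a by (simp add: O_N_iff)
      show "norm (Tsig \<sigma> a1 a2 x) \<le> C * norm x powr (- real (2 * CARD('n) + N + 1))" if "norm x \<ge> R" for x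
        using b(1)[OF that] b(2)[of x] by (rule order_trans[rotated])
    qed (simp only: Tsig_eq_leibniz[OF a] S_def[abs_def])
  qed
  have cond_a: "(\<forall>\<alpha>. mabs \<alpha> \<le> N \<longrightarrow> (\<forall>\<xi>1. \<xi>1 \<noteq> 0 \<longrightarrow> pd2 (\<lambda>_. 0) \<alpha> \<sigma> (\<xi>1, - \<xi>1) = 0))
     \<longleftrightarrow> (\<forall>b \<xi>. set b \<subseteq> Basis \<longrightarrow> length b \<le> N \<longrightarrow> \<xi> \<noteq> 0 \<longrightarrow> S b (\<xi>, - \<xi>) = 0)" (is "?A \<longleftrightarrow> ?A'")
  proof
    assume ?A then show ?A' by (simp add: S_pd2 mabs_multi_index)
  next
    assume A': ?A'
    show ?A
    proof (intro allI impI)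
      fix \<alpha> :: "'n \<Rightarrow> nat" and \<xi> :: "real^'n" assume "mabs \<alpha> \<le> N" "\<xi> \<noteq> 0"
      then show "pd2 (\<lambda>_. 0) \<alpha> \<sigma> (\<xi>, - \<xi>) = 0"
        using A' S_pd2[OF set_vlist, of \<xi> \<alpha>] by (simp add: multi_index_vlist length_vlist set_vlist)
    qed
  qed
  have cond_b: "(\<forall>\<alpha>. mabs \<alpha> \<le> N \<longrightarrow> (LINT x|lborel. of_real (monom \<alpha> x) * Tsig \<sigma> a1 a2 x) = 0)
     \<longleftrightarrow> (\<forall>l. set l \<subseteq> Basis \<longrightarrow> length l \<le> N \<longrightarrow> (LINT \<xi>|lborel. fourier a1 \<xi> * leibniz S a2 l (\<xi>, - \<xi>)) = 0)"
    if a: "a1 \<in> O_N N" "a2 \<in> O_N N" for a1 a2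
    unfolding monom_moments_iff vanishing_moments_def using moments[OF a] by (auto simp: less_Suc_eq_le)
  show ?thesis unfolding cond_a
  proof
    assume A: "\<forall>b \<xi>. set b \<subseteq> Basis \<longrightarrow> length b \<le> N \<longrightarrow> \<xi> \<noteq> 0 \<longrightarrow> S b (\<xi>, - \<xi>) = 0"
    \<comment> \<open>Every Leibniz term carries a derivative of the symbol of order at most
      \<open>N\<close> on the antidiagonal; at \<xi> = 0 the default value applies.\<close>
    have "leibniz S a2 l (\<xi>, - \<xi>) = 0" if l: "set l \<subseteq> Basis" "length l \<le> N" for a2 l \<xi>
    proof (cases "\<xi> = 0")
      case False
      have "(\<Sum>(b, c)\<leftarrow>splits l. S b (\<xi>, - \<xi>) * fourier (\<lambda>x. fweight c x * a2 x) (- \<xi>)) = (\<Sum>p\<leftarrow>splits l. 0)"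
      proof (intro arg_cong[where f=sum_list] map_cong refl, clarify)
        fix b c assume bc: "(b, c) \<in> set (splits l)"
        then have "S b (\<xi>, - \<xi>) = 0"
          using A splits_length[OF bc] splits_subset[OF bc] l False by auto
        then show "S b (\<xi>, - \<xi>) * fourier (\<lambda>x. fweight c x * a2 x) (- \<xi>) = 0" by simp
      qed
      then show ?thesis by (simp add: leibniz_def)
    qed (simp add: leibniz_def)
    then show "\<forall>a1 \<in> O_N N. \<forall>a2 \<in> O_N N. \<forall>\<alpha>. mabs \<alpha> \<le> N \<longrightarrow>
            (LINT x|lborel. of_real (monom \<alpha> x) * Tsig \<sigma> a1 a2 x) = 0"
      by (simp add: cond_b)
  next
    assume B: "\<forall>a1 \<in> O_N N. \<forall>a2 \<in> O_N N. \<forall>\<alpha>. mabs \<alpha> \<le> N \<longrightarrow>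
            (LINT x|lborel. of_real (monom \<alpha> x) * Tsig \<sigma> a1 a2 x) = 0"
    have "S l (\<xi>, - \<xi>) = 0" if "set l \<subseteq> Basis" "length l \<le> N" "\<xi> \<noteq> 0" for l \<xi>
      using that
    \<comment> \<open>Strong induction on the order: isolating the top Leibniz term requires all
      lower derivatives to vanish on the antidiagonal.\<close>
    proof (induction "length l" arbitrary: l \<xi> rule: less_induct)
      case less
      show ?case
      proof (rule symbol_eq_0_if_integrals_eq_0[OF less.prems(1,2) _ _ less.prems(3)])
        show "S b (\<xi>', - \<xi>') = 0" if "set b \<subseteq> Basis" "length b < length l" "\<xi>' \<noteq> 0" for b \<xi>'
          using that less.prems by (intro less.hyps) auto
        show "(LINT \<xi>|lborel. fourier a1 \<xi> * leibniz S a2 l (\<xi>, - \<xi>)) = 0" if "a1 \<in> O_N N" "a2 \<in> O_N N" for a1 a2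
          using B that less.prems by (simp add: cond_b)
      qed
    qed
    then show "\<forall>b \<xi>. set b \<subseteq> Basis \<longrightarrow> length b \<le> N \<longrightarrow> \<xi> \<noteq> 0 \<longrightarrow> S b (\<xi>, - \<xi>) = 0" by blast
  qed
qed

end
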